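(* Let $V$ be an affine toric $\mathbb{R}$-variety and let $S\subseteq V(\mathbb{R})$ be a semi-algebraic set. Assume that there exists a toric completion $V\subseteq X$ of $V$ which is compatible with $S$. Then $L_{X,n}(S)$ is finitely generated as a module over $B_V(S)$, for every $n\ge0$.
   Context: Toric varieties are normal varieties over $\mathbb{R}$ with an action of a split torus $T$ having a dense orbit isomorphic to $T$, i.e. those given by fans. A toric completion of $V$ is an open embedding of $V$ into a complete toric variety $X$ compatible with the torus actions. It is compatible with $S$ if for every irreducible component $Z$ of $X\setminus V$ the set $Z(\mathbb{R})\cap\overline{S}$ is either empty or Zariski-dense in $Z$, where $\overline{S}$ is the closure of $S$ in $X(\mathbb{R})$ in the Euclidean topology. $B_V(S)=\{f\in\mathbb{R}[V]:\exists\lambda\in\mathbb{R}\ |f|\le\lambda\text{ on }S\}$. Let $Y$ (resp. $Y'$) be the union of those irreducible components $Z$ of $X\setminus V$ (all of which have codimension one) for which $\overline{S}\cap Z(\mathbb{R})$ is empty (resp. non-empty), and $U=X\setminus Y$. For $n\ge0$, $L_{X,n}(S)=\Gamma(U,\mathcal{O}_X(nY'))$, considered as a subspace of $\mathbb{R}[V]$: $L_{X,n}(S)=\{f\in\mathbb{R}[V]:\mathrm{ord}_Z(f)\ge-n\text{ for all irreducible components }Z\text{ of }Y'\}$. Each $L_{X,n}(S)$ is a module over $B_V(S)=L_{X,0}(S)$. *)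

theory Defs
  imports "HOL-Analysis.Analysis" "HOL-Library.Poly_Mapping"
begin

section \<open>Lattices, cones and fans\<close>

text \<open>
  The cocharacter lattice \<open>N\<close> of the split torus is a lattice in some Euclidean space. It need not
  span that space, so that every rank, including rank zero, is covered. Its real
  span is \<open>N\<^sub>\<real>\<close>, and the inner product identifies the character lattice with \<open>dual_lattice N\<close>.
\<close>

definition is_lattice :: "'a::euclidean_space set \<Rightarrow> bool" where
  "is_lattice N \<longleftrightarrow>
     (\<exists>B. independent B \<and> N = range (\<lambda>c :: 'a \<Rightarrow> int. \<Sum>b\<in>B. of_int (c b) *\<^sub>R b))"

definition dual_lattice :: "'a::euclidean_space set \<Rightarrow> 'a set" where
  "dual_lattice N = {m \<in> span N. \<forall>u\<in>N. m \<bullet> u \<in> \<int>}"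

definition strongly_convex_rational_cone :: "'a::euclidean_space set \<Rightarrow> 'a set \<Rightarrow> bool" where
  "strongly_convex_rational_cone N \<sigma> \<longleftrightarrow>
     (\<exists>G. finite G \<and> G \<subseteq> N \<and> \<sigma> = convex_cone hull G) \<and> \<sigma> \<inter> uminus ` \<sigma> = {0}"

text \<open>The library relation \<open>face_of\<close> counts the empty set as a face; fans do not.\<close>

definition is_fan :: "'a::euclidean_space set \<Rightarrow> 'a set set \<Rightarrow> bool" where
  "is_fan N \<Sigma> \<longleftrightarrow>
     finite \<Sigma> \<and>
     (\<forall>\<tau>\<in>\<Sigma>. strongly_convex_rational_cone N \<tau>) \<and>
     (\<forall>\<tau>\<in>\<Sigma>. \<forall>F. F face_of \<tau> \<and> F \<noteq> {} \<longrightarrow> F \<in> \<Sigma>) \<and>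
     (\<forall>\<tau>\<in>\<Sigma>. \<forall>\<tau>'\<in>\<Sigma>. (\<tau> \<inter> \<tau>') face_of \<tau> \<and> (\<tau> \<inter> \<tau>') face_of \<tau>')"

section \<open>Affine toric varieties\<close>

text \<open>
  A finitely supported function \<open>f\<close> on the character lattice stands for the Laurent polynomial
  \<open>\<Sum>m. f(m) \<chi>\<^sup>m\<close>, so that multiplication is convolution.
  The coordinate ring of the affine toric variety \<open>U\<^sub>\<tau>\<close> consists of those \<open>f\<close> whose support lies
  in the dual cone of \<open>\<tau>\<close>.
\<close>

definition coordinate_ring :: "'a::euclidean_space set \<Rightarrow> 'a set \<Rightarrow> ('a \<Rightarrow>\<^sub>0 real) set" where
  "coordinate_ring N \<tau> =
     {f. Poly_Mapping.keys f \<subseteq> {m \<in> dual_lattice N. \<forall>u\<in>\<tau>. 0 \<le> m \<bullet> u}}"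

text \<open>
  A variety over \<open>\<real>\<close> is represented by its complex points together with the Zariski
  topology whose closed sets are defined by \<^emph>\<open>real\<close> equations. Complex conjugate points are not
  separated by this topology, and its closed sets correspond to those of the
  underlying scheme. Real points are the complex points at which all
  regular functions take real values. A point of an affine variety is an \<open>\<real>\<close>-algebra homomorphism
  \<open>x\<close> on the coordinate ring, so the value of \<open>f\<close> at \<open>x\<close> is \<open>x f\<close>.
\<close>

type_synonym 'a point = "('a \<Rightarrow>\<^sub>0 real) \<Rightarrow> complex"

definition points :: "('a::euclidean_space \<Rightarrow>\<^sub>0 real) set \<Rightarrow> 'a point set" where
  "points A = {x \<in> extensional A.
     (\<forall>c. x (Poly_Mapping.single 0 c) = of_real c) \<and>
     (\<forall>f\<in>A. \<forall>g\<in>A. x (f + g) = x f + x g \<and> x (f * g) = x f * x g)}"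

definition real_points :: "('a::euclidean_space \<Rightarrow>\<^sub>0 real) set \<Rightarrow> 'a point set" where
  "real_points A = {x \<in> points A. \<forall>f\<in>A. x f \<in> \<real>}"

definition affine_zariski :: "('a::euclidean_space \<Rightarrow>\<^sub>0 real) set \<Rightarrow> 'a point topology" where
  "affine_zariski A = topology_generated_by {{x \<in> points A. x f \<noteq> 0} | f. f \<in> A}"

text \<open>
  The Euclidean topology on the real points is that of pointwise convergence on the coordinate
  ring, which is the one induced by any closed embedding into an affine space.
\<close>

definition affine_euclidean :: "('a::euclidean_space \<Rightarrow>\<^sub>0 real) set \<Rightarrow> 'a point topology" where
  "affine_euclidean A = subtopology (product_topology (\<lambda>f. euclidean) A) (real_points A)"

inductive_set semialgebraic_sets ::
  "('a::euclidean_space \<Rightarrow>\<^sub>0 real) set \<Rightarrow> 'a point set set" for A where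
  pos: "f \<in> A \<Longrightarrow> {x \<in> real_points A. 0 < Re (x f)} \<in> semialgebraic_sets A"
| compl: "S \<in> semialgebraic_sets A \<Longrightarrow> real_points A - S \<in> semialgebraic_sets A"
| union: "S \<in> semialgebraic_sets A \<Longrightarrow> S' \<in> semialgebraic_sets A \<Longrightarrow>
    S \<union> S' \<in> semialgebraic_sets A"

definition bounded_functions ::
  "('a::euclidean_space \<Rightarrow>\<^sub>0 real) set \<Rightarrow> 'a point set \<Rightarrow> ('a \<Rightarrow>\<^sub>0 real) set" where
  "bounded_functions A S = {f \<in> A. \<exists>c::real. \<forall>x\<in>S. norm (x f) \<le> c}"

section \<open>The toric variety of a fan\<close>

text \<open>
  Points \<open>x\<close> of \<open>U\<^sub>\<tau>\<close> and \<open>x'\<close> of \<open>U\<^sub>\<tau>\<^sub>'\<close> are identified when they are images of the same point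
  of \<open>U\<close> of the common face \<open>\<tau> \<inter> \<tau>'\<close>.
\<close>

definition glue :: "'a::euclidean_space set \<Rightarrow> 'a set set \<Rightarrow>
    (('a set \<times> 'a point) \<times> ('a set \<times> 'a point)) set" where
  "glue N \<Sigma> = {((\<tau>, restrict y (coordinate_ring N \<tau>)), (\<tau>', restrict y (coordinate_ring N \<tau>')))
     | \<tau> \<tau>' y. \<tau> \<in> \<Sigma> \<and> \<tau>' \<in> \<Sigma> \<and> y \<in> points (coordinate_ring N (\<tau> \<inter> \<tau>'))}"

type_synonym 'a toric_point = "('a set \<times> 'a point) set"

definition chart :: "'a::euclidean_space set \<Rightarrow> 'a set set \<Rightarrow> 'a set \<Rightarrow> 'a point \<Rightarrow> 'a toric_point"
  where "chart N \<Sigma> \<tau> x = glue N \<Sigma> `` {(\<tau>, x)}"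

definition toric_variety :: "'a::euclidean_space set \<Rightarrow> 'a set set \<Rightarrow> 'a toric_point set" where
  "toric_variety N \<Sigma> = (SIGMA \<tau>:\<Sigma>. points (coordinate_ring N \<tau>)) // glue N \<Sigma>"

definition toric_real_points :: "'a::euclidean_space set \<Rightarrow> 'a set set \<Rightarrow> 'a toric_point set" where
  "toric_real_points N \<Sigma> = (\<Union>\<tau>\<in>\<Sigma>. chart N \<Sigma> \<tau> ` real_points (coordinate_ring N \<tau>))"

definition final_topology ::
  "'i set \<Rightarrow> ('i \<Rightarrow> 'b topology) \<Rightarrow> ('i \<Rightarrow> 'b \<Rightarrow> 'c) \<Rightarrow> 'c set \<Rightarrow> 'c topology" where
  "final_topology I T q Y =
     topology (\<lambda>W. W \<subseteq> Y \<and> (\<forall>i\<in>I. openin (T i) {x \<in> topspace (T i). q i x \<in> W}))"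

lemma openin_final_topology:
  "openin (final_topology I T q Y) W \<longleftrightarrow>
     W \<subseteq> Y \<and> (\<forall>i\<in>I. openin (T i) {x \<in> topspace (T i). q i x \<in> W})"
proof -
  let ?P = "\<lambda>W. W \<subseteq> Y \<and> (\<forall>i\<in>I. openin (T i) {x \<in> topspace (T i). q i x \<in> W})"
  have "?P (W1 \<inter> W2)" if "?P W1" "?P W2" for W1 W2
  proof -
    have "{x \<in> topspace (T i). q i x \<in> W1 \<inter> W2} =
        {x \<in> topspace (T i). q i x \<in> W1} \<inter> {x \<in> topspace (T i). q i x \<in> W2}" for i
      by auto
    then show ?thesis using that by auto
  qed
  moreover have "?P (\<Union>K)" if "\<forall>W\<in>K. ?P W" for K
  proof -
    have "{x \<in> topspace (T i). q i x \<in> \<Union>K} = (\<Union>W\<in>K. {x \<in> topspace (T i). q i x \<in> W})" for i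
      by auto
    then show ?thesis using that by auto
  qed
  ultimately have "istopology ?P"
    unfolding istopology_def by blast
  then show ?thesis
    by (simp add: final_topology_def topology_inverse')
qed

definition toric_zariski :: "'a::euclidean_space set \<Rightarrow> 'a set set \<Rightarrow> 'a toric_point topology" where
  "toric_zariski N \<Sigma> =
     final_topology \<Sigma> (\<lambda>\<tau>. affine_zariski (coordinate_ring N \<tau>)) (chart N \<Sigma>) (toric_variety N \<Sigma>)"

definition toric_euclidean :: "'a::euclidean_space set \<Rightarrow> 'a set set \<Rightarrow> 'a toric_point topology" where
  "toric_euclidean N \<Sigma> =
     final_topology \<Sigma> (\<lambda>\<tau>. affine_euclidean (coordinate_ring N \<tau>)) (chart N \<Sigma>)
       (toric_real_points N \<Sigma>)"

section \<open>Completeness\<close>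

text \<open>
  A variety \<open>X\<close> is complete if the projection \<open>X \<times> Y \<rightarrow> Y\<close> is closed for all varieties \<open>Y\<close>. Closedness
  is local on \<open>Y\<close> and passes to closed subvarieties of \<open>Y\<close>, so \<open>Y\<close> ranges over affine spaces.
  The coordinate ring of \<open>U\<^sub>\<tau> \<times> \<bbbA>\<^sup>k\<close> consists of the polynomials in \<open>k\<close> variables with coefficients
  in the coordinate ring of \<open>U\<^sub>\<tau>\<close>.
\<close>

definition affine_space :: "nat \<Rightarrow> (nat \<Rightarrow> complex) set" where
  "affine_space k = {..<k} \<rightarrow>\<^sub>E UNIV"

definition polynomials :: "nat \<Rightarrow> 'c::zero set \<Rightarrow> ((nat \<Rightarrow>\<^sub>0 nat) \<Rightarrow>\<^sub>0 'c) set" where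
  "polynomials k A = {F. (\<forall>\<alpha>\<in>Poly_Mapping.keys F. Poly_Mapping.keys \<alpha> \<subseteq> {..<k}) \<and>
     (\<forall>\<alpha>\<in>Poly_Mapping.keys F. Poly_Mapping.lookup F \<alpha> \<in> A)}"

definition eval_polynomial ::
  "nat \<Rightarrow> ('c::zero \<Rightarrow> complex) \<Rightarrow> ((nat \<Rightarrow>\<^sub>0 nat) \<Rightarrow>\<^sub>0 'c) \<Rightarrow> (nat \<Rightarrow> complex) \<Rightarrow> complex" where
  "eval_polynomial k x F t = (\<Sum>\<alpha>\<in>Poly_Mapping.keys F.
     x (Poly_Mapping.lookup F \<alpha>) * (\<Prod>i<k. t i ^ Poly_Mapping.lookup \<alpha> i))"

definition affine_space_zariski :: "nat \<Rightarrow> (nat \<Rightarrow> complex) topology" where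
  "affine_space_zariski k = topology_generated_by
     {{t \<in> affine_space k. eval_polynomial k of_real F t \<noteq> 0} | F. F \<in> polynomials k (UNIV :: real set)}"

definition affine_product_zariski :: "nat \<Rightarrow> ('a::euclidean_space \<Rightarrow>\<^sub>0 real) set \<Rightarrow>
    ('a point \<times> (nat \<Rightarrow> complex)) topology" where
  "affine_product_zariski k A = topology_generated_by
     {{(x, t) \<in> points A \<times> affine_space k. eval_polynomial k x F t \<noteq> 0} | F. F \<in> polynomials k A}"

definition toric_product_zariski :: "nat \<Rightarrow> 'a::euclidean_space set \<Rightarrow> 'a set set \<Rightarrow>
    ('a toric_point \<times> (nat \<Rightarrow> complex)) topology" where
  "toric_product_zariski k N \<Sigma> =
     final_topology \<Sigma> (\<lambda>\<tau>. affine_product_zariski k (coordinate_ring N \<tau>))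
       (\<lambda>\<tau> (x, t). (chart N \<Sigma> \<tau> x, t)) (toric_variety N \<Sigma> \<times> affine_space k)"

definition complete_toric_variety :: "'a::euclidean_space set \<Rightarrow> 'a set set \<Rightarrow> bool" where
  "complete_toric_variety N \<Sigma> \<longleftrightarrow> is_fan N \<Sigma> \<and>
     (\<forall>k. closed_map (toric_product_zariski k N \<Sigma>) (affine_space_zariski k) snd)"

section \<open>Toric completions and the modules \<open>L\<^sub>X\<^sub>,\<^sub>n(S)\<close>\<close>

text \<open>
  Open embeddings of \<open>U\<^sub>\<sigma>\<close> that are compatible with the torus actions are, after identifying the
  tori, the inclusions of charts of fans that have \<open>\<sigma>\<close> as a member.
\<close>

definition toric_completion :: "'a::euclidean_space set \<Rightarrow> 'a set \<Rightarrow> 'a set set \<Rightarrow> bool" where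
  "toric_completion N \<sigma> \<Sigma> \<longleftrightarrow> complete_toric_variety N \<Sigma> \<and> \<sigma> \<in> \<Sigma>"

definition irreducible_in :: "'b topology \<Rightarrow> 'b set \<Rightarrow> bool" where
  "irreducible_in T Z \<longleftrightarrow> Z \<subseteq> topspace T \<and> Z \<noteq> {} \<and>
     (\<forall>C D. closedin T C \<and> closedin T D \<and> Z \<subseteq> C \<union> D \<longrightarrow> Z \<subseteq> C \<or> Z \<subseteq> D)"

definition irreducible_components :: "'b topology \<Rightarrow> 'b set \<Rightarrow> 'b set set" where
  "irreducible_components T Y = {Z. Z \<subseteq> Y \<and> irreducible_in T Z \<and>
     (\<forall>Z'. irreducible_in T Z' \<and> Z \<subseteq> Z' \<and> Z' \<subseteq> Y \<longrightarrow> Z' = Z)}"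

definition boundary_components ::
  "'a::euclidean_space set \<Rightarrow> 'a set \<Rightarrow> 'a set set \<Rightarrow> 'a toric_point set set" where
  "boundary_components N \<sigma> \<Sigma> = irreducible_components (toric_zariski N \<Sigma>)
     (toric_variety N \<Sigma> - chart N \<Sigma> \<sigma> ` points (coordinate_ring N \<sigma>))"

definition real_closure :: "'a::euclidean_space set \<Rightarrow> 'a set \<Rightarrow> 'a set set \<Rightarrow> 'a point set \<Rightarrow>
    'a toric_point set" where
  "real_closure N \<sigma> \<Sigma> S = toric_euclidean N \<Sigma> closure_of (chart N \<Sigma> \<sigma> ` S)"

text \<open>The closure of \<open>S\<close> consists of real points, so its intersections with \<open>Z\<close> and with the real
  points of \<open>Z\<close> agree.\<close>

definition compatible_completion ::
  "'a::euclidean_space set \<Rightarrow> 'a set \<Rightarrow> 'a set set \<Rightarrow> 'a point set \<Rightarrow> bool" where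
  "compatible_completion N \<sigma> \<Sigma> S \<longleftrightarrow> (\<forall>Z\<in>boundary_components N \<sigma> \<Sigma>.
     Z \<inter> real_closure N \<sigma> \<Sigma> S = {} \<or>
     Z \<subseteq> toric_zariski N \<Sigma> closure_of (Z \<inter> real_closure N \<sigma> \<Sigma> S))"

primrec ideal_power :: "'r::comm_ring_1 set \<Rightarrow> 'r set \<Rightarrow> nat \<Rightarrow> 'r set" where
  "ideal_power A p 0 = A"
| "ideal_power A p (Suc k) = {\<Sum>i<r. g i * h i | (r::nat) g h.
     \<forall>i<r. g i \<in> p \<and> h i \<in> ideal_power A p k}"

text \<open>
  For \<open>a \<in> A\<close> and a prime ideal \<open>p\<close>, the condition \<open>\<exists>s\<in>A - p. s * a \<in> p\<^sup>k\<close> says that \<open>a\<close> lies in the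
  \<open>k\<close>-th power of the maximal ideal of the local ring \<open>A\<^sub>p\<close>. If \<open>A\<^sub>p\<close> is a discrete valuation
  ring and \<open>a \<noteq> 0\<close>, the greatest such \<open>k\<close> is the valuation of \<open>a\<close>.
\<close>

definition local_order :: "'r::comm_ring_1 set \<Rightarrow> 'r set \<Rightarrow> 'r \<Rightarrow> nat" where
  "local_order A p a = (GREATEST k. \<exists>s\<in>A - p. s * a \<in> ideal_power A p k)"

definition chart_ideal :: "'a::euclidean_space set \<Rightarrow> 'a set set \<Rightarrow> 'a set \<Rightarrow> 'a toric_point set \<Rightarrow>
    ('a \<Rightarrow>\<^sub>0 real) set" where
  "chart_ideal N \<Sigma> \<tau> Z = {f \<in> coordinate_ring N \<tau>.
     \<forall>x\<in>points (coordinate_ring N \<tau>). chart N \<Sigma> \<tau> x \<in> Z \<longrightarrow> x f = 0}"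

text \<open>
  The order along a prime divisor \<open>Z\<close> of a nonzero rational function \<open>f = a / b\<close>, computed in any
  chart that meets \<open>Z\<close>.
\<close>

definition order_along :: "'a::euclidean_space set \<Rightarrow> 'a set set \<Rightarrow> 'a toric_point set \<Rightarrow>
    ('a \<Rightarrow>\<^sub>0 real) \<Rightarrow> int" where
  "order_along N \<Sigma> Z f = (THE d. \<exists>\<tau>\<in>\<Sigma>. \<exists>a\<in>coordinate_ring N \<tau>. \<exists>b\<in>coordinate_ring N \<tau>.
     Z \<inter> chart N \<Sigma> \<tau> ` points (coordinate_ring N \<tau>) \<noteq> {} \<and> b \<noteq> 0 \<and> b * f = a \<and>
     d = int (local_order (coordinate_ring N \<tau>) (chart_ideal N \<Sigma> \<tau> Z) a) -
         int (local_order (coordinate_ring N \<tau>) (chart_ideal N \<Sigma> \<tau> Z) b))"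

text \<open>The zero function has order \<open>\<infinity>\<close>, hence the separate clause for it.\<close>

definition L_module :: "'a::euclidean_space set \<Rightarrow> 'a set \<Rightarrow> 'a set set \<Rightarrow> nat \<Rightarrow> 'a point set \<Rightarrow>
    ('a \<Rightarrow>\<^sub>0 real) set" where
  "L_module N \<sigma> \<Sigma> n S = {f \<in> coordinate_ring N \<sigma>. f = 0 \<or>
     (\<forall>Z\<in>boundary_components N \<sigma> \<Sigma>. Z \<inter> real_closure N \<sigma> \<Sigma> S \<noteq> {} \<longrightarrow>
        - int n \<le> order_along N \<Sigma> Z f)}"

text \<open>The equation includes that \<open>L\<close> is stable under multiplication by \<open>B\<close>.\<close>

definition finitely_generated_module :: "'r::comm_ring_1 set \<Rightarrow> 'r set \<Rightarrow> bool" where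
  "finitely_generated_module B L \<longleftrightarrow>
     (\<exists>G. finite G \<and> G \<subseteq> L \<and> L = {\<Sum>g\<in>G. b g * g | b. \<forall>g\<in>G. b g \<in> B})"

end

theory Submission
  imports Defs
begin

text \<open>
  A point of a chart \<open>U\<^sub>\<tau>\<close> is a monoid homomorphism to \<open>\<complex>\<close> on the lattice points of the dual cone, and
  its torus orbit is recorded by the face of \<open>\<tau>\<close> orthogonal to all characters that do not vanish at it.
  The boundary components of \<open>U\<^sub>\<sigma>\<close> are the orbit closures of the rays \<open>\<rho>\<close> of the fan outside \<open>\<sigma>\<close>, and
  the order of \<open>f\<close> along such a component is the least value of \<open>m \<bullet> u\<close> on the exponents \<open>m\<close> of \<open>f\<close>,
  where \<open>u\<close> is the primitive vector of \<open>\<rho>\<close>.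

  Completeness, tested on the closure of the graph of a one-parameter subgroup, forces the fan to
  cover the whole space. Hence the real points are covered by the finitely many compact sets
  \<open>{|\<chi>\<^sup>m| \<le> 1 for all m}\<close> of the charts, and a character without poles along the components that meet
  the closure of \<open>S\<close> is bounded on \<open>S\<close>. Conversely, if \<open>f\<close> has a pole along a component in which
  the closure of \<open>S\<close> is dense, then it is unbounded near some real point of that closure.

  So both the ring of bounded functions and the module are spanned by the monomials in the
  integral solutions of linear inequalities with the same linear parts, and Dickson's lemma applies.
\<close>

section \<open>Subgroups, lattices and rational cones\<close>

text \<open>Convexity yields real vectors, whereas characters are integral, and \<open>N\<close>
  need not span the ambient space. The passage is made by
  \<open>subgroup_sign_approximation\<close>: under an integrality condition, a vector in the real
  span of a subgroup may be traded for an element of the subgroup with the same signs on finitely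
  many test vectors. It is applied to the dual lattice (separating forms, faces, primitive vectors),
  to \<open>N\<close> (from lattice points to the whole real span) and to the graph of an additive
  function (logarithms of absolute values), hence the abstract notion of subgroup.

  Charts are compared through one character \<open>m0\<close> that cuts out a common face: every
  character of the face becomes one of the larger cone after adding a multiple of \<open>m0\<close>,
  so values on the smaller chart are fractions with a power of the value at \<open>m0\<close> as
  denominator.

  In the final step the linear forms themselves serve as coordinates for Dickson's lemma: if no form
  is larger at \<open>g\<close> than at \<open>m\<close>, then \<open>m - g\<close> satisfies the
  homogeneous inequalities, so its monomial is bounded on \<open>S\<close>.\<close>

definition additive_subgroup :: "'a::ab_group_add set \<Rightarrow> bool" where
  "additive_subgroup \<Gamma> \<longleftrightarrow> 0 \<in> \<Gamma> \<and> (\<forall>x\<in>\<Gamma>. \<forall>y\<in>\<Gamma>. x - y \<in> \<Gamma>)"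

lemma additive_subgroup_0: "additive_subgroup \<Gamma> \<Longrightarrow> 0 \<in> \<Gamma>"
  by (simp add: additive_subgroup_def)

lemma additive_subgroup_diff: "additive_subgroup \<Gamma> \<Longrightarrow> x \<in> \<Gamma> \<Longrightarrow> y \<in> \<Gamma> \<Longrightarrow> x - y \<in> \<Gamma>"
  by (simp add: additive_subgroup_def)

lemma additive_subgroup_uminus: "additive_subgroup \<Gamma> \<Longrightarrow> x \<in> \<Gamma> \<Longrightarrow> - x \<in> \<Gamma>"
  using additive_subgroup_diff[of \<Gamma> 0 x] by (simp add: additive_subgroup_0)

lemma additive_subgroup_add: "additive_subgroup \<Gamma> \<Longrightarrow> x \<in> \<Gamma> \<Longrightarrow> y \<in> \<Gamma> \<Longrightarrow> x + y \<in> \<Gamma>"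
  using additive_subgroup_diff[of \<Gamma> x "- y"] by (simp add: additive_subgroup_uminus)

lemma additive_subgroup_sum:
  "additive_subgroup \<Gamma> \<Longrightarrow> (\<And>i. i \<in> I \<Longrightarrow> f i \<in> \<Gamma>) \<Longrightarrow> sum f I \<in> \<Gamma>"
  by (induction I rule: infinite_finite_induct)
    (auto simp: additive_subgroup_0 intro: additive_subgroup_add)

lemma additive_subgroup_scale_nat:
  fixes x :: "'a::real_vector"
  assumes "additive_subgroup \<Gamma>" "x \<in> \<Gamma>"
  shows "of_nat n *\<^sub>R x \<in> \<Gamma>"
  by (induction n) (auto simp: scaleR_left_distrib assms additive_subgroup_0 intro!: additive_subgroup_add)

lemma additive_subgroup_scale_Ints:
  fixes x :: "'a::real_vector"
  assumes "additive_subgroup \<Gamma>" "x \<in> \<Gamma>" "c \<in> \<int>"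
  shows "c *\<^sub>R x \<in> \<Gamma>"
proof -
  obtain k where k: "c = of_int k"
    using assms(3) by (elim Ints_cases)
  show ?thesis
  proof (cases k rule: int_cases2)
    case (nonneg n)
    then show ?thesis
      using additive_subgroup_scale_nat[OF assms(1,2), of n] k by simp
  next
    case (nonpos n)
    then show ?thesis
      using additive_subgroup_uminus[OF assms(1) additive_subgroup_scale_nat[OF assms(1,2), of n]] k
      by simp
  qed
qed

lemma tendsto_floor_mult_div: "((\<lambda>t. of_int \<lfloor>t * b\<rfloor> / t) \<longlongrightarrow> (b::real)) at_top"
proof (rule tendsto_sandwich)
  have "b - 1 / t \<le> of_int \<lfloor>t * b\<rfloor> / t" if "0 < t" for t
  proof -
    have "(t * b - 1) / t \<le> of_int \<lfloor>t * b\<rfloor> / t"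
      using that by (intro divide_right_mono) linarith+
    then show ?thesis
      using that by (simp add: diff_divide_distrib)
  qed
  then show "\<forall>\<^sub>F t in at_top. b - 1 / t \<le> of_int \<lfloor>t * b\<rfloor> / t"
    by (rule eventually_mono[OF eventually_gt_at_top])
  show "\<forall>\<^sub>F t in at_top. of_int \<lfloor>t * b\<rfloor> / t \<le> b"
    using eventually_gt_at_top[of 0]
    by eventually_elim (simp add: field_simps)
  have "((\<lambda>t::real. b - 1 / t) \<longlongrightarrow> b - 0) at_top"
    by (intro tendsto_intros tendsto_divide_0[OF tendsto_const] filterlim_at_top_imp_at_infinity filterlim_ident)
  then show "((\<lambda>t::real. b - 1 / t) \<longlongrightarrow> b) at_top"
    by simp
qed (rule tendsto_const)

lemma tendsto_imp_eventually_sgn_eq: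
  fixes f :: "real \<Rightarrow> real"
  assumes "(f \<longlongrightarrow> L) F" "L \<noteq> 0"
  shows "\<forall>\<^sub>F t in F. sgn (f t) = sgn L"
proof (cases "L > 0")
  case True
  then show ?thesis
    using order_tendstoD(1)[OF assms(1), of 0] by (auto elim!: eventually_mono)
next
  case False
  then show ?thesis
    using order_tendstoD(2)[OF assms(1), of 0] assms(2) by (auto elim!: eventually_mono)
qed

lemma sgn_eq_real_cong:
  fixes x y :: real
  assumes "sgn x = sgn y"
  shows "0 \<le> x \<longleftrightarrow> 0 \<le> y" "x < 0 \<longleftrightarrow> y < 0"
  using assms by (auto simp: sgn_real_def split: if_splits)

text \<open>
  In a representation of \<open>x\<close> by elements of \<open>\<Gamma>\<close> with as few terms as possible, every integral
  relation \<open>x \<bullet> g = 0\<close> already holds for each term, since otherwise it could be used to eliminate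
  one. The coefficients can then be replaced by integer approximations of large multiples.
\<close>

lemma subgroup_sign_approximation:
  fixes \<Gamma> :: "'a::euclidean_space set"
  assumes sub: "additive_subgroup \<Gamma>" and x: "x \<in> span \<Gamma>" and G: "finite G"
    and int: "\<And>g q. g \<in> G \<Longrightarrow> x \<bullet> g = 0 \<Longrightarrow> q \<in> \<Gamma> \<Longrightarrow> q \<bullet> g \<in> \<int>"
  shows "\<exists>q\<in>\<Gamma>. \<forall>g\<in>G. sgn (q \<bullet> g) = sgn (x \<bullet> g)"
proof -
  \<comment> \<open>The vectors form a family \<open>q\<close> rather than a set: an elimination
    replaces them by combinations of themselves, and two of these may coincide.\<close>
  define P where "P = (\<lambda>(I :: 'a set, \<beta> :: 'a \<Rightarrow> real, q :: 'a \<Rightarrow> 'a).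
    finite I \<and> q ` I \<subseteq> \<Gamma> \<and> x = (\<Sum>j\<in>I. \<beta> j *\<^sub>R q j))"
  obtain T r where "finite T" "T \<subseteq> \<Gamma>" "x = (\<Sum>j\<in>T. r j *\<^sub>R j)"
    using x unfolding span_explicit by blast
  then have "P (T, r, id)"
    by (simp add: P_def)
  then obtain w where "P w" and minw: "\<And>w'. P w' \<Longrightarrow> card (fst w) \<le> card (fst w')"
    using ex_has_least_nat[of P "(T, r, id)" "\<lambda>w. card (fst w)"] by blast
  obtain I \<beta> q where w: "w = (I, \<beta>, q)"
    by (cases w) auto
  have I: "finite I" and q: "\<And>j. j \<in> I \<Longrightarrow> q j \<in> \<Gamma>" and xeq: "x = (\<Sum>j\<in>I. \<beta> j *\<^sub>R q j)"
    using \<open>P w\<close> by (auto simp: P_def w)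
  have zero: "q j \<bullet> g = 0" if g: "g \<in> G" "x \<bullet> g = 0" and j: "j \<in> I" for g j
  proof (rule ccontr)
    define c where "c = (\<lambda>i. q i \<bullet> g)"
    assume "q j \<bullet> g \<noteq> 0"
    then have cj: "c j \<noteq> 0"
      by (simp add: c_def)
    have cI: "c i \<in> \<int>" if "i \<in> I" for i
      unfolding c_def using int[OF g] q[OF that] by blast
    have "(\<Sum>i\<in>I. \<beta> i * c i) = 0"
      using g(2) by (simp add: xeq inner_sum_left c_def)
    then have *: "(\<Sum>i\<in>I - {j}. \<beta> i * c i) = - \<beta> j * c j"
      using I j by (simp add: sum.remove)
    \<comment> \<open>Solving the relation for the \<open>j\<close>-th term and clearing the
      denominator \<open>c j\<close> leads to these combinations; they stay in
      \<open>\<Gamma>\<close> because all \<open>c i\<close> are integers.\<close>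
    have "(\<Sum>i\<in>I - {j}. (\<beta> i / c j) *\<^sub>R (c j *\<^sub>R q i - c i *\<^sub>R q j)) =
        (\<Sum>i\<in>I - {j}. \<beta> i *\<^sub>R q i) - ((\<Sum>i\<in>I - {j}. \<beta> i * c i) / c j) *\<^sub>R q j"
      using cj by (simp add: scaleR_diff_right sum_subtractf scaleR_sum_left sum_divide_distrib)
    also have "\<dots> = x"
      using I j cj by (simp add: * xeq sum.remove)
    finally have "P (I - {j}, \<lambda>i. \<beta> i / c j, \<lambda>i. c j *\<^sub>R q i - c i *\<^sub>R q j)"
      using I q j cI
      by (auto simp: P_def intro!: additive_subgroup_diff additive_subgroup_scale_Ints sub)
    from minw[OF this] show False
      using card_Diff1_less[OF I j] by (simp add: w)
  qed
  define m where "m = (\<lambda>t::real. \<Sum>j\<in>I. of_int \<lfloor>t * \<beta> j\<rfloor> *\<^sub>R q j)"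
  have m: "m t \<in> \<Gamma>" for t
    unfolding m_def
    by (intro additive_subgroup_sum additive_subgroup_scale_Ints sub q) auto
  have "\<forall>\<^sub>F t in at_top. sgn (m t \<bullet> g) = sgn (x \<bullet> g)" if g: "g \<in> G" for g
  proof (cases "x \<bullet> g = 0")
    case True
    then show ?thesis
      using zero[OF g] by (simp add: m_def inner_sum_left)
  next
    case False
    have "((\<lambda>t. \<Sum>j\<in>I. (of_int \<lfloor>t * \<beta> j\<rfloor> / t) * (q j \<bullet> g)) \<longlongrightarrow> (\<Sum>j\<in>I. \<beta> j * (q j \<bullet> g))) at_top"
      by (intro tendsto_intros tendsto_floor_mult_div)
    moreover have "(\<Sum>j\<in>I. (of_int \<lfloor>t * \<beta> j\<rfloor> / t) * (q j \<bullet> g)) = m t \<bullet> g / t" for t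
      by (simp add: m_def inner_sum_left sum_divide_distrib)
    moreover have "(\<Sum>j\<in>I. \<beta> j * (q j \<bullet> g)) = x \<bullet> g"
      by (simp add: xeq inner_sum_left)
    ultimately have "\<forall>\<^sub>F t in at_top. sgn (m t \<bullet> g / t) = sgn (x \<bullet> g)"
      using False by (intro tendsto_imp_eventually_sgn_eq) simp_all
    then show ?thesis
      using eventually_gt_at_top[of 0]
      by eventually_elim (simp add: sgn_divide)
  qed
  then have "\<forall>\<^sub>F t in at_top. \<forall>g\<in>G. sgn (m t \<bullet> g) = sgn (x \<bullet> g)"
    using G by (simp add: eventually_ball_finite)
  then obtain t where "\<forall>g\<in>G. sgn (m t \<bullet> g) = sgn (x \<bullet> g)"
    using eventually_happens'[OF trivial_limit_at_top_linorder] by blast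
  then show ?thesis
    by (intro bexI[OF _ m])
qed

text \<open>The component \<open>z\<close> of \<open>b\<close> orthogonal to the other basis vectors
  is nonzero by independence and satisfies \<open>z \<bullet> b = z \<bullet> z\<close>; dividing it
  by its squared length gives the dual vector.\<close>

lemma dual_vector_exists:
  fixes B :: "'a::euclidean_space set"
  assumes B: "independent B" and b: "b \<in> B"
  shows "\<exists>d\<in>span B. d \<bullet> b = 1 \<and> (\<forall>b'\<in>B - {b}. d \<bullet> b' = 0)"
proof -
  obtain y z where y: "y \<in> span (B - {b})" and z: "\<And>w. w \<in> span (B - {b}) \<Longrightarrow> orthogonal z w"
    and bz: "b = y + z"
    using orthogonal_subspace_decomp_exists by metis
  have "z \<noteq> 0"
    using B b y bz unfolding dependent_def by auto
  have "z \<in> span B"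
    using bz y span_mono[of "B - {b}" B] span_base[OF b] span_diff[of b B y]
    by (metis Diff_subset add_diff_cancel_left' subsetD)
  moreover have "z \<bullet> b = z \<bullet> z"
    using z[OF y] by (simp add: bz inner_add_right orthogonal_def)
  moreover have "z \<bullet> b' = 0" if "b' \<in> B - {b}" for b'
    using z[OF span_base[OF that]] by (simp add: orthogonal_def)
  ultimately show ?thesis
    using \<open>z \<noteq> 0\<close> by (intro bexI[of _ "z /\<^sub>R (z \<bullet> z)"]) (auto intro: span_scale)
qed

lemma additive_subgroup_lattice:
  assumes "is_lattice N"
  shows "additive_subgroup N"
proof -
  obtain B where N: "N = range (\<lambda>c :: 'a \<Rightarrow> int. \<Sum>b\<in>B. of_int (c b) *\<^sub>R b)"
    using assms unfolding is_lattice_def by blast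
  have "(\<Sum>b\<in>B. of_int (c b) *\<^sub>R b) - (\<Sum>b\<in>B. of_int (d b) *\<^sub>R b) \<in> N" for c d
    unfolding N by (rule image_eqI[of _ _ "\<lambda>b. c b - d b"])
      (simp_all add: scaleR_diff_left sum_subtractf)
  moreover have "0 \<in> N"
    unfolding N by (rule image_eqI[of _ _ "\<lambda>b. 0"]) simp_all
  ultimately show ?thesis
    unfolding additive_subgroup_def by (auto simp: N)
qed

lemma additive_subgroup_dual_lattice: "additive_subgroup (dual_lattice N)"
  by (auto simp: additive_subgroup_def dual_lattice_def span_0 span_diff inner_diff_left)

lemma dual_lattice_inner_Ints: "m \<in> dual_lattice N \<Longrightarrow> u \<in> N \<Longrightarrow> m \<bullet> u \<in> \<int>"
  by (simp add: dual_lattice_def)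

text \<open>The dual basis of a basis of \<open>N\<close> lies in the dual lattice, and a vector of
  the span has the coefficients \<open>x \<bullet> b\<close> in it. This makes every real form on
  the span of \<open>N\<close> accessible to \<open>subgroup_sign_approximation\<close> for the dual
  lattice.\<close>

lemma span_dual_lattice:
  assumes "is_lattice N"
  shows "span (dual_lattice N) = span N"
proof
  show "span (dual_lattice N) \<subseteq> span N"
    by (rule span_minimal) (auto simp: dual_lattice_def)
  obtain B where B: "independent B" and N: "N = range (\<lambda>c :: 'a \<Rightarrow> int. \<Sum>b\<in>B. of_int (c b) *\<^sub>R b)"
    using assms unfolding is_lattice_def by blast
  have fin: "finite B"
    using B independent_imp_finite by blast
  have "B \<subseteq> N"
  proof
    fix b assume "b \<in> B"
    then show "b \<in> N"
      unfolding N using fin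
      by (intro image_eqI[of _ _ "\<lambda>b'. if b' = b then 1 else 0"])
        (auto simp: if_distrib[of of_int] if_distrib[of "\<lambda>c. c *\<^sub>R _"] cong: if_cong)
  qed
  moreover have "N \<subseteq> span B"
    by (auto simp: N intro!: span_sum span_scale intro: span_base)
  ultimately have spanNB: "span N = span B"
    by (metis span_mono span_span subset_antisym)
  obtain d where d: "\<And>b. b \<in> B \<Longrightarrow> d b \<in> span B" "\<And>b. b \<in> B \<Longrightarrow> d b \<bullet> b = 1"
    "\<And>b b'. b \<in> B \<Longrightarrow> b' \<in> B \<Longrightarrow> b' \<noteq> b \<Longrightarrow> d b \<bullet> b' = 0"
    using dual_vector_exists[OF B] by (metis DiffI empty_iff insert_iff)
  have "d b \<in> dual_lattice N" if "b \<in> B" for b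
  proof -
    have "d b \<bullet> b' \<in> \<int>" if "b' \<in> B" for b'
      using d(2,3)[OF \<open>b \<in> B\<close>] that by (cases "b' = b") auto
    then show ?thesis
      using d(1)[OF that] by (auto simp: dual_lattice_def N inner_sum_right spanNB[unfolded N])
  qed
  then have dspan: "d ` B \<subseteq> span (dual_lattice N)"
    by (auto intro: span_base)
  show "span N \<subseteq> span (dual_lattice N)"
  proof
    fix x assume "x \<in> span N"
    define y where "y = (\<Sum>b\<in>B. (x \<bullet> b) *\<^sub>R d b)"
    have "(x - y) \<bullet> b = 0" if "b \<in> B" for b
    proof -
      have "y \<bullet> b = (\<Sum>b'\<in>B. if b' = b then x \<bullet> b else 0)"
        unfolding y_def inner_sum_left using d(2,3) that by (intro sum.cong) auto
      then show ?thesis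
        using fin that by (simp add: inner_diff_left)
    qed
    moreover have "x - y \<in> span B"
      unfolding y_def using \<open>x \<in> span N\<close> d(1) by (auto simp: spanNB intro!: span_diff span_sum span_scale)
    ultimately have "orthogonal (x - y) (x - y)"
      using orthogonal_to_span[of "x - y" B "x - y"] by (auto simp: orthogonal_def)
    then have "x = y"
      by (simp add: orthogonal_self)
    then show "x \<in> span (dual_lattice N)"
      unfolding y_def using dspan by (metis (no_types, lifting) imageI span_scale span_sum subsetD)
  qed
qed

text \<open>The semigroup of lattice points of the dual cone; its semigroup algebra over the reals
  is the coordinate ring of the chart.\<close>

definition character_monoid :: "'a::euclidean_space set \<Rightarrow> 'a set \<Rightarrow> 'a set" where
  "character_monoid N \<tau> = {m \<in> dual_lattice N. \<forall>u\<in>\<tau>. 0 \<le> m \<bullet> u}"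

lemma coordinate_ring_eq: "coordinate_ring N \<tau> = {f. Poly_Mapping.keys f \<subseteq> character_monoid N \<tau>}"
  by (simp add: coordinate_ring_def character_monoid_def)

lemma character_monoid_0: "0 \<in> character_monoid N \<tau>"
  by (auto simp: character_monoid_def additive_subgroup_0 additive_subgroup_dual_lattice)

lemma character_monoid_add:
  "m \<in> character_monoid N \<tau> \<Longrightarrow> m' \<in> character_monoid N \<tau> \<Longrightarrow> m + m' \<in> character_monoid N \<tau>"
  by (auto simp: character_monoid_def inner_add_left additive_subgroup_add additive_subgroup_dual_lattice)

lemma character_monoid_mono: "\<tau> \<subseteq> \<tau>' \<Longrightarrow> character_monoid N \<tau>' \<subseteq> character_monoid N \<tau>"
  by (auto simp: character_monoid_def)

lemma character_monoid_scale:
  "m \<in> character_monoid N \<tau> \<Longrightarrow> of_nat n *\<^sub>R m \<in> character_monoid N \<tau>"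
  by (auto simp: character_monoid_def additive_subgroup_scale_nat additive_subgroup_dual_lattice)

lemma character_monoid_sum:
  "(\<And>i. i \<in> I \<Longrightarrow> f i \<in> character_monoid N \<tau>) \<Longrightarrow> sum f I \<in> character_monoid N \<tau>"
  by (induction I rule: infinite_finite_induct) (auto simp: character_monoid_0 character_monoid_add)

section \<open>Separation and faces of rational cones\<close>

lemma convex_cone_hull_nonneg:
  assumes "\<And>g. g \<in> G \<Longrightarrow> 0 \<le> m \<bullet> g" "x \<in> convex_cone hull G"
  shows "0 \<le> m \<bullet> x"
proof -
  have "convex_cone hull G \<subseteq> {x. m \<bullet> x \<ge> 0}"
    by (rule hull_minimal) (use assms convex_cone_halfspace_ge in auto)
  then show ?thesis
    using assms(2) by auto
qed

text \<open>Where both forms are nonnegative, vanishing at a sum means vanishing at both summands,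
  so the points at which the forms vanish together make up a convex cone. This transfers a face from
  a real supporting form to an integral one.\<close>

lemma convex_cone_hull_transfer_zero:
  assumes "\<And>g. g \<in> G \<Longrightarrow> sgn (m \<bullet> g) = sgn (a \<bullet> g)" "\<And>g. g \<in> G \<Longrightarrow> 0 \<le> a \<bullet> g"
    and "x \<in> convex_cone hull G"
  shows "m \<bullet> x = 0 \<longleftrightarrow> a \<bullet> x = 0"
proof -
  let ?C = "{x. 0 \<le> m \<bullet> x \<and> 0 \<le> a \<bullet> x \<and> (m \<bullet> x = 0 \<longleftrightarrow> a \<bullet> x = 0)}"
  have nn: "0 \<le> m \<bullet> g" if "g \<in> G" for g
    using assms(1,2)[OF that] by (metis sgn_less not_less)
  have "convex_cone ?C"
    by (auto simp: convex_cone_iff inner_add_right add_nonneg_eq_0_iff)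
  then have "convex_cone hull G \<subseteq> ?C"
    by (intro hull_minimal) (use assms(1,2) nn in \<open>auto, (metis sgn_zero_iff)+\<close>)
  then show ?thesis
    using assms(3) by auto
qed

text \<open>\<open>N\<close> may span a proper subspace, but
  \<open>subgroup_sign_approximation\<close> needs a vector of the span; only the values on that
  span matter.\<close>

lemma span_orthogonal_projection:
  fixes a :: "'a::euclidean_space"
  obtains a' where "a' \<in> span N" "\<And>u. u \<in> span N \<Longrightarrow> a' \<bullet> u = a \<bullet> u"
proof -
  obtain y z where "y \<in> span N" "\<And>w. w \<in> span N \<Longrightarrow> orthogonal z w" "a = y + z"
    using orthogonal_subspace_decomp_exists by metis
  then show thesis
    by (intro that[of y]) (auto simp: inner_add_left orthogonal_def)
qed

lemma convex_cone_hull_subset_span: "G \<subseteq> N \<Longrightarrow> convex_cone hull G \<subseteq> span N"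
  by (rule hull_minimal)
    (auto simp: convex_cone_iff span_0 span_add span_scale intro: span_base)

text \<open>Scaling makes an affine separation linear: a point of the cone with a negative value
  could be scaled to have exactly the value \<open>b\<close>, against the strict inequality on the
  cone.\<close>

lemma closed_cone_separation:
  fixes \<tau> :: "'a::euclidean_space set"
  assumes "closed \<tau>" "convex_cone \<tau>" "u \<notin> \<tau>"
  shows "\<exists>a. a \<bullet> u < 0 \<and> (\<forall>x\<in>\<tau>. 0 \<le> a \<bullet> x)"
proof -
  obtain a b where ab: "a \<bullet> u < b" "\<And>x. x \<in> \<tau> \<Longrightarrow> b < a \<bullet> x"
    using separating_hyperplane_closed_point[of \<tau> u] assms by (auto simp: convex_cone_def)
  have "b < 0"
    using ab(2)[of 0] assms(2) by (simp add: convex_cone_contains_0)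
  have "0 \<le> a \<bullet> x" if x: "x \<in> \<tau>" for x
  proof (rule ccontr)
    assume "\<not> 0 \<le> a \<bullet> x"
    then have neg: "a \<bullet> x < 0"
      by simp
    have "(b / (a \<bullet> x)) *\<^sub>R x \<in> \<tau>"
      using assms(2) x neg \<open>b < 0\<close> by (auto simp: convex_cone_iff divide_nonpos_neg)
    from ab(2)[OF this] show False
      using neg by simp
  qed
  then show ?thesis
    using ab(1) \<open>b < 0\<close> by force
qed

lemma closed_convex_cone_hull_finite:
  fixes G :: "'a::euclidean_space set"
  shows "finite G \<Longrightarrow> closed (convex_cone hull G)"
  by (intro polyhedron_imp_closed polyhedron_convex_cone_hull)

text \<open>The separation depends only on the signs at \<open>u\<close> and at the generators, so
  the real form of \<open>closed_cone_separation\<close> can be replaced by a character with the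
  same signs there.\<close>

lemma rational_cone_separation:
  assumes N: "is_lattice N" and G: "finite G" "G \<subseteq> N" and u: "u \<in> N" "u \<notin> convex_cone hull G"
  shows "\<exists>m\<in>character_monoid N (convex_cone hull G). m \<bullet> u < 0"
proof -
  obtain a where a: "a \<bullet> u < 0" "\<forall>x\<in>convex_cone hull G. 0 \<le> a \<bullet> x"
    using closed_cone_separation[OF closed_convex_cone_hull_finite[OF G(1)] convex_cone_convex_cone_hull u(2)]
    by blast
  obtain a' where a': "a' \<in> span N" "\<And>u. u \<in> span N \<Longrightarrow> a' \<bullet> u = a \<bullet> u"
    using span_orthogonal_projection by metis
  obtain m where m: "m \<in> dual_lattice N" "\<forall>g\<in>insert u G. sgn (m \<bullet> g) = sgn (a' \<bullet> g)"
    using subgroup_sign_approximation[OF additive_subgroup_dual_lattice[of N], of a' "insert u G"]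
      a'(1) G u(1) span_dual_lattice[OF N] dual_lattice_inner_Ints
    by (metis finite_insert insert_iff subsetD)
  have "m \<bullet> u < 0"
    using sgn_eq_real_cong(2)[of "m \<bullet> u" "a' \<bullet> u"] m(2) a(1) a'(2)[OF span_base[OF u(1)]] by simp
  moreover have "\<And>g. g \<in> G \<Longrightarrow> 0 \<le> m \<bullet> g"
  proof -
    fix g
    assume that: "g \<in> G"
    have "0 \<le> a \<bullet> g"
      using a(2) hull_inc[OF that, of convex_cone] by blast
    moreover have "a' \<bullet> g = a \<bullet> g"
      using a'(2) span_base that G(2) by blast
    moreover have "sgn (m \<bullet> g) = sgn (a' \<bullet> g)"
      using m(2) that by blast
    ultimately show "0 \<le> m \<bullet> g"
      using sgn_eq_real_cong(1) by metis
  qed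
  then have "m \<in> character_monoid N (convex_cone hull G)"
    using m(1) convex_cone_hull_nonneg by (auto simp: character_monoid_def)
  ultimately show ?thesis
    by blast
qed

text \<open>Faces of a polyhedral cone are exposed. A character with the same signs as the
  supporting form on the generators vanishes on the same part of the cone by
  \<open>convex_cone_hull_transfer_zero\<close>.\<close>

lemma rational_face_cut:
  assumes N: "is_lattice N" and G: "finite G" "G \<subseteq> N" and F: "F face_of convex_cone hull G" "F \<noteq> {}"
  shows "\<exists>m\<in>character_monoid N (convex_cone hull G). F = {x \<in> convex_cone hull G. m \<bullet> x = 0}"
proof -
  let ?\<tau> = "convex_cone hull G"
  have "F exposed_face_of ?\<tau>"
    using F(1) polyhedron_convex_cone_hull[OF G(1)] exposed_face_of_polyhedron by blast
  then obtain a b where ab: "?\<tau> \<subseteq> {x. a \<bullet> x \<le> b}" "F = ?\<tau> \<inter> {x. a \<bullet> x = b}"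
    unfolding exposed_face_of_def by blast
  \<comment> \<open>The face contains some \<open>y\<close> with value \<open>b\<close>, and both
    \<open>0\<close> and twice \<open>y\<close> lie in the cone; hence \<open>0 \<le> b\<close> and
    \<open>2 * b \<le> b\<close>.\<close>
  have "b = 0"
  proof -
    obtain y where y: "y \<in> ?\<tau>" "a \<bullet> y = b"
      using F(2) ab(2) by auto
    have "a \<bullet> 0 \<le> b" "a \<bullet> (2 *\<^sub>R y) \<le> b"
      using ab(1) convex_cone_hull_contains_0[of G] convex_cone_hull_mul[OF y(1), of 2] by fastforce+
    then show ?thesis
      using y(2) by simp
  qed
  obtain a' where a': "a' \<in> span N" "\<And>u. u \<in> span N \<Longrightarrow> a' \<bullet> u = (- a) \<bullet> u"
    using span_orthogonal_projection by metis
  have a'G: "0 \<le> a' \<bullet> g" if "g \<in> G" for g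
  proof -
    have "g \<in> ?\<tau>" "g \<in> N"
      using that hull_inc G(2) by fast+
    then show ?thesis
      using ab(1) a'(2)[OF span_base, of g] \<open>b = 0\<close> by auto
  qed
  obtain m where m: "m \<in> dual_lattice N" "\<forall>g\<in>G. sgn (m \<bullet> g) = sgn (a' \<bullet> g)"
    using subgroup_sign_approximation[OF additive_subgroup_dual_lattice[of N], of a' G]
      a'(1) G span_dual_lattice[OF N] dual_lattice_inner_Ints by (metis subsetD)
  have "0 \<le> m \<bullet> g" if "g \<in> G" for g
    using m(2) a'G[OF that] that by (metis sgn_less not_less)
  then have "m \<in> character_monoid N ?\<tau>"
    using m(1) convex_cone_hull_nonneg by (auto simp: character_monoid_def)
  moreover have "a' \<bullet> x = - (a \<bullet> x)" if "x \<in> ?\<tau>" for x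
    using a'(2) convex_cone_hull_subset_span[OF G(2)] that by auto
  then have "F = {x \<in> ?\<tau>. m \<bullet> x = 0}"
    using convex_cone_hull_transfer_zero[of G m a'] m(2) a'G ab(2) \<open>b = 0\<close> by auto
  ultimately show ?thesis
    by blast
qed

text \<open>At a generator with \<open>m0 \<bullet> g > 0\<close> a large multiple of
  \<open>m0\<close> outweighs \<open>m\<close>; the other generators lie in the face, where
  \<open>m\<close> is nonnegative already. Thus the ring of the face is the localization at
  \<open>m0\<close>. The conclusion for all large \<open>L\<close> lets finitely many characters
  share one exponent.\<close>

lemma character_monoid_localization:
  assumes G: "finite G" "G \<subseteq> N" and m0: "m0 \<in> character_monoid N (convex_cone hull G)"
    and m: "m \<in> character_monoid N {x \<in> convex_cone hull G. m0 \<bullet> x = 0}"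
  shows "\<exists>L0. \<forall>L\<ge>L0. m + of_nat L *\<^sub>R m0 \<in> character_monoid N (convex_cone hull G)"
proof -
  let ?\<tau> = "convex_cone hull G"
  have G\<tau>: "g \<in> ?\<tau>" if "g \<in> G" for g
    using that hull_inc by fast
  have "\<forall>\<^sub>F L in sequentially. 0 \<le> m \<bullet> g + of_nat L * (m0 \<bullet> g)" if g: "g \<in> G" for g
  proof (cases "m0 \<bullet> g = 0")
    case True
    then show ?thesis
      using m G\<tau>[OF g] by (auto simp: character_monoid_def)
  next
    case False
    then have "0 < m0 \<bullet> g"
      using m0 G\<tau>[OF g] by (force simp: character_monoid_def)
    then have "filterlim (\<lambda>L. m \<bullet> g + of_nat L * (m0 \<bullet> g)) at_top sequentially"
      by (intro filterlim_tendsto_add_at_top[OF tendsto_const]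
          filterlim_at_top_mult_tendsto_pos[OF tendsto_const] filterlim_real_sequentially)
    then show ?thesis
      by (auto simp: filterlim_at_top)
  qed
  then have "\<forall>\<^sub>F L in sequentially. \<forall>g\<in>G. 0 \<le> m \<bullet> g + of_nat L * (m0 \<bullet> g)"
    using G(1) by (simp add: eventually_ball_finite)
  then obtain L0 where L0: "\<And>L g. L \<ge> L0 \<Longrightarrow> g \<in> G \<Longrightarrow> 0 \<le> (m + of_nat L *\<^sub>R m0) \<bullet> g"
    by (auto simp: eventually_sequentially inner_add_left)
  have "m + of_nat L *\<^sub>R m0 \<in> dual_lattice N" for L
    using m m0 by (auto simp: character_monoid_def
        intro!: additive_subgroup_add additive_subgroup_scale_nat additive_subgroup_dual_lattice)
  then show ?thesis
    using convex_cone_hull_nonneg[OF L0] unfolding character_monoid_def by blast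
qed

section \<open>Rays and primitive vectors\<close>

lemma strongly_convex_cone_zero:
  fixes \<tau> :: "'a::group_add set"
  assumes "\<tau> \<inter> uminus ` \<tau> = {0}" "x \<in> \<tau>" "- x \<in> \<tau>"
  shows "x = 0"
proof -
  have "x \<in> \<tau> \<inter> uminus ` \<tau>"
    using assms(2,3) by (simp add: image_iff) (metis minus_minus)
  then show ?thesis
    using assms(1) by simp
qed

text \<open>In a cone the weights of a point of a segment can be absorbed into the end points, which
  reduces the segment condition to sums.\<close>

lemma convex_cone_face_ofI:
  assumes "convex_cone \<tau>" "convex_cone F" "F \<subseteq> \<tau>"
    and sum: "\<And>a b. a \<in> \<tau> \<Longrightarrow> b \<in> \<tau> \<Longrightarrow> a + b \<in> F \<Longrightarrow> a \<in> F"
  shows "F face_of \<tau>"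
proof -
  have "a \<in> F \<and> b \<in> F" if ab: "a \<in> \<tau>" "b \<in> \<tau>" "x \<in> F" "x \<in> open_segment a b" for a b x
  proof -
    obtain u where u: "0 < u" "u < 1" "x = (1 - u) *\<^sub>R a + u *\<^sub>R b"
      using ab(4) by (auto simp: in_segment)
    have scaled: "(1 - u) *\<^sub>R a \<in> \<tau>" "u *\<^sub>R b \<in> \<tau>"
      using ab(1,2) u(1,2) assms(1) by (auto simp: convex_cone_iff)
    have "(1 - u) *\<^sub>R a \<in> F" "u *\<^sub>R b \<in> F"
      using sum[OF scaled] sum[OF scaled(2,1)] ab(3) u(3) by (auto simp: add.commute)
    then have "inverse (1 - u) *\<^sub>R ((1 - u) *\<^sub>R a) \<in> F" "inverse u *\<^sub>R (u *\<^sub>R b) \<in> F"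
      using assms(2) u(1,2) unfolding convex_cone_iff by (meson inverse_nonnegative_iff_nonnegative less_imp_le diff_ge_0_iff_ge)+
    then show ?thesis
      using u(1,2) by simp
  qed
  moreover have "convex F"
    using assms(2) by (simp add: convex_cone_def)
  ultimately show ?thesis
    unfolding face_of_def using assms(3) by blast
qed

lemma convex_cone_hull_singleton: "convex_cone hull {r} = {t *\<^sub>R r | t. 0 \<le> t}"
  by (auto simp: convex_cone_hull_convex_hull)

text \<open>A minimal generating set of a strongly convex cone spans its rays.\<close>

lemma cone_generated_by_rays:
  fixes G :: "'a::euclidean_space set"
  assumes G: "finite G" and sc: "convex_cone hull G \<inter> uminus ` (convex_cone hull G) = {0}"
  shows "\<exists>R\<subseteq>G. convex_cone hull R = convex_cone hull G \<and>
    (\<forall>r\<in>R. r \<noteq> 0 \<and> convex_cone hull {r} face_of convex_cone hull G)"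
proof -
  let ?\<tau> = "convex_cone hull G"
  obtain R where R: "R \<subseteq> G" "convex_cone hull R = ?\<tau>"
    and minR: "\<And>R'. R' \<subseteq> G \<and> convex_cone hull R' = ?\<tau> \<Longrightarrow> card R \<le> card R'"
    using ex_has_least_nat[of "\<lambda>R. R \<subseteq> G \<and> convex_cone hull R = ?\<tau>" G card] by auto
  have fR: "finite R"
    using G R(1) finite_subset by blast
  have notin: "r \<notin> convex_cone hull (R - {r})" if r: "r \<in> R" for r
  proof
    assume "r \<in> convex_cone hull (R - {r})"
    then have "convex_cone hull (R - {r}) = ?\<tau>"
      using hull_redundant[of r convex_cone "R - {r}"] r R(2) by (simp add: insert_absorb)
    then show False
      using minR[of "R - {r}"] R(1) r fR by (metis Diff_subset card_Diff1_less not_less subset_trans)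
  qed
  have "r \<noteq> 0 \<and> convex_cone hull {r} face_of ?\<tau>" if r: "r \<in> R" for r
  proof
    let ?H = "convex_cone hull (R - {r})"
    show "r \<noteq> 0"
      using notin[OF r] convex_cone_hull_contains_0 by metis
    have decomp: "\<exists>s y. 0 \<le> s \<and> y \<in> ?H \<and> x = s *\<^sub>R r + y" if "x \<in> ?\<tau>" for x
    proof -
      have "x \<in> convex_cone hull ({r} \<union> (R - {r}))"
        using that R(2) r by (simp add: insert_absorb)
      then show ?thesis
        unfolding convex_cone_hull_Un convex_cone_hull_singleton by blast
    qed
    have HT: "?H \<subseteq> ?\<tau>"
      using R by (metis Diff_subset hull_mono)
    have rT: "r \<in> ?\<tau>"
      using R r hull_inc by fast
    show "convex_cone hull {r} face_of ?\<tau>"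
    proof (rule convex_cone_face_ofI)
      show "convex_cone hull {r} \<subseteq> ?\<tau>"
        using R(1) r by (intro hull_mono) auto
      fix a b assume ab: "a \<in> ?\<tau>" "b \<in> ?\<tau>" "a + b \<in> convex_cone hull {r}"
      obtain t where t: "0 \<le> t" "a + b = t *\<^sub>R r"
        using ab(3) by (auto simp: convex_cone_hull_singleton)
      obtain s y where s: "0 \<le> s" "y \<in> ?H" "a = s *\<^sub>R r + y"
        using decomp[OF ab(1)] by blast
      obtain s' y' where s': "0 \<le> s'" "y' \<in> ?H" "b = s' *\<^sub>R r + y'"
        using decomp[OF ab(2)] by blast
      have eq: "y + y' = (t - s - s') *\<^sub>R r"
        using t(2) s(3) s'(3) by (simp add: algebra_simps)
      \<comment> \<open>Otherwise \<open>eq\<close> would express \<open>r\<close> by the other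
        generators. So \<open>y + y'\<close> is a nonpositive multiple of \<open>r\<close>, its
        negative lies in the cone as well, and strong convexity forces \<open>y = 0\<close>.\<close>
      have "t \<le> s + s'"
      proof (rule ccontr)
        assume "\<not> t \<le> s + s'"
        then have "r = inverse (t - s - s') *\<^sub>R (y + y')" "0 \<le> inverse (t - s - s')"
          using eq by auto
        then have "r \<in> ?H"
          using s(2) s'(2) by (metis convex_cone_hull_add convex_cone_hull_mul)
        then show False
          using notin[OF r] by simp
      qed
      have "- (y + y') \<in> ?\<tau>"
      proof -
      have "- (y + y') = (s + s' - t) *\<^sub>R r"
        unfolding eq by (simp flip: scaleR_minus_left)
      then show ?thesis
        using convex_cone_hull_mul[OF rT, of "s + s' - t"] \<open>t \<le> s + s'\<close> by simp
    qed
      moreover have "y \<in> ?\<tau>" "y' \<in> ?\<tau>"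
        using s(2) s'(2) HT by auto
      ultimately have "- y \<in> ?\<tau>"
        using convex_cone_hull_add[of "- (y + y')" G y'] by simp
      then have "y = 0"
        using strongly_convex_cone_zero[OF sc] \<open>y \<in> ?\<tau>\<close> by blast
      then show "a \<in> convex_cone hull {r}"
        using s by (auto simp: convex_cone_hull_singleton)
    qed (auto intro: convex_cone_convex_cone_hull)
  qed
  then show ?thesis
    using R by blast
qed

text \<open>The vector \<open>r\<close> is divided by the least positive value \<open>d\<close> that
  the dual lattice takes on it; subtracting multiples of a character \<open>e\<close> with value
  \<open>d\<close> leaves remainders below \<open>d\<close>, so \<open>d\<close> divides all values.
  Primitivity is expressed by pairings because these are the orders computed later.\<close>

lemma primitive_vector_exists:
  assumes N: "is_lattice N" and r: "r \<in> N" "r \<noteq> 0"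
  shows "\<exists>u. u \<noteq> 0 \<and> convex_cone hull {u} = convex_cone hull {r} \<and>
    (\<forall>m\<in>dual_lattice N. m \<bullet> u \<in> \<int>) \<and> (\<exists>e\<in>dual_lattice N. e \<bullet> u = 1)"
proof -
  let ?M = "dual_lattice N"
  note sub = additive_subgroup_dual_lattice
  have rint: "m \<bullet> r \<in> \<int>" if "m \<in> ?M" for m
    using that r(1) dual_lattice_inner_Ints by blast
  \<comment> \<open>A character positive at \<open>r\<close> exists, since
    \<open>r \<bullet> r\<close> is positive.\<close>
  have "\<exists>q\<in>?M. \<forall>g\<in>{r}. sgn (q \<bullet> g) = sgn (r \<bullet> g)"
    by (rule subgroup_sign_approximation[OF sub])
      (simp_all add: span_dual_lattice[OF N] span_base[OF r(1)] rint)
  then obtain m where "m \<in> ?M" "sgn (m \<bullet> r) = sgn (r \<bullet> r)"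
    by blast
  moreover have "sgn (r \<bullet> r) = 1"
    using r(2) by simp
  ultimately have m: "m \<in> ?M" "0 < m \<bullet> r"
    by (simp_all add: sgn_1_pos)
  define P where "P = (\<lambda>k::nat. 0 < k \<and> (\<exists>e\<in>?M. e \<bullet> r = of_nat k))"
  have "P (nat \<lfloor>m \<bullet> r\<rfloor>)"
    using m rint[OF m(1)] by (auto simp: P_def elim!: Ints_cases)
  then obtain d where "P d" and dmin: "\<And>k. P k \<Longrightarrow> d \<le> k"
    using ex_has_least_nat[of P _ "\<lambda>k. k"] by metis
  then obtain e where d: "0 < d" "e \<in> ?M" "e \<bullet> r = of_nat d"
    by (auto simp: P_def)
  have dvd: "m \<bullet> (r /\<^sub>R of_nat d) \<in> \<int>" if mM: "m \<in> ?M" for m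
  proof -
    obtain k where k: "m \<bullet> r = of_int k"
      using rint[OF mM] by (elim Ints_cases)
    have "k mod int d = 0"
    proof (rule ccontr)
      assume nz: "k mod int d \<noteq> 0"
      have "m - of_int (k div int d) *\<^sub>R e \<in> ?M"
        by (intro additive_subgroup_diff additive_subgroup_scale_Ints sub d(2) mM) auto
      moreover have "(m - of_int (k div int d) *\<^sub>R e) \<bullet> r = of_int (k - (k div int d) * int d)"
        by (simp add: inner_diff_left k d(3))
      then have "(m - of_int (k div int d) *\<^sub>R e) \<bullet> r = of_nat (nat (k mod int d))"
        using d(1) by (simp add: minus_div_mult_eq_mod)
      moreover have "0 \<le> k mod int d" "k mod int d < int d"
        using d(1) by auto
      ultimately have "P (nat (k mod int d))"
        using nz by (auto simp: P_def)
      then show False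
        using dmin[of "nat (k mod int d)"] \<open>k mod int d < int d\<close> \<open>0 \<le> k mod int d\<close> by auto
    qed
    then obtain j where "k = int d * j"
      by (auto elim: dvdE)
    then have "m \<bullet> (r /\<^sub>R of_nat d) = of_int j"
      using d(1) k by simp
    then show ?thesis
      by simp
  qed
  have "convex_cone hull {r /\<^sub>R of_nat d} = convex_cone hull {r}"
    unfolding convex_cone_hull_singleton
  proof (intro subset_antisym subsetI; clarify)
    fix t :: real
    assume t: "0 \<le> t"
    show "\<exists>t'. t *\<^sub>R (r /\<^sub>R of_nat d) = t' *\<^sub>R r \<and> 0 \<le> t'"
      using t by (intro exI[of _ "t * inverse (of_nat d)"]) simp
    show "\<exists>t'. t *\<^sub>R r = t' *\<^sub>R (r /\<^sub>R of_nat d) \<and> 0 \<le> t'"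
      using t d(1) by (intro exI[of _ "t * of_nat d"]) simp
  qed
  moreover have "e \<bullet> (r /\<^sub>R of_nat d) = 1" "r /\<^sub>R of_nat d \<noteq> 0"
    using d(1,3) r(2) by simp_all
  ultimately show ?thesis
    using d(2) dvd by blast
qed

section \<open>Points as monoid homomorphisms\<close>

text \<open>The function is total on the ambient space, but only its values on the semigroup count.
  So one function can represent a point in several charts, without restrictions being
  written.\<close>

definition monoid_hom :: "'a::euclidean_space set \<Rightarrow> 'a set \<Rightarrow> ('a \<Rightarrow> complex) \<Rightarrow> bool" where
  "monoid_hom N \<tau> \<zeta> \<longleftrightarrow> \<zeta> 0 = 1 \<and>
     (\<forall>m\<in>character_monoid N \<tau>. \<forall>m'\<in>character_monoid N \<tau>. \<zeta> (m + m') = \<zeta> m * \<zeta> m')"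

definition eval_hom :: "('a::euclidean_space \<Rightarrow> complex) \<Rightarrow> ('a \<Rightarrow>\<^sub>0 real) \<Rightarrow> complex" where
  "eval_hom \<zeta> f = (\<Sum>m\<in>Poly_Mapping.keys f. of_real (Poly_Mapping.lookup f m) * \<zeta> m)"

definition hom_point :: "'a::euclidean_space set \<Rightarrow> 'a set \<Rightarrow> ('a \<Rightarrow> complex) \<Rightarrow> 'a point" where
  "hom_point N \<tau> \<zeta> = restrict (eval_hom \<zeta>) (coordinate_ring N \<tau>)"

abbreviation char_fun :: "'a \<Rightarrow> ('a \<Rightarrow>\<^sub>0 real)" where
  "char_fun m \<equiv> Poly_Mapping.single m 1"

lemma poly_mapping_expansion:
  fixes f :: "'a \<Rightarrow>\<^sub>0 'b::comm_monoid_add"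
  shows "f = (\<Sum>m\<in>Poly_Mapping.keys f. Poly_Mapping.single m (Poly_Mapping.lookup f m))"
proof (rule poly_mapping_eqI)
  fix k
  have "(\<Sum>m\<in>Poly_Mapping.keys f. Poly_Mapping.lookup (Poly_Mapping.single m (Poly_Mapping.lookup f m)) k) =
      (\<Sum>m\<in>Poly_Mapping.keys f. if m = k then Poly_Mapping.lookup f k else 0)"
    by (intro sum.cong) (auto simp: lookup_single when_def)
  also have "\<dots> = Poly_Mapping.lookup f k"
    by (auto simp: in_keys_iff)
  finally show "Poly_Mapping.lookup f k = Poly_Mapping.lookup
      (\<Sum>m\<in>Poly_Mapping.keys f. Poly_Mapping.single m (Poly_Mapping.lookup f m)) k"
    by (simp add: lookup_sum)
qed

lemma poly_mapping_mult_expansion: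
  fixes f g :: "'a::comm_monoid_add \<Rightarrow>\<^sub>0 'b::semiring_0"
  shows "f * g = (\<Sum>m\<in>Poly_Mapping.keys f. \<Sum>m'\<in>Poly_Mapping.keys g.
    Poly_Mapping.single (m + m') (Poly_Mapping.lookup f m * Poly_Mapping.lookup g m'))"
proof -
  have "f * g = (\<Sum>m\<in>Poly_Mapping.keys f. Poly_Mapping.single m (Poly_Mapping.lookup f m)) *
      (\<Sum>m\<in>Poly_Mapping.keys g. Poly_Mapping.single m (Poly_Mapping.lookup g m))"
    by (rule arg_cong2[where f = "(*)"]) (rule poly_mapping_expansion)+
  then show ?thesis
    by (simp add: sum_product mult_single)
qed

lemma eval_hom_superset:
  assumes "finite F" "Poly_Mapping.keys f \<subseteq> F"
  shows "eval_hom \<zeta> f = (\<Sum>m\<in>F. of_real (Poly_Mapping.lookup f m) * \<zeta> m)"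
  unfolding eval_hom_def by (rule sum.mono_neutral_left) (use assms in \<open>auto simp: in_keys_iff\<close>)

lemma eval_hom_0 [simp]: "eval_hom \<zeta> 0 = 0"
  by (simp add: eval_hom_def)

lemma eval_hom_add: "eval_hom \<zeta> (f + g) = eval_hom \<zeta> f + eval_hom \<zeta> g"
proof -
  let ?F = "Poly_Mapping.keys f \<union> Poly_Mapping.keys g"
  have "eval_hom \<zeta> h = (\<Sum>m\<in>?F. of_real (Poly_Mapping.lookup h m) * \<zeta> m)"
    if "Poly_Mapping.keys h \<subseteq> ?F" for h
    by (rule eval_hom_superset) (use that in auto)
  from this[of f] this[of g] this[of "f + g"] show ?thesis
    using Poly_Mapping.keys_add[of f g] by (simp add: lookup_add sum.distrib algebra_simps)
qed

lemma eval_hom_sum: "eval_hom \<zeta> (sum f I) = (\<Sum>i\<in>I. eval_hom \<zeta> (f i))"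
  by (induction I rule: infinite_finite_induct) (auto simp: eval_hom_add)

lemma eval_hom_single [simp]: "eval_hom \<zeta> (Poly_Mapping.single m c) = of_real c * \<zeta> m"
  by (cases "c = 0") (auto simp: eval_hom_def)

lemma eval_hom_cong:
  "(\<And>m. m \<in> Poly_Mapping.keys f \<Longrightarrow> \<zeta> m = \<zeta>' m) \<Longrightarrow> eval_hom \<zeta> f = eval_hom \<zeta>' f"
  by (auto simp: eval_hom_def intro!: sum.cong)

lemma eval_hom_mult:
  assumes "monoid_hom N \<tau> \<zeta>" "f \<in> coordinate_ring N \<tau>" "g \<in> coordinate_ring N \<tau>"
  shows "eval_hom \<zeta> (f * g) = eval_hom \<zeta> f * eval_hom \<zeta> g"
proof -
  have "eval_hom \<zeta> (f * g) = (\<Sum>m\<in>Poly_Mapping.keys f. \<Sum>m'\<in>Poly_Mapping.keys g.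
      of_real (Poly_Mapping.lookup f m * Poly_Mapping.lookup g m') * \<zeta> (m + m'))"
    by (simp add: poly_mapping_mult_expansion eval_hom_sum)
  also have "\<dots> = (\<Sum>m\<in>Poly_Mapping.keys f. \<Sum>m'\<in>Poly_Mapping.keys g.
      (of_real (Poly_Mapping.lookup f m) * \<zeta> m) * (of_real (Poly_Mapping.lookup g m') * \<zeta> m'))"
    using assms unfolding monoid_hom_def coordinate_ring_eq by (intro sum.cong refl) (auto simp: subset_iff)
  finally show ?thesis
    by (simp add: eval_hom_def sum_product)
qed

lemma coordinate_ring_0: "0 \<in> coordinate_ring N \<tau>"
  by (simp add: coordinate_ring_eq)

lemma coordinate_ring_add:
  "f \<in> coordinate_ring N \<tau> \<Longrightarrow> g \<in> coordinate_ring N \<tau> \<Longrightarrow> f + g \<in> coordinate_ring N \<tau>"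
  using Poly_Mapping.keys_add[of f g] by (auto simp: coordinate_ring_eq)

lemma coordinate_ring_uminus: "f \<in> coordinate_ring N \<tau> \<Longrightarrow> - f \<in> coordinate_ring N \<tau>"
  by (auto simp: coordinate_ring_eq in_keys_iff subset_iff)

lemma coordinate_ring_sum:
  "(\<And>i. i \<in> I \<Longrightarrow> f i \<in> coordinate_ring N \<tau>) \<Longrightarrow> sum f I \<in> coordinate_ring N \<tau>"
  by (induction I rule: infinite_finite_induct) (auto simp: coordinate_ring_0 coordinate_ring_add)

lemma coordinate_ring_mult:
  assumes "f \<in> coordinate_ring N \<tau>" "g \<in> coordinate_ring N \<tau>"
  shows "f * g \<in> coordinate_ring N \<tau>"
proof -
  have "Poly_Mapping.keys (f * g) \<subseteq> {a + b | a b. a \<in> Poly_Mapping.keys f \<and> b \<in> Poly_Mapping.keys g}"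
    by (rule Poly_Mapping.keys_mult)
  then show ?thesis
    using assms by (force simp: coordinate_ring_eq intro: character_monoid_add)
qed

lemma coordinate_ring_single:
  "m \<in> character_monoid N \<tau> \<Longrightarrow> Poly_Mapping.single m c \<in> coordinate_ring N \<tau>"
  by (simp add: coordinate_ring_eq)

lemma coordinate_ring_mono: "\<gamma> \<subseteq> \<tau> \<Longrightarrow> coordinate_ring N \<tau> \<subseteq> coordinate_ring N \<gamma>"
  using character_monoid_mono[of \<gamma> \<tau> N] by (auto simp: coordinate_ring_eq)

lemma monoid_hom_mono: "\<gamma> \<subseteq> \<tau> \<Longrightarrow> monoid_hom N \<gamma> \<zeta> \<Longrightarrow> monoid_hom N \<tau> \<zeta>"
  using character_monoid_mono[of \<gamma> \<tau> N] unfolding monoid_hom_def by blast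

lemma monoid_hom_cong:
  assumes "\<And>m. m \<in> character_monoid N \<tau> \<Longrightarrow> \<zeta> m = \<zeta>' m"
  shows "monoid_hom N \<tau> \<zeta> = monoid_hom N \<tau> \<zeta>'"
proof -
  have "monoid_hom N \<tau> \<eta>'" if "monoid_hom N \<tau> \<eta>" "\<And>m. m \<in> character_monoid N \<tau> \<Longrightarrow> \<eta>' m = \<eta> m" for \<eta> \<eta>'
    using that(1) unfolding monoid_hom_def
    by (simp add: that(2) character_monoid_0 character_monoid_add)
  from this[of \<zeta> \<zeta>'] this[of \<zeta>' \<zeta>] show ?thesis
    using assms by metis
qed

lemma monoid_hom_scale:
  assumes "monoid_hom N \<tau> \<zeta>" "m \<in> character_monoid N \<tau>"
  shows "\<zeta> (of_nat n *\<^sub>R m) = \<zeta> m ^ n"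
proof (induction n)
  case 0
  then show ?case
    using assms by (simp add: monoid_hom_def)
next
  case (Suc n)
  have "\<zeta> (m + of_nat n *\<^sub>R m) = \<zeta> m * \<zeta> (of_nat n *\<^sub>R m)"
    using assms character_monoid_scale unfolding monoid_hom_def by blast
  then show ?case
    by (simp add: Suc scaleR_left_distrib)
qed

lemma monoid_hom_add:
  "monoid_hom N \<tau> \<zeta> \<Longrightarrow> m \<in> character_monoid N \<tau> \<Longrightarrow> m' \<in> character_monoid N \<tau> \<Longrightarrow>
    \<zeta> (m + m') = \<zeta> m * \<zeta> m'"
  by (simp add: monoid_hom_def)

lemma monoid_hom_sum:
  assumes "monoid_hom N \<tau> \<zeta>" "\<And>i. i \<in> I \<Longrightarrow> f i \<in> character_monoid N \<tau>"
  shows "\<zeta> (sum f I) = (\<Prod>i\<in>I. \<zeta> (f i))"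
  using assms(2)
proof (induction I rule: infinite_finite_induct)
  case (insert i I)
  then show ?case
    using monoid_hom_add[OF assms(1), of "f i" "sum f I"] character_monoid_sum[of I f N \<tau>] by simp
qed (use assms(1) in \<open>simp_all add: monoid_hom_def\<close>)

lemma hom_point_apply: "f \<in> coordinate_ring N \<tau> \<Longrightarrow> hom_point N \<tau> \<zeta> f = eval_hom \<zeta> f"
  by (simp add: hom_point_def)

lemma hom_point_char: "m \<in> character_monoid N \<tau> \<Longrightarrow> hom_point N \<tau> \<zeta> (char_fun m) = \<zeta> m"
  by (simp add: hom_point_apply coordinate_ring_single)

lemma hom_point_in_points:
  assumes "monoid_hom N \<tau> \<zeta>"
  shows "hom_point N \<tau> \<zeta> \<in> points (coordinate_ring N \<tau>)"
proof -
  have "hom_point N \<tau> \<zeta> (Poly_Mapping.single 0 c) = of_real c" for c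
    using assms by (simp add: hom_point_apply coordinate_ring_single character_monoid_0 monoid_hom_def)
  moreover have "hom_point N \<tau> \<zeta> (f + g) = hom_point N \<tau> \<zeta> f + hom_point N \<tau> \<zeta> g \<and>
      hom_point N \<tau> \<zeta> (f * g) = hom_point N \<tau> \<zeta> f * hom_point N \<tau> \<zeta> g"
    if "f \<in> coordinate_ring N \<tau>" "g \<in> coordinate_ring N \<tau>" for f g
    using that coordinate_ring_add[OF that] coordinate_ring_mult[OF that]
    by (simp add: hom_point_apply eval_hom_add eval_hom_mult[OF assms])
  moreover have "hom_point N \<tau> \<zeta> \<in> extensional (coordinate_ring N \<tau>)"
    by (simp add: hom_point_def)
  ultimately show ?thesis
    unfolding points_def by blast
qed

text \<open>The constants are mapped as prescribed, so multiplicativity makes a point real linear,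
  and it is determined by its values on the characters. Together with
  \<open>hom_point_in_points\<close> this reduces all statements on points to semigroup
  homomorphisms.\<close>

lemma pointsE:
  assumes x: "x \<in> points (coordinate_ring N \<tau>)"
  obtains \<zeta> where "monoid_hom N \<tau> \<zeta>" "x = hom_point N \<tau> \<zeta>"
proof
  let ?A = "coordinate_ring N \<tau>"
  let ?\<zeta> = "\<lambda>m. x (char_fun m)"
  have add: "x (f + g) = x f + x g" and mult: "x (f * g) = x f * x g" if "f \<in> ?A" "g \<in> ?A" for f g
    using x that by (auto simp: points_def)
  have const: "x (Poly_Mapping.single 0 c) = of_real c" for c
    using x by (auto simp: points_def)
  have x0: "x 0 = 0"
    using const[of 0] by simp
  have sum: "x (sum f I) = (\<Sum>i\<in>I. x (f i))" if "\<And>i. i \<in> I \<Longrightarrow> f i \<in> ?A" for f and I :: "'a set"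
    using that
    by (induction I rule: infinite_finite_induct) (auto simp: x0 add coordinate_ring_sum)
  have single: "x (Poly_Mapping.single m c) = of_real c * ?\<zeta> m" if "m \<in> character_monoid N \<tau>" for m c
    using mult[of "Poly_Mapping.single 0 c" "char_fun m"] const that
    by (simp add: mult_single coordinate_ring_single character_monoid_0)
  show "monoid_hom N \<tau> ?\<zeta>"
    unfolding monoid_hom_def
    using const[of 1] mult[of "char_fun _" "char_fun _"]
    by (simp add: mult_single coordinate_ring_single)
  show "x = hom_point N \<tau> ?\<zeta>"
  proof
    fix f
    show "x f = hom_point N \<tau> ?\<zeta> f"
    proof (cases "f \<in> ?A")
      case True
      have "x f = x (\<Sum>m\<in>Poly_Mapping.keys f. Poly_Mapping.single m (Poly_Mapping.lookup f m))"
        by (metis poly_mapping_expansion)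
      also have "\<dots> = (\<Sum>m\<in>Poly_Mapping.keys f. x (Poly_Mapping.single m (Poly_Mapping.lookup f m)))"
        using True by (intro sum) (auto simp: coordinate_ring_eq)
      also have "\<dots> = eval_hom ?\<zeta> f"
        unfolding eval_hom_def using True by (intro sum.cong single) (auto simp: coordinate_ring_eq)
      finally show ?thesis
        using True by (simp add: hom_point_apply)
    next
      case False
      then show ?thesis
        using x by (auto simp: hom_point_def points_def extensional_def)
    qed
  qed
qed

lemma hom_point_eq_iff:
  "hom_point N \<tau> \<zeta> = hom_point N \<tau> \<zeta>' \<longleftrightarrow> (\<forall>m\<in>character_monoid N \<tau>. \<zeta> m = \<zeta>' m)"
proof
  assume "hom_point N \<tau> \<zeta> = hom_point N \<tau> \<zeta>'"
  then show "\<forall>m\<in>character_monoid N \<tau>. \<zeta> m = \<zeta>' m"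
    by (metis hom_point_char)
next
  assume *: "\<forall>m\<in>character_monoid N \<tau>. \<zeta> m = \<zeta>' m"
  show "hom_point N \<tau> \<zeta> = hom_point N \<tau> \<zeta>'"
    unfolding hom_point_def
    by (intro restrict_ext eval_hom_cong) (use * in \<open>auto simp: coordinate_ring_eq\<close>)
qed

lemma restrict_hom_point:
  "\<gamma> \<subseteq> \<tau> \<Longrightarrow> restrict (hom_point N \<gamma> \<zeta>) (coordinate_ring N \<tau>) = hom_point N \<tau> \<zeta>"
  using coordinate_ring_mono[of \<gamma> \<tau> N] by (auto simp: hom_point_def restrict_def fun_eq_iff)

lemma hom_point_real_iff:
  assumes "monoid_hom N \<tau> \<zeta>"
  shows "hom_point N \<tau> \<zeta> \<in> real_points (coordinate_ring N \<tau>) \<longleftrightarrow>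
    (\<forall>m\<in>character_monoid N \<tau>. \<zeta> m \<in> \<real>)"
proof
  assume *: "hom_point N \<tau> \<zeta> \<in> real_points (coordinate_ring N \<tau>)"
  show "\<forall>m\<in>character_monoid N \<tau>. \<zeta> m \<in> \<real>"
  proof
    fix m assume m: "m \<in> character_monoid N \<tau>"
    then have "hom_point N \<tau> \<zeta> (char_fun m) \<in> \<real>"
      using * coordinate_ring_single[of m N \<tau> 1] by (simp add: real_points_def)
    then show "\<zeta> m \<in> \<real>"
      using m by (simp add: hom_point_char)
  qed
next
  assume *: "\<forall>m\<in>character_monoid N \<tau>. \<zeta> m \<in> \<real>"
  have "eval_hom \<zeta> f \<in> \<real>" if "f \<in> coordinate_ring N \<tau>" for f
    unfolding eval_hom_def using that *
    by (intro sum_in_Reals Reals_mult) (auto simp: coordinate_ring_eq)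
  then show "hom_point N \<tau> \<zeta> \<in> real_points (coordinate_ring N \<tau>)"
    by (auto simp: real_points_def hom_point_in_points[OF assms] hom_point_apply)
qed

section \<open>Charts of the toric variety of a fan\<close>

definition orbit_cone :: "'a::euclidean_space set \<Rightarrow> 'a set \<Rightarrow> ('a \<Rightarrow> complex) \<Rightarrow> 'a set" where
  "orbit_cone N \<tau> \<zeta> = {u \<in> \<tau>. \<forall>m\<in>character_monoid N \<tau>. \<zeta> m \<noteq> 0 \<longrightarrow> m \<bullet> u = 0}"

locale toric_fan =
  fixes N :: "'a::euclidean_space set" and \<Sigma> :: "'a set set"
  assumes lattice: "is_lattice N" and fan: "is_fan N \<Sigma>"
begin

abbreviation "Q \<equiv> character_monoid N"
abbreviation "A \<equiv> coordinate_ring N"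
abbreviation "tpoint \<tau> \<zeta> \<equiv> chart N \<Sigma> \<tau> (hom_point N \<tau> \<zeta>)"

lemma cone_generators:
  assumes "\<tau> \<in> \<Sigma>"
  obtains G where "finite G" "G \<subseteq> N" "\<tau> = convex_cone hull G"
    "convex_cone hull G \<inter> uminus ` (convex_cone hull G) = {0}"
proof -
  have "strongly_convex_rational_cone N \<tau>"
    using fan assms unfolding is_fan_def by blast
  then show thesis
    using that unfolding strongly_convex_rational_cone_def by blast
qed

lemma cone_convex_cone: "\<tau> \<in> \<Sigma> \<Longrightarrow> convex_cone \<tau>"
  by (rule cone_generators) (auto simp: convex_cone_convex_cone_hull)

lemma cone_0: "\<tau> \<in> \<Sigma> \<Longrightarrow> 0 \<in> \<tau>"
  by (simp add: cone_convex_cone convex_cone_contains_0)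

lemma face_in_fan: "\<tau> \<in> \<Sigma> \<Longrightarrow> F face_of \<tau> \<Longrightarrow> F \<noteq> {} \<Longrightarrow> F \<in> \<Sigma>"
  using fan unfolding is_fan_def by blast

lemma Int_face_of: "\<tau> \<in> \<Sigma> \<Longrightarrow> \<tau>' \<in> \<Sigma> \<Longrightarrow> \<tau> \<inter> \<tau>' face_of \<tau>"
  using fan unfolding is_fan_def by blast

lemma Int_in_fan: "\<tau> \<in> \<Sigma> \<Longrightarrow> \<tau>' \<in> \<Sigma> \<Longrightarrow> \<tau> \<inter> \<tau>' \<in> \<Sigma>"
  using face_in_fan[OF _ Int_face_of] cone_0 by blast

lemma face_cut:
  assumes "\<tau> \<in> \<Sigma>" "F face_of \<tau>" "F \<noteq> {}"
  obtains m0 where "m0 \<in> Q \<tau>" "F = {x \<in> \<tau>. m0 \<bullet> x = 0}"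
proof -
  obtain G where "finite G" "G \<subseteq> N" "\<tau> = convex_cone hull G"
    using cone_generators[OF assms(1)] by blast
  then show thesis
    using rational_face_cut[OF lattice, of G F] assms(2,3) that by blast
qed

lemma subcone_cut:
  assumes "\<tau> \<in> \<Sigma>" "\<gamma> \<in> \<Sigma>" "\<gamma> \<subseteq> \<tau>"
  obtains m0 where "m0 \<in> Q \<tau>" "\<gamma> = {x \<in> \<tau>. m0 \<bullet> x = 0}"
proof -
  have "\<tau> \<inter> \<gamma> = \<gamma>" "\<gamma> \<noteq> {}"
    using assms(3) cone_0[OF assms(2)] by auto
  then have "\<gamma> face_of \<tau>"
    using Int_face_of[OF assms(1,2)] by simp
  then show thesis
    using face_cut[OF assms(1)] \<open>\<gamma> \<noteq> {}\<close> that by blast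
qed

section \<open>Localization at a face and extension of points to smaller charts\<close>

lemma localization:
  assumes "\<tau> \<in> \<Sigma>" "m0 \<in> Q \<tau>" "\<gamma> = {x \<in> \<tau>. m0 \<bullet> x = 0}" "m \<in> Q \<gamma>"
  shows "\<exists>L0. \<forall>L\<ge>L0. m + of_nat L *\<^sub>R m0 \<in> Q \<tau>"
proof -
  obtain G where "finite G" "G \<subseteq> N" "\<tau> = convex_cone hull G"
    using cone_generators[OF assms(1)] by blast
  then show ?thesis
    using character_monoid_localization[of G N m0 m] assms(2-4) by simp
qed

lemma localization_finite:
  assumes "\<tau> \<in> \<Sigma>" "m0 \<in> Q \<tau>" "\<gamma> = {x \<in> \<tau>. m0 \<bullet> x = 0}" "finite F" "F \<subseteq> Q \<gamma>"
  shows "\<exists>L. \<forall>m\<in>F. m + of_nat L *\<^sub>R m0 \<in> Q \<tau>"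
proof -
  have "\<forall>m\<in>F. \<forall>\<^sub>F L in sequentially. m + of_nat L *\<^sub>R m0 \<in> Q \<tau>"
    unfolding eventually_sequentially using localization[OF assms(1-3)] assms(5) by blast
  then have "\<forall>\<^sub>F L in sequentially. \<forall>m\<in>F. m + of_nat L *\<^sub>R m0 \<in> Q \<tau>"
    using assms(4) by (simp add: eventually_ball_finite)
  then show ?thesis
    by (auto simp: eventually_sequentially)
qed

text \<open>Both \<open>m0\<close> and \<open>- m0\<close> are nonnegative on the face that
  \<open>m0\<close> cuts out, so the character is invertible there.\<close>

lemma cut_unit:
  assumes "m0 \<in> Q \<tau>" "\<gamma> = {x \<in> \<tau>. m0 \<bullet> x = 0}" "monoid_hom N \<gamma> \<xi>"
  shows "\<xi> m0 \<noteq> 0"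
proof -
  have "m0 \<in> Q \<gamma>" "- m0 \<in> Q \<gamma>"
    using assms(1,2) additive_subgroup_uminus[OF additive_subgroup_dual_lattice]
    by (auto simp: character_monoid_def)
  then have "\<xi> m0 * \<xi> (- m0) = 1"
    using monoid_hom_add[OF assms(3), of m0 "- m0"] assms(3) by (simp add: monoid_hom_def)
  then show ?thesis
    by auto
qed

lemma hom_shift:
  assumes "monoid_hom N \<gamma> \<xi>" "m \<in> Q \<gamma>" "m0 \<in> Q \<gamma>"
  shows "\<xi> (m + of_nat L *\<^sub>R m0) = \<xi> m * \<xi> m0 ^ L"
  using monoid_hom_add[OF assms(1,2) character_monoid_scale[OF assms(3)]] monoid_hom_scale[OF assms(1,3)]
  by simp

lemma cut_subset: "m0 \<in> Q \<tau> \<Longrightarrow> \<gamma> = {x \<in> \<tau>. m0 \<bullet> x = 0} \<Longrightarrow> \<gamma> \<subseteq> \<tau> \<and> m0 \<in> Q \<gamma>"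
  by (auto simp: character_monoid_def)

text \<open>Values on the face are fractions of values on \<open>\<tau>\<close>. Hence an extension
  to the smaller chart is unique, and real if the point is real.\<close>

lemma extension_value:
  assumes "m0 \<in> Q \<tau>" "\<gamma> = {x \<in> \<tau>. m0 \<bullet> x = 0}" "monoid_hom N \<gamma> \<xi>"
    and "m \<in> Q \<gamma>"
  shows "\<xi> m = \<xi> (m + of_nat L *\<^sub>R m0) / \<xi> m0 ^ L"
  using hom_shift[OF assms(3,4)] cut_subset[OF assms(1,2)] cut_unit[OF assms(1-3)] by simp

lemma extension_unique:
  assumes "\<tau> \<in> \<Sigma>" "\<gamma> \<in> \<Sigma>" "\<gamma> \<subseteq> \<tau>" "monoid_hom N \<gamma> \<xi>" "monoid_hom N \<gamma> \<xi>'"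
    and "\<And>m. m \<in> Q \<tau> \<Longrightarrow> \<xi> m = \<xi>' m" and m: "m \<in> Q \<gamma>"
  shows "\<xi> m = \<xi>' m"
proof -
  obtain m0 where m0: "m0 \<in> Q \<tau>" "\<gamma> = {x \<in> \<tau>. m0 \<bullet> x = 0}"
    using subcone_cut assms(1-3) by blast
  obtain L where "m + of_nat L *\<^sub>R m0 \<in> Q \<tau>"
    using localization[OF assms(1) m0 m] by blast
  then show ?thesis
    using extension_value[OF m0 assms(4) m, of L] extension_value[OF m0 assms(5) m, of L] assms(6) m0(1)
    by simp
qed

lemma extension_real:
  assumes "\<tau> \<in> \<Sigma>" "\<gamma> \<in> \<Sigma>" "\<gamma> \<subseteq> \<tau>" "monoid_hom N \<gamma> \<xi>"
    and "\<And>m. m \<in> Q \<tau> \<Longrightarrow> \<xi> m \<in> \<real>" and m: "m \<in> Q \<gamma>"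
  shows "\<xi> m \<in> \<real>"
proof -
  obtain m0 where m0: "m0 \<in> Q \<tau>" "\<gamma> = {x \<in> \<tau>. m0 \<bullet> x = 0}"
    using subcone_cut assms(1-3) by blast
  obtain L where "m + of_nat L *\<^sub>R m0 \<in> Q \<tau>"
    using localization[OF assms(1) m0 m] by blast
  then show ?thesis
    using extension_value[OF m0 assms(4) m, of L] assms(5) m0(1) by (simp add: Reals_divide Reals_power)
qed

text \<open>Each character of the face gets a chosen exponent \<open>l m\<close> that moves it into
  \<open>Q \<tau>\<close>. The resulting fraction does not depend on the exponent, which makes it
  multiplicative: at \<open>m + m'\<close> the exponent \<open>l m + l m'\<close> may be
  used.\<close>

lemma extension_exists:
  assumes \<tau>: "\<tau> \<in> \<Sigma>" and m0: "m0 \<in> Q \<tau>" and \<gamma>: "\<gamma> = {x \<in> \<tau>. m0 \<bullet> x = 0}"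
    and \<zeta>: "monoid_hom N \<tau> \<zeta>" and nz: "\<zeta> m0 \<noteq> 0"
  shows "\<exists>\<xi>. monoid_hom N \<gamma> \<xi> \<and> (\<forall>m\<in>Q \<tau>. \<xi> m = \<zeta> m)"
proof -
  define l where "l = (\<lambda>m. SOME L. m + of_nat L *\<^sub>R m0 \<in> Q \<tau>)"
  define \<xi> where "\<xi> = (\<lambda>m. \<zeta> (m + of_nat (l m) *\<^sub>R m0) / \<zeta> m0 ^ l m)"
  have l: "m + of_nat (l m) *\<^sub>R m0 \<in> Q \<tau>" if "m \<in> Q \<gamma>" for m
  proof -
    have "\<exists>L. m + of_nat L *\<^sub>R m0 \<in> Q \<tau>"
      using localization[OF \<tau> m0 \<gamma> that] by blast
    then show ?thesis
      unfolding l_def by (rule someI_ex)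
  qed
  have \<xi>: "\<xi> m = \<zeta> (m + of_nat L *\<^sub>R m0) / \<zeta> m0 ^ L"
    if m: "m \<in> Q \<gamma>" and L: "m + of_nat L *\<^sub>R m0 \<in> Q \<tau>" for m L
  proof -
    have "(m + of_nat L *\<^sub>R m0) + of_nat (l m) *\<^sub>R m0 = (m + of_nat (l m) *\<^sub>R m0) + of_nat L *\<^sub>R m0"
      by simp
    then have "\<zeta> (m + of_nat L *\<^sub>R m0) * \<zeta> m0 ^ l m = \<zeta> (m + of_nat (l m) *\<^sub>R m0) * \<zeta> m0 ^ L"
      using hom_shift[OF \<zeta> L m0, of "l m"] hom_shift[OF \<zeta> l[OF m] m0, of L] by (simp only:)
    then show ?thesis
      using nz by (simp add: \<xi>_def frac_eq_eq)
  qed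
  have \<tau>\<gamma>: "Q \<tau> \<subseteq> Q \<gamma>"
    using character_monoid_mono cut_subset[OF m0 \<gamma>] by blast
  have ext: "\<xi> m = \<zeta> m" if "m \<in> Q \<tau>" for m
    using \<xi>[of m 0] that \<tau>\<gamma> by auto
  have "\<xi> 0 = 1"
    using ext[OF character_monoid_0] \<zeta> by (simp add: monoid_hom_def)
  moreover have "\<xi> (m + m') = \<xi> m * \<xi> m'" if m: "m \<in> Q \<gamma>" "m' \<in> Q \<gamma>" for m m'
  proof -
    have eq: "m + m' + of_nat (l m + l m') *\<^sub>R m0 = (m + of_nat (l m) *\<^sub>R m0) + (m' + of_nat (l m') *\<^sub>R m0)"
      by (simp add: scaleR_left_distrib)
    have "m + m' + of_nat (l m + l m') *\<^sub>R m0 \<in> Q \<tau>"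
      unfolding eq by (intro character_monoid_add l m)
    then have "\<xi> (m + m') = \<zeta> (m + m' + of_nat (l m + l m') *\<^sub>R m0) / \<zeta> m0 ^ (l m + l m')"
      by (rule \<xi>[OF character_monoid_add[OF m]])
    also have "\<dots> = \<xi> m * \<xi> m'"
      unfolding eq monoid_hom_add[OF \<zeta> l[OF m(1)] l[OF m(2)]] by (simp add: \<xi>_def power_add)
    finally show ?thesis .
  qed
  ultimately show ?thesis
    using ext unfolding monoid_hom_def by blast
qed

text \<open>For each generator outside the orbit cone there is a character that is nonzero at the
  point and not orthogonal to the generator. The sum \<open>m1\<close> of these characters is still
  nonzero at the point, as its value is the product of theirs.\<close>

lemma orbit_cone_cut:
  assumes \<tau>: "\<tau> \<in> \<Sigma>" and \<zeta>: "monoid_hom N \<tau> \<zeta>"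
  obtains m1 where "m1 \<in> Q \<tau>" "\<zeta> m1 \<noteq> 0" "orbit_cone N \<tau> \<zeta> = {x \<in> \<tau>. m1 \<bullet> x = 0}"
proof -
  obtain G where G: "finite G" "\<tau> = convex_cone hull G"
    using cone_generators[OF \<tau>] by blast
  define G' where "G' = G - orbit_cone N \<tau> \<zeta>"
  have G\<tau>: "G \<subseteq> \<tau>"
    unfolding G(2) by (rule hull_subset)
  have "\<forall>g\<in>G'. \<exists>m. m \<in> Q \<tau> \<and> \<zeta> m \<noteq> 0 \<and> m \<bullet> g \<noteq> 0"
    using G\<tau> by (auto simp: G'_def orbit_cone_def)
  then obtain \<mu> where \<mu>: "\<And>g. g \<in> G' \<Longrightarrow> \<mu> g \<in> Q \<tau> \<and> \<zeta> (\<mu> g) \<noteq> 0 \<and> \<mu> g \<bullet> g \<noteq> 0"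
    by metis
  define m1 where "m1 = sum \<mu> G'"
  have m1: "m1 \<in> Q \<tau>"
    unfolding m1_def using \<mu> by (intro character_monoid_sum) blast
  have "\<zeta> m1 = (\<Prod>g\<in>G'. \<zeta> (\<mu> g))"
    unfolding m1_def using \<mu> by (intro monoid_hom_sum[OF \<zeta>]) blast
  then have nz: "\<zeta> m1 \<noteq> 0"
    using \<mu> by (auto simp: G'_def G(1))
  have "m \<bullet> x = 0" if x: "x \<in> \<tau>" "m1 \<bullet> x = 0" and m: "m \<in> Q \<tau>" "\<zeta> m \<noteq> 0" for m x
  proof -
    \<comment> \<open>Since both forms are nonnegative on \<open>?C\<close>, this is a convex cone
      and it suffices to test the generators. There \<open>m1 \<bullet> g\<close> is a sum of
      nonnegative terms, and the term belonging to \<open>g\<close> itself is positive if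
      \<open>g\<close> is in \<open>G'\<close>.\<close>
    let ?C = "{x. 0 \<le> m1 \<bullet> x \<and> 0 \<le> m \<bullet> x \<and> (m1 \<bullet> x = 0 \<longrightarrow> m \<bullet> x = 0)}"
    have nonneg: "0 \<le> m' \<bullet> g" if "m' \<in> Q \<tau>" "g \<in> G" for m' g
      using that G\<tau> by (auto simp: character_monoid_def)
    have "m \<bullet> g = 0" if g: "g \<in> G" "m1 \<bullet> g = 0" for g
    proof (rule ccontr)
      assume "m \<bullet> g \<noteq> 0"
      then have "g \<in> G'"
        using g m by (auto simp: G'_def orbit_cone_def)
      have "\<mu> g \<bullet> g \<le> (\<Sum>h\<in>G'. \<mu> h \<bullet> g)"
        using \<mu> nonneg g(1) G(1) \<open>g \<in> G'\<close> by (intro member_le_sum) (auto simp: G'_def)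
      then have "\<mu> g \<bullet> g \<le> 0"
        using g(2) by (simp add: m1_def inner_sum_left)
      then show False
        using \<mu>[OF \<open>g \<in> G'\<close>] nonneg[OF _ g(1), of "\<mu> g"] by simp
    qed
    moreover have "convex_cone ?C"
      by (auto simp: convex_cone_iff inner_add_right add_nonneg_eq_0_iff)
    ultimately have "convex_cone hull G \<subseteq> ?C"
      using nonneg m1 m(1) by (intro hull_minimal) auto
    then show ?thesis
      using x G(2) by auto
  qed
  then have "orbit_cone N \<tau> \<zeta> = {x \<in> \<tau>. m1 \<bullet> x = 0}"
    using m1 nz by (auto simp: orbit_cone_def)
  then show thesis
    using that m1 nz by blast
qed

lemma cut_face_of: "\<tau> \<in> \<Sigma> \<Longrightarrow> m \<in> Q \<tau> \<Longrightarrow> {x \<in> \<tau>. m \<bullet> x = 0} face_of \<tau>"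
  using face_of_Int_supporting_hyperplane_ge[of \<tau> 0 m] cone_convex_cone[of \<tau>]
  by (auto simp: character_monoid_def convex_cone_def Collect_conj_eq)

lemma orbit_cone_in_fan:
  assumes "\<tau> \<in> \<Sigma>" "monoid_hom N \<tau> \<zeta>"
  shows "orbit_cone N \<tau> \<zeta> \<in> \<Sigma>"
proof -
  obtain m1 where m1: "m1 \<in> Q \<tau>" "orbit_cone N \<tau> \<zeta> = {x \<in> \<tau>. m1 \<bullet> x = 0}"
    using orbit_cone_cut[OF assms] by blast
  have "0 \<in> {x \<in> \<tau>. m1 \<bullet> x = 0}"
    using cone_0[OF assms(1)] by simp
  then show ?thesis
    unfolding m1(2) using face_in_fan[OF assms(1) cut_face_of[OF assms(1) m1(1)]] by blast
qed

lemma orbit_cone_subset: "orbit_cone N \<tau> \<zeta> \<subseteq> \<tau>"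
  by (auto simp: orbit_cone_def)

text \<open>On the orbit cone \<open>- m0\<close> is a character too, so some
  \<open>- m0 + L m1\<close> belongs to \<open>Q \<tau>\<close>, where \<open>m1\<close> cuts out
  the orbit cone. The values at this character and at \<open>m0\<close> multiply to a power of
  \<open>\<zeta> m1\<close>, which is nonzero.\<close>

lemma cut_nonzero:
  assumes \<tau>: "\<tau> \<in> \<Sigma>" and \<zeta>: "monoid_hom N \<tau> \<zeta>" and m0: "m0 \<in> Q \<tau>"
    and sub: "\<And>x. x \<in> orbit_cone N \<tau> \<zeta> \<Longrightarrow> m0 \<bullet> x = 0"
  shows "\<zeta> m0 \<noteq> 0"
proof -
  obtain m1 where m1: "m1 \<in> Q \<tau>" "\<zeta> m1 \<noteq> 0" "orbit_cone N \<tau> \<zeta> = {x \<in> \<tau>. m1 \<bullet> x = 0}"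
    using orbit_cone_cut[OF \<tau> \<zeta>] by blast
  have "- m0 \<in> Q (orbit_cone N \<tau> \<zeta>)"
    using m0 sub additive_subgroup_uminus[OF additive_subgroup_dual_lattice]
    by (auto simp: character_monoid_def)
  then obtain L where L: "- m0 + of_nat L *\<^sub>R m1 \<in> Q \<tau>"
    using localization[OF \<tau> m1(1,3)] by blast
  have "\<zeta> m0 * \<zeta> (- m0 + of_nat L *\<^sub>R m1) = \<zeta> m1 ^ L"
    using monoid_hom_add[OF \<zeta> m0 L] monoid_hom_scale[OF \<zeta> m1(1)] by simp
  then show ?thesis
    using m1(2) by auto
qed

lemma extension_iff:
  assumes \<tau>: "\<tau> \<in> \<Sigma>" and \<gamma>: "\<gamma> \<in> \<Sigma>" "\<gamma> \<subseteq> \<tau>" and \<zeta>: "monoid_hom N \<tau> \<zeta>"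
    and sub: "orbit_cone N \<tau> \<zeta> \<subseteq> \<gamma>"
  obtains \<xi> where "monoid_hom N \<gamma> \<xi>" "\<And>m. m \<in> Q \<tau> \<Longrightarrow> \<xi> m = \<zeta> m"
proof -
  obtain m0 where m0: "m0 \<in> Q \<tau>" "\<gamma> = {x \<in> \<tau>. m0 \<bullet> x = 0}"
    using subcone_cut[OF \<tau> \<gamma>] by blast
  have "\<zeta> m0 \<noteq> 0"
    using sub m0(2) by (intro cut_nonzero[OF \<tau> \<zeta> m0(1)]) auto
  then show thesis
    using extension_exists[OF \<tau> m0 \<zeta>] that by blast
qed

text \<open>The character \<open>m0\<close> that cuts out \<open>\<gamma>\<close> is a unit there,
  so the orbit cone in \<open>\<tau>\<close> is orthogonal to it and lies in
  \<open>\<gamma>\<close>. Adding multiples of \<open>m0\<close> moves characters of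
  \<open>\<gamma>\<close> into \<open>Q \<tau>\<close> without affecting whether they vanish. Thus
  the orbit cone belongs to the point and not to the chart.\<close>

lemma orbit_cone_extension:
  assumes \<tau>: "\<tau> \<in> \<Sigma>" and \<gamma>: "\<gamma> \<in> \<Sigma>" "\<gamma> \<subseteq> \<tau>" and \<xi>: "monoid_hom N \<gamma> \<xi>"
    and ext: "\<And>m. m \<in> Q \<tau> \<Longrightarrow> \<xi> m = \<zeta> m"
  shows "orbit_cone N \<tau> \<zeta> = orbit_cone N \<gamma> \<xi>"
proof -
  obtain m0 where m0: "m0 \<in> Q \<tau>" "\<gamma> = {x \<in> \<tau>. m0 \<bullet> x = 0}"
    using subcone_cut[OF \<tau> \<gamma>] by blast
  have nz: "\<xi> m0 \<noteq> 0"
    by (rule cut_unit[OF m0 \<xi>])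
  have Q: "Q \<tau> \<subseteq> Q \<gamma>"
    using \<gamma>(2) by (rule character_monoid_mono)
  show ?thesis
  proof (intro subset_antisym subsetI)
    fix u assume u: "u \<in> orbit_cone N \<tau> \<zeta>"
    then have u0: "m0 \<bullet> u = 0" and "u \<in> \<tau>"
      using m0(1) nz ext by (auto simp: orbit_cone_def)
    have "m \<bullet> u = 0" if m: "m \<in> Q \<gamma>" "\<xi> m \<noteq> 0" for m
    proof -
      obtain L where L: "m + of_nat L *\<^sub>R m0 \<in> Q \<tau>"
        using localization[OF \<tau> m0 m(1)] by blast
      have "\<xi> (m + of_nat L *\<^sub>R m0) \<noteq> 0"
        using hom_shift[OF \<xi> m(1), of m0 L] Q m0(1) m(2) nz by auto
      then have "(m + of_nat L *\<^sub>R m0) \<bullet> u = 0"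
        using u L ext by (auto simp: orbit_cone_def)
      then show ?thesis
        by (simp add: inner_add_left u0)
    qed
    then show "u \<in> orbit_cone N \<gamma> \<xi>"
      using u0 \<open>u \<in> \<tau>\<close> m0(2) by (auto simp: orbit_cone_def)
  next
    fix u assume "u \<in> orbit_cone N \<gamma> \<xi>"
    then show "u \<in> orbit_cone N \<tau> \<zeta>"
      using Q ext \<gamma>(2) by (auto simp: orbit_cone_def)
  qed
qed

section \<open>The gluing relation and the points of the toric variety\<close>

lemma glue_iff:
  "((\<tau>, hom_point N \<tau> \<zeta>), (\<tau>', hom_point N \<tau>' \<zeta>')) \<in> glue N \<Sigma> \<longleftrightarrow>
    \<tau> \<in> \<Sigma> \<and> \<tau>' \<in> \<Sigma> \<and> (\<exists>\<xi>. monoid_hom N (\<tau> \<inter> \<tau>') \<xi> \<and>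
      (\<forall>m\<in>Q \<tau>. \<zeta> m = \<xi> m) \<and> (\<forall>m\<in>Q \<tau>'. \<zeta>' m = \<xi> m))"
    (is "?L \<longleftrightarrow> ?R")
proof
  assume ?L
  then obtain y where y: "\<tau> \<in> \<Sigma>" "\<tau>' \<in> \<Sigma>" "y \<in> points (A (\<tau> \<inter> \<tau>'))"
    "hom_point N \<tau> \<zeta> = restrict y (A \<tau>)" "hom_point N \<tau>' \<zeta>' = restrict y (A \<tau>')"
    unfolding glue_def by blast
  obtain \<xi> where \<xi>: "monoid_hom N (\<tau> \<inter> \<tau>') \<xi>" "y = hom_point N (\<tau> \<inter> \<tau>') \<xi>"
    using pointsE[OF y(3)] by blast
  then show ?R
    using y by (auto simp: restrict_hom_point hom_point_eq_iff intro!: exI[of _ \<xi>])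
next
  assume ?R
  then obtain \<xi> where \<xi>: "\<tau> \<in> \<Sigma>" "\<tau>' \<in> \<Sigma>" "monoid_hom N (\<tau> \<inter> \<tau>') \<xi>"
    "\<forall>m\<in>Q \<tau>. \<zeta> m = \<xi> m" "\<forall>m\<in>Q \<tau>'. \<zeta>' m = \<xi> m"
    by blast
  have "hom_point N \<tau> \<zeta> = restrict (hom_point N (\<tau> \<inter> \<tau>') \<xi>) (A \<tau>)"
    "hom_point N \<tau>' \<zeta>' = restrict (hom_point N (\<tau> \<inter> \<tau>') \<xi>) (A \<tau>')"
    using \<xi>(4,5) by (simp_all add: restrict_hom_point hom_point_eq_iff)
  then show ?L
    unfolding glue_def using \<xi>(1,2) hom_point_in_points[OF \<xi>(3)] by blast
qed

lemma glueE:
  assumes "(p, p') \<in> glue N \<Sigma>"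
  obtains \<tau> \<tau>' \<zeta> where "\<tau> \<in> \<Sigma>" "\<tau>' \<in> \<Sigma>" "monoid_hom N (\<tau> \<inter> \<tau>') \<zeta>"
    "p = (\<tau>, hom_point N \<tau> \<zeta>)" "p' = (\<tau>', hom_point N \<tau>' \<zeta>)"
proof -
  obtain \<tau> \<tau>' y where y: "\<tau> \<in> \<Sigma>" "\<tau>' \<in> \<Sigma>" "y \<in> points (A (\<tau> \<inter> \<tau>'))"
    "p = (\<tau>, restrict y (A \<tau>))" "p' = (\<tau>', restrict y (A \<tau>'))"
    using assms unfolding glue_def by blast
  obtain \<zeta> where "monoid_hom N (\<tau> \<inter> \<tau>') \<zeta>" "y = hom_point N (\<tau> \<inter> \<tau>') \<zeta>"
    using pointsE[OF y(3)] by blast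
  then show thesis
    using that[of \<tau> \<tau>' \<zeta>] y by (simp add: restrict_hom_point)
qed

text \<open>The middle point extends to the charts of both pairwise intersections, so its orbit cone
  lies in the triple intersection, and it extends to that chart. By \<open>extension_unique\<close>
  this extension agrees with the two given ones, and it witnesses the gluing of the outer
  points.\<close>

lemma glue_trans:
  assumes "(p, p') \<in> glue N \<Sigma>" "(p', p'') \<in> glue N \<Sigma>"
  shows "(p, p'') \<in> glue N \<Sigma>"
proof -
  obtain \<tau> \<tau>' \<zeta> where 1: "\<tau> \<in> \<Sigma>" "\<tau>' \<in> \<Sigma>" "monoid_hom N (\<tau> \<inter> \<tau>') \<zeta>"
    "p = (\<tau>, hom_point N \<tau> \<zeta>)" "p' = (\<tau>', hom_point N \<tau>' \<zeta>)"
    using assms(1) by (rule glueE)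
  obtain \<tau>'' \<eta> where 2: "\<tau>'' \<in> \<Sigma>" "monoid_hom N (\<tau>' \<inter> \<tau>'') \<eta>"
    "p' = (\<tau>', hom_point N \<tau>' \<eta>)" "p'' = (\<tau>'', hom_point N \<tau>'' \<eta>)"
    using assms(2) 1(5) by (elim glueE) blast
  have agree: "\<zeta> m = \<eta> m" if "m \<in> Q \<tau>'" for m
    using 1(5) 2(3) that by (simp add: hom_point_eq_iff)
  let ?\<gamma> = "\<tau> \<inter> \<tau>' \<inter> \<tau>''"
  have \<gamma>: "?\<gamma> \<in> \<Sigma>" "\<tau> \<inter> \<tau>' \<in> \<Sigma>" "\<tau>' \<inter> \<tau>'' \<in> \<Sigma>"
    using 1 2 by (auto intro!: Int_in_fan)
  have \<zeta>': "monoid_hom N \<tau>' \<zeta>"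
    using monoid_hom_mono[OF _ 1(3)] by blast
  have "orbit_cone N \<tau>' \<zeta> = orbit_cone N (\<tau> \<inter> \<tau>') \<zeta>"
    using orbit_cone_extension[OF 1(2) \<gamma>(2) _ 1(3)] by blast
  moreover have "orbit_cone N \<tau>' \<zeta> = orbit_cone N (\<tau>' \<inter> \<tau>'') \<eta>"
    using orbit_cone_extension[OF 1(2) \<gamma>(3) _ 2(2)] agree by auto
  ultimately have "orbit_cone N \<tau>' \<zeta> \<subseteq> ?\<gamma>"
    using orbit_cone_subset by blast
  then obtain \<xi> where \<xi>: "monoid_hom N ?\<gamma> \<xi>" "\<And>m. m \<in> Q \<tau>' \<Longrightarrow> \<xi> m = \<zeta> m"
    using extension_iff[OF 1(2) \<gamma>(1) _ \<zeta>'] by blast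
  have "\<xi> m = \<zeta> m" if "m \<in> Q (\<tau> \<inter> \<tau>')" for m
    using extension_unique[OF 1(2) \<gamma>(2) _ monoid_hom_mono[OF _ \<xi>(1)] 1(3) \<xi>(2) that] by blast
  moreover have "\<xi> m = \<eta> m" if "m \<in> Q (\<tau>' \<inter> \<tau>'')" for m
    using extension_unique[OF 1(2) \<gamma>(3) _ monoid_hom_mono[OF _ \<xi>(1)] 2(2) _ that] \<xi>(2) agree
    by auto
  moreover have "Q \<tau> \<subseteq> Q (\<tau> \<inter> \<tau>')" "Q \<tau>'' \<subseteq> Q (\<tau>' \<inter> \<tau>'')"
    by (auto intro!: character_monoid_mono)
  moreover have "monoid_hom N (\<tau> \<inter> \<tau>'') \<xi>"
    using monoid_hom_mono[OF _ \<xi>(1)] by blast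
  ultimately show ?thesis
    unfolding 1(4) 2(4) glue_iff using 1(1) 2(1) by (auto intro!: exI[of _ \<xi>])
qed

lemma glue_sym: "(p, p') \<in> glue N \<Sigma> \<Longrightarrow> (p', p) \<in> glue N \<Sigma>"
  by (elim glueE) (auto simp: glue_iff Int_commute)

lemma tpoint_eq_iff:
  assumes "\<tau> \<in> \<Sigma>" "\<tau>' \<in> \<Sigma>" "monoid_hom N \<tau> \<zeta>" "monoid_hom N \<tau>' \<zeta>'"
  shows "tpoint \<tau> \<zeta> = tpoint \<tau>' \<zeta>' \<longleftrightarrow>
    (\<exists>\<xi>. monoid_hom N (\<tau> \<inter> \<tau>') \<xi> \<and> (\<forall>m\<in>Q \<tau>. \<zeta> m = \<xi> m) \<and> (\<forall>m\<in>Q \<tau>'. \<zeta>' m = \<xi> m))"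
proof -
  let ?p = "(\<tau>, hom_point N \<tau> \<zeta>)" and ?p' = "(\<tau>', hom_point N \<tau>' \<zeta>')"
  have "(?p', ?p') \<in> glue N \<Sigma>"
    unfolding glue_iff using assms by auto
  then have "tpoint \<tau> \<zeta> = tpoint \<tau>' \<zeta>' \<longleftrightarrow> (?p, ?p') \<in> glue N \<Sigma>"
    unfolding chart_def using glue_trans glue_sym by blast
  then show ?thesis
    using assms(1,2) by (simp add: glue_iff)
qed

lemma tpoint_eqI:
  assumes "\<tau> \<in> \<Sigma>" "\<tau>' \<in> \<Sigma>" "monoid_hom N (\<tau> \<inter> \<tau>') \<xi>"
  shows "tpoint \<tau> \<xi> = tpoint \<tau>' \<xi>"
proof -
  have "monoid_hom N \<tau> \<xi>" "monoid_hom N \<tau>' \<xi>"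
    by (rule monoid_hom_mono[OF _ assms(3)], simp)+
  then show ?thesis
    unfolding tpoint_eq_iff[OF assms(1,2) \<open>monoid_hom N \<tau> \<xi>\<close> \<open>monoid_hom N \<tau>' \<xi>\<close>]
    by (intro exI[of _ \<xi>]) (simp add: assms(3))
qed

lemma tpoint_eq_orbit_cone:
  assumes "\<tau> \<in> \<Sigma>" "\<tau>' \<in> \<Sigma>" "monoid_hom N \<tau> \<zeta>" "monoid_hom N \<tau>' \<zeta>'" "tpoint \<tau> \<zeta> = tpoint \<tau>' \<zeta>'"
  shows "orbit_cone N \<tau> \<zeta> = orbit_cone N \<tau>' \<zeta>'"
proof -
  have "\<exists>\<xi>. monoid_hom N (\<tau> \<inter> \<tau>') \<xi> \<and> (\<forall>m\<in>Q \<tau>. \<zeta> m = \<xi> m) \<and> (\<forall>m\<in>Q \<tau>'. \<zeta>' m = \<xi> m)"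
    by (rule iffD1[OF tpoint_eq_iff[OF assms(1-4)] assms(5)])
  then obtain \<xi> where \<xi>: "monoid_hom N (\<tau> \<inter> \<tau>') \<xi>" "\<And>m. m \<in> Q \<tau> \<Longrightarrow> \<xi> m = \<zeta> m"
    "\<And>m. m \<in> Q \<tau>' \<Longrightarrow> \<xi> m = \<zeta>' m"
    by auto
  have "\<tau> \<inter> \<tau>' \<in> \<Sigma>"
    by (rule Int_in_fan[OF assms(1,2)])
  then show ?thesis
    using orbit_cone_extension[OF assms(1) _ _ \<xi>(1,2)] orbit_cone_extension[OF assms(2) _ _ \<xi>(1,3)]
    by simp
qed

lemma toric_variety_eq: "toric_variety N \<Sigma> = {tpoint \<tau> \<zeta> | \<tau> \<zeta>. \<tau> \<in> \<Sigma> \<and> monoid_hom N \<tau> \<zeta>}"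
proof (intro subset_antisym subsetI)
  fix p assume "p \<in> toric_variety N \<Sigma>"
  then obtain \<tau> x where x: "\<tau> \<in> \<Sigma>" "x \<in> points (A \<tau>)" "p = chart N \<Sigma> \<tau> x"
    unfolding toric_variety_def chart_def by (auto elim!: quotientE)
  from x(2) obtain \<zeta> where "monoid_hom N \<tau> \<zeta>" "x = hom_point N \<tau> \<zeta>"
    by (rule pointsE)
  then show "p \<in> {tpoint \<tau> \<zeta> | \<tau> \<zeta>. \<tau> \<in> \<Sigma> \<and> monoid_hom N \<tau> \<zeta>}"
    using x(1,3) by blast
next
  fix p assume "p \<in> {tpoint \<tau> \<zeta> | \<tau> \<zeta>. \<tau> \<in> \<Sigma> \<and> monoid_hom N \<tau> \<zeta>}"
  then obtain \<tau> \<zeta> where "p = tpoint \<tau> \<zeta>" "\<tau> \<in> \<Sigma>" "monoid_hom N \<tau> \<zeta>"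
    by blast
  then show "p \<in> toric_variety N \<Sigma>"
    unfolding toric_variety_def chart_def by (auto intro!: quotientI hom_point_in_points)
qed

text \<open>One direction is the independence of the orbit cone from the chart. For the other, the
  point extends to the chart of \<open>\<tau> \<inter> \<sigma>\<close> and reappears from there in
  the chart of \<open>\<sigma>\<close>.\<close>

lemma tpoint_in_chart_iff:
  assumes "\<tau> \<in> \<Sigma>" "\<sigma> \<in> \<Sigma>" "monoid_hom N \<tau> \<zeta>"
  shows "tpoint \<tau> \<zeta> \<in> chart N \<Sigma> \<sigma> ` points (A \<sigma>) \<longleftrightarrow> orbit_cone N \<tau> \<zeta> \<subseteq> \<sigma>"
proof
  assume "tpoint \<tau> \<zeta> \<in> chart N \<Sigma> \<sigma> ` points (A \<sigma>)"
  then obtain \<zeta>' where "monoid_hom N \<sigma> \<zeta>'" "tpoint \<tau> \<zeta> = tpoint \<sigma> \<zeta>'"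
    by (auto elim!: pointsE)
  then show "orbit_cone N \<tau> \<zeta> \<subseteq> \<sigma>"
    using tpoint_eq_orbit_cone[OF assms(1,2,3)] orbit_cone_subset by blast
next
  assume "orbit_cone N \<tau> \<zeta> \<subseteq> \<sigma>"
  then obtain \<xi> where \<xi>: "monoid_hom N (\<tau> \<inter> \<sigma>) \<xi>" "\<And>m. m \<in> Q \<tau> \<Longrightarrow> \<xi> m = \<zeta> m"
    using extension_iff[OF assms(1) Int_in_fan[OF assms(1,2)] _ assms(3)] orbit_cone_subset[of \<tau> \<zeta>]
    by (metis Int_lower1 le_inf_iff)
  have "hom_point N \<tau> \<zeta> = hom_point N \<tau> \<xi>"
    using \<xi>(2) by (simp add: hom_point_eq_iff)
  then have "tpoint \<tau> \<zeta> = tpoint \<sigma> \<xi>"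
    using tpoint_eqI[OF assms(1,2) \<xi>(1)] by simp
  then show "tpoint \<tau> \<zeta> \<in> chart N \<Sigma> \<sigma> ` points (A \<sigma>)"
    using hom_point_in_points[OF monoid_hom_mono[OF _ \<xi>(1)]] by blast
qed

end

section \<open>Orbit closures\<close>

text \<open>The vectors to be avoided lie on finitely many hyperplanes, which are null sets.\<close>

lemma finite_distinct_inner_exists:
  fixes K :: "'a::euclidean_space set"
  assumes "finite K"
  shows "\<exists>w. \<forall>m\<in>K. \<forall>m'\<in>K. m \<noteq> m' \<longrightarrow> m \<bullet> w \<noteq> m' \<bullet> w"
proof -
  let ?H = "\<lambda>(m, m'). {w. (m - m') \<bullet> w = 0}"
  let ?I = "{p \<in> K \<times> K. fst p \<noteq> snd p}"
  have "negligible (\<Union>(?H ` ?I))"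
  proof (rule negligible_Union)
    show "finite (?H ` ?I)"
      using assms by simp
    show "negligible t" if "t \<in> ?H ` ?I" for t
      using that by (auto intro: negligible_hyperplane)
  qed
  then have "\<Union>(?H ` ?I) \<noteq> UNIV"
    using non_negligible_UNIV by metis
  then obtain w where "w \<notin> \<Union>(?H ` ?I)"
    by blast
  then show ?thesis
    by (intro exI[of _ w]) (auto simp: inner_diff_left)
qed

text \<open>After division by the exponential with the largest exponent, only its coefficient
  survives in the limit.\<close>

lemma exponential_sum_eventually_nonzero:
  fixes K :: "'a::euclidean_space set"
  assumes "finite K" "K \<noteq> {}" "\<And>m. m \<in> K \<Longrightarrow> c m \<noteq> (0::real)" "inj_on (\<lambda>m. m \<bullet> w) K"
  shows "\<forall>\<^sub>F s in at_top. (\<Sum>m\<in>K. c m * exp (s * (m \<bullet> w))) \<noteq> 0"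
proof -
  have "Max ((\<lambda>m. m \<bullet> w) ` K) \<in> (\<lambda>m. m \<bullet> w) ` K"
    using assms(1,2) by (intro Max_in) auto
  then obtain M where M: "M \<in> K" "Max ((\<lambda>m. m \<bullet> w) ` K) = M \<bullet> w"
    by blast
  then have M: "M \<in> K" "\<And>m. m \<in> K \<Longrightarrow> m \<bullet> w \<le> M \<bullet> w"
    using Max_ge[of "(\<lambda>m. m \<bullet> w) ` K"] assms(1) by auto
  have less: "m \<bullet> w - M \<bullet> w < 0" if "m \<in> K - {M}" for m
  proof -
    have "m \<bullet> w \<noteq> M \<bullet> w"
      using inj_onD[OF assms(4), of m M] that M(1) by auto
    then show ?thesis
      using M(2)[of m] that by auto
  qed
  have "((\<lambda>s. c m * exp (s * (m \<bullet> w - M \<bullet> w))) \<longlongrightarrow> c m * 0) at_top" if "m \<in> K - {M}" for m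
  proof (intro tendsto_mult tendsto_const filterlim_compose[OF exp_at_bot])
    have "filterlim (\<lambda>s. (m \<bullet> w - M \<bullet> w) * s) at_bot at_top"
      by (rule filterlim_tendsto_neg_mult_at_bot[OF tendsto_const less[OF that] filterlim_ident])
    then show "filterlim (\<lambda>s. s * (m \<bullet> w - M \<bullet> w)) at_bot at_top"
      by (simp add: mult.commute)
  qed
  then have "((\<lambda>s. \<Sum>m\<in>K - {M}. c m * exp (s * (m \<bullet> w - M \<bullet> w))) \<longlongrightarrow> (\<Sum>m\<in>K - {M}. 0)) at_top"
    by (intro tendsto_sum) simp
  then have "((\<lambda>s. c M + (\<Sum>m\<in>K - {M}. c m * exp (s * (m \<bullet> w - M \<bullet> w)))) \<longlongrightarrow> c M + 0) at_top"
    by (intro tendsto_add tendsto_const) simp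
  then have "\<forall>\<^sub>F s in at_top. c M + (\<Sum>m\<in>K - {M}. c m * exp (s * (m \<bullet> w - M \<bullet> w))) \<noteq> 0"
    using assms(3)[OF M(1)] by (intro tendsto_imp_eventually_ne[where c = "c M"]) simp_all
  then show ?thesis
  proof eventually_elim
    case (elim s)
    have "(\<Sum>m\<in>K. c m * exp (s * (m \<bullet> w))) =
        exp (s * (M \<bullet> w)) * (c M + (\<Sum>m\<in>K - {M}. c m * exp (s * (m \<bullet> w - M \<bullet> w))))"
      using assms(1) M(1)
      by (simp add: sum.remove[of K M] sum_distrib_left distrib_left exp_diff right_diff_distrib mult.left_commute)
    then show ?case
      using elim by simp
  qed
qed

text \<open>Finitely many nonzero Laurent polynomials have a common non-root among the positive real
  points of the torus: along a generic direction each becomes an exponential sum with distinct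
  exponents.\<close>

lemma generic_exponentials:
  fixes F :: "('a::euclidean_space \<Rightarrow>\<^sub>0 real) set"
  assumes "finite F" "0 \<notin> F"
  shows "\<exists>w. \<forall>f\<in>F. eval_hom (\<lambda>m. of_real (exp (m \<bullet> w))) f \<noteq> 0"
proof -
  have "finite (\<Union>f\<in>F. Poly_Mapping.keys f)"
    using assms(1) by simp
  then obtain w where w: "\<And>m m'. m \<in> (\<Union>f\<in>F. Poly_Mapping.keys f) \<Longrightarrow>
      m' \<in> (\<Union>f\<in>F. Poly_Mapping.keys f) \<Longrightarrow> m \<noteq> m' \<Longrightarrow> m \<bullet> w \<noteq> m' \<bullet> w"
    using finite_distinct_inner_exists by meson
  have "\<forall>f\<in>F. \<forall>\<^sub>F s in at_top. (\<Sum>m\<in>Poly_Mapping.keys f. Poly_Mapping.lookup f m * exp (s * (m \<bullet> w))) \<noteq> 0"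
  proof
    fix f assume "f \<in> F"
    then have "Poly_Mapping.keys f \<noteq> {}"
      using assms(2) by auto
    moreover have "inj_on (\<lambda>m. m \<bullet> w) (Poly_Mapping.keys f)"
      using w \<open>f \<in> F\<close> by (intro inj_onI) blast
    ultimately show "\<forall>\<^sub>F s in at_top. (\<Sum>m\<in>Poly_Mapping.keys f. Poly_Mapping.lookup f m * exp (s * (m \<bullet> w))) \<noteq> 0"
      by (intro exponential_sum_eventually_nonzero) (auto simp: in_keys_iff)
  qed
  then have "\<forall>\<^sub>F s in at_top. \<forall>f\<in>F. (\<Sum>m\<in>Poly_Mapping.keys f. Poly_Mapping.lookup f m * exp (s * (m \<bullet> w))) \<noteq> 0"
    using assms(1) by (simp add: eventually_ball_finite)
  then obtain s where s: "\<forall>f\<in>F. (\<Sum>m\<in>Poly_Mapping.keys f. Poly_Mapping.lookup f m * exp (s * (m \<bullet> w))) \<noteq> 0"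
    using eventually_happens'[OF trivial_limit_at_top_linorder] by blast
  have "eval_hom (\<lambda>m. of_real (exp (m \<bullet> (s *\<^sub>R w)))) f =
      of_real (\<Sum>m\<in>Poly_Mapping.keys f. Poly_Mapping.lookup f m * exp (s * (m \<bullet> w)))" for f :: "'a \<Rightarrow>\<^sub>0 real"
    by (simp add: eval_hom_def)
  then show ?thesis
    using s by (intro exI[of _ "s *\<^sub>R w"]) (simp only: of_real_eq_0_iff)
qed

text \<open>The distinguished point of the orbit of \<open>\<rho>\<close>, translated by the
  positive real torus element with logarithm \<open>w\<close>.\<close>

definition face_hom :: "'a::euclidean_space set \<Rightarrow> 'a \<Rightarrow> 'a \<Rightarrow> complex" where
  "face_hom \<rho> w m = (if \<forall>u\<in>\<rho>. m \<bullet> u = 0 then of_real (exp (m \<bullet> w)) else 0)"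

lemma monoid_hom_face_hom:
  assumes "\<rho> \<subseteq> \<tau>"
  shows "monoid_hom N \<tau> (face_hom \<rho> w)"
proof -
  have "face_hom \<rho> w (m + m') = face_hom \<rho> w m * face_hom \<rho> w m'"
    if m: "m \<in> character_monoid N \<tau>" "m' \<in> character_monoid N \<tau>" for m m'
  proof -
    have "(m + m') \<bullet> u = 0 \<longleftrightarrow> m \<bullet> u = 0 \<and> m' \<bullet> u = 0" if "u \<in> \<rho>" for u
      using m assms that by (auto simp: character_monoid_def inner_add_left add_nonneg_eq_0_iff subset_iff)
    then show ?thesis
      by (auto simp: face_hom_def inner_add_left exp_add)
  qed
  then show ?thesis
    by (auto simp: monoid_hom_def face_hom_def)
qed

lemma orbit_cone_face_hom: "\<rho> \<subseteq> \<tau> \<Longrightarrow> \<rho> \<subseteq> orbit_cone N \<tau> (face_hom \<rho> w)"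
  by (auto simp: orbit_cone_def face_hom_def)

text \<open>The terms with exponents orthogonal to \<open>\<rho>\<close>, collected in
  \<open>part f\<close>, are all that \<open>f\<close> retains on the orbit. They form a nonzero
  Laurent polynomial, to which \<open>generic_exponentials\<close> applies.\<close>

lemma generic_face_hom:
  fixes F :: "('a::euclidean_space \<Rightarrow>\<^sub>0 real) set"
  assumes "finite F" "\<And>f. f \<in> F \<Longrightarrow> \<exists>m\<in>Poly_Mapping.keys f. \<forall>u\<in>\<rho>. m \<bullet> u = 0"
  shows "\<exists>w. \<forall>f\<in>F. eval_hom (face_hom \<rho> w) f \<noteq> 0"
proof -
  define P where "P = (\<lambda>m. \<forall>u\<in>\<rho>. m \<bullet> u = 0)"
  define part where "part = (\<lambda>f :: 'a \<Rightarrow>\<^sub>0 real. \<Sum>m\<in>{m \<in> Poly_Mapping.keys f. P m}.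
    Poly_Mapping.single m (Poly_Mapping.lookup f m))"
  have "part f \<noteq> 0" if f: "f \<in> F" for f
  proof -
    obtain m where m: "m \<in> Poly_Mapping.keys f" "P m"
      using assms(2)[OF f] by (auto simp: P_def)
    have "Poly_Mapping.lookup (part f) m = (\<Sum>m'\<in>{m \<in> Poly_Mapping.keys f. P m}. if m' = m then Poly_Mapping.lookup f m else 0)"
      unfolding part_def lookup_sum by (intro sum.cong) (auto simp: lookup_single when_def)
    also have "\<dots> = Poly_Mapping.lookup f m"
      using m by simp
    finally show ?thesis
      using m(1) by (auto simp: in_keys_iff)
  qed
  then have "0 \<notin> part ` F"
    by (metis imageE)
  then obtain w where w: "\<forall>f\<in>part ` F. eval_hom (\<lambda>m. of_real (exp (m \<bullet> w))) f \<noteq> 0"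
    using generic_exponentials[of "part ` F"] assms(1) by blast
  have "eval_hom (face_hom \<rho> w) f = eval_hom (\<lambda>m. of_real (exp (m \<bullet> w))) (part f)" for f
  proof -
    have "eval_hom (face_hom \<rho> w) f =
        (\<Sum>m\<in>Poly_Mapping.keys f. if P m then of_real (Poly_Mapping.lookup f m) * of_real (exp (m \<bullet> w)) else 0)"
      unfolding eval_hom_def by (intro sum.cong) (auto simp: face_hom_def P_def)
    then show ?thesis
      unfolding part_def eval_hom_sum by (subst sum.inter_filter) (auto intro!: sum.cong)
  qed
  then have "\<forall>f\<in>F. eval_hom (face_hom \<rho> w) f \<noteq> 0"
    using w by (metis imageI)
  then show ?thesis
    by blast
qed

section \<open>Principal open sets and irreducible components\<close>

lemma topspace_affine_zariski:
  "topspace (affine_zariski (coordinate_ring N \<tau>)) = points (coordinate_ring N \<tau>)"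
proof -
  have "x (Poly_Mapping.single 0 1) \<noteq> 0" if "x \<in> points (coordinate_ring N \<tau>)" for x
  proof -
    have "x (Poly_Mapping.single 0 1) = of_real 1"
      using that unfolding points_def by blast
    then show ?thesis
      by simp
  qed
  then show ?thesis
    unfolding affine_zariski_def topology_generated_by_topspace
    using coordinate_ring_single[OF character_monoid_0] by blast
qed

lemma openin_affine_zariski_basis:
  "f \<in> A \<Longrightarrow> openin (affine_zariski A) {x \<in> points A. x f \<noteq> 0}"
  unfolding affine_zariski_def by (intro topology_generated_by_Basis) blast

text \<open>Principal open sets generate the topology; they are even a basis because two of them
  intersect in the one of the product \<open>f * g\<close>.\<close>

lemma affine_zariski_neighbourhood:
  assumes "openin (affine_zariski (coordinate_ring N \<tau>)) W" "x \<in> W"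
  obtains f where "f \<in> coordinate_ring N \<tau>" "x f \<noteq> 0" "{y \<in> points (coordinate_ring N \<tau>). y f \<noteq> 0} \<subseteq> W"
proof -
  let ?A = "coordinate_ring N \<tau>"
  have "generate_topology_on {{x \<in> points ?A. x f \<noteq> 0} | f. f \<in> ?A} W"
    using openin_topology_generated_by assms(1) unfolding affine_zariski_def by blast
  then have "\<forall>x\<in>W. x \<in> points ?A \<and> (\<exists>f\<in>?A. x f \<noteq> 0 \<and> {y \<in> points ?A. y f \<noteq> 0} \<subseteq> W)"
  proof (induction W rule: generate_topology_on.induct)
    case Empty
    then show ?case by simp
  next
    case (Int a b)
    show ?case
    proof
      fix x assume x: "x \<in> a \<inter> b"
      obtain f where f: "f \<in> ?A" "x f \<noteq> 0" "{y \<in> points ?A. y f \<noteq> 0} \<subseteq> a"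
        using Int.IH(1) x by blast
      obtain g where g: "g \<in> ?A" "x g \<noteq> 0" "{y \<in> points ?A. y g \<noteq> 0} \<subseteq> b"
        using Int.IH(2) x by blast
      have prod: "y (f * g) = y f * y g" if "y \<in> points ?A" for y
        using that f(1) g(1) by (simp add: points_def)
      have "x \<in> points ?A"
        using Int.IH(1) x by blast
      moreover have "{y \<in> points ?A. y (f * g) \<noteq> 0} \<subseteq> a \<inter> b"
      proof
        fix y assume y: "y \<in> {y \<in> points ?A. y (f * g) \<noteq> 0}"
        then have "y f \<noteq> 0" "y g \<noteq> 0"
          using prod[of y] by auto
        then show "y \<in> a \<inter> b"
          using y f(3) g(3) by blast
      qed
      moreover have "x (f * g) \<noteq> 0"
        using prod[of x] f(2) g(2) calculation(1) by simp
      ultimately show "x \<in> points ?A \<and> (\<exists>f\<in>?A. x f \<noteq> 0 \<and> {y \<in> points ?A. y f \<noteq> 0} \<subseteq> a \<inter> b)"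
        using coordinate_ring_mult[OF f(1) g(1)] by blast
    qed
  next
    case (UN K)
    show ?case
    proof
      fix x assume "x \<in> \<Union>K"
      then obtain k where k: "k \<in> K" "x \<in> k"
        by blast
      then obtain f where "x \<in> points ?A" "f \<in> ?A" "x f \<noteq> 0" "{y \<in> points ?A. y f \<noteq> 0} \<subseteq> k"
        using UN.IH[OF k(1)] by blast
      moreover have "k \<subseteq> \<Union>K"
        using k(1) by blast
      ultimately show "x \<in> points ?A \<and> (\<exists>f\<in>?A. x f \<noteq> 0 \<and> {y \<in> points ?A. y f \<noteq> 0} \<subseteq> \<Union>K)"
        by (meson subset_trans)
    qed
  next
    case (Basis s)
    then obtain f where "s = {x \<in> points ?A. x f \<noteq> 0}" "f \<in> ?A"
      by blast
    then show ?case
      by (auto intro!: bexI[of _ f])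
  qed
  then show thesis
    using assms(2) that by blast
qed

lemma irreducible_in_finite_Union:
  assumes "irreducible_in T Z" "finite \<C>" "\<And>C. C \<in> \<C> \<Longrightarrow> closedin T C" "Z \<subseteq> \<Union>\<C>"
  shows "\<exists>C\<in>\<C>. Z \<subseteq> C"
  using assms(2-4)
proof (induction \<C> rule: finite_induct)
  case empty
  then show ?case
    using assms(1) by (auto simp: irreducible_in_def)
next
  case (insert C \<C>)
  have "closedin T (\<Union>\<C>)"
    using insert by (intro closedin_Union) auto
  then have "Z \<subseteq> C \<or> Z \<subseteq> \<Union>\<C>"
    using assms(1) insert.prems unfolding irreducible_in_def by (metis Union_insert insertI1)
  then show ?case
    using insert by blast
qed

text \<open>An irreducible subset of a finite union of closed sets lies in one of them, so members
  that are pairwise incomparable are exactly the maximal ones.\<close>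

lemma irreducible_components_finite_Union:
  assumes "finite \<C>" "\<And>C. C \<in> \<C> \<Longrightarrow> closedin T C \<and> irreducible_in T C"
    and "\<And>C C'. C \<in> \<C> \<Longrightarrow> C' \<in> \<C> \<Longrightarrow> C \<subseteq> C' \<Longrightarrow> C = C'"
  shows "irreducible_components T (\<Union>\<C>) = \<C>"
proof (intro subset_antisym subsetI)
  fix Z assume "Z \<in> irreducible_components T (\<Union>\<C>)"
  then have Z: "irreducible_in T Z" "Z \<subseteq> \<Union>\<C>"
    and max: "\<And>Z'. irreducible_in T Z' \<Longrightarrow> Z \<subseteq> Z' \<Longrightarrow> Z' \<subseteq> \<Union>\<C> \<Longrightarrow> Z' = Z"
    by (auto simp: irreducible_components_def)
  obtain C where "C \<in> \<C>" "Z \<subseteq> C"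
    using irreducible_in_finite_Union[OF Z(1) assms(1) _ Z(2)] assms(2) by blast
  then show "Z \<in> \<C>"
    using max[of C] assms(2) by (metis Union_upper)
next
  fix C assume C: "C \<in> \<C>"
  have "Z' = C" if Z': "irreducible_in T Z'" "C \<subseteq> Z'" "Z' \<subseteq> \<Union>\<C>" for Z'
  proof -
    obtain C' where "C' \<in> \<C>" "Z' \<subseteq> C'"
      using irreducible_in_finite_Union[OF Z'(1) assms(1) _ Z'(3)] assms(2) by blast
    then show ?thesis
      using assms(3)[of C C'] C Z'(2) by auto
  qed
  then show "C \<in> irreducible_components T (\<Union>\<C>)"
    using C assms(2) by (auto simp: irreducible_components_def)
qed

context toric_fan
begin

lemma topspace_toric_zariski: "topspace (toric_zariski N \<Sigma>) = toric_variety N \<Sigma>"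
proof -
  have "chart N \<Sigma> \<tau> x \<in> toric_variety N \<Sigma>" if "\<tau> \<in> \<Sigma>" "x \<in> points (A \<tau>)" for \<tau> x
    using that unfolding toric_variety_eq by (auto elim!: pointsE)
  then have "{x \<in> topspace (affine_zariski (A \<tau>)). chart N \<Sigma> \<tau> x \<in> toric_variety N \<Sigma>} =
      topspace (affine_zariski (A \<tau>))" if "\<tau> \<in> \<Sigma>" for \<tau>
    using that unfolding topspace_affine_zariski by blast
  then have "\<forall>\<tau>\<in>\<Sigma>. openin (affine_zariski (A \<tau>))
      {x \<in> topspace (affine_zariski (A \<tau>)). chart N \<Sigma> \<tau> x \<in> toric_variety N \<Sigma>}"
    by simp
  then have "openin (toric_zariski N \<Sigma>) (toric_variety N \<Sigma>)"
    unfolding toric_zariski_def openin_final_topology by blast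
  moreover have "topspace (toric_zariski N \<Sigma>) \<subseteq> toric_variety N \<Sigma>"
    unfolding topspace_def toric_zariski_def openin_final_topology by blast
  ultimately show ?thesis
    using openin_subset by blast
qed

lemma openin_toric_zariski_iff:
  "openin (toric_zariski N \<Sigma>) W \<longleftrightarrow> W \<subseteq> toric_variety N \<Sigma> \<and>
    (\<forall>\<tau>\<in>\<Sigma>. openin (affine_zariski (A \<tau>)) {x \<in> points (A \<tau>). chart N \<Sigma> \<tau> x \<in> W})"
  unfolding toric_zariski_def openin_final_topology by (simp add: topspace_affine_zariski)

text \<open>By the orbit-cone correspondence the closure of the orbit of \<open>\<rho>\<close> is
  the union of the orbits whose cones contain \<open>\<rho>\<close>; this description is taken as
  the definition.\<close>

definition orbit_closure :: "'a set \<Rightarrow> 'a toric_point set" where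
  "orbit_closure \<rho> = {tpoint \<tau> \<zeta> | \<tau> \<zeta>. \<tau> \<in> \<Sigma> \<and> monoid_hom N \<tau> \<zeta> \<and> \<rho> \<subseteq> orbit_cone N \<tau> \<zeta>}"

lemma tpoint_in_orbit_closure_iff:
  assumes "\<tau> \<in> \<Sigma>" "monoid_hom N \<tau> \<zeta>"
  shows "tpoint \<tau> \<zeta> \<in> orbit_closure \<rho> \<longleftrightarrow> \<rho> \<subseteq> orbit_cone N \<tau> \<zeta>"
proof
  assume "tpoint \<tau> \<zeta> \<in> orbit_closure \<rho>"
  then obtain \<tau>' \<zeta>' where *: "\<tau>' \<in> \<Sigma>" "monoid_hom N \<tau>' \<zeta>'" "\<rho> \<subseteq> orbit_cone N \<tau>' \<zeta>'" "tpoint \<tau> \<zeta> = tpoint \<tau>' \<zeta>'"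
    unfolding orbit_closure_def by blast
  then show "\<rho> \<subseteq> orbit_cone N \<tau> \<zeta>"
    using tpoint_eq_orbit_cone[OF assms(1) *(1) assms(2) *(2,4)] by simp
next
  assume "\<rho> \<subseteq> orbit_cone N \<tau> \<zeta>"
  then show "tpoint \<tau> \<zeta> \<in> orbit_closure \<rho>"
    unfolding orbit_closure_def using assms by blast
qed

lemma orbit_closure_subset: "orbit_closure \<rho> \<subseteq> toric_variety N \<Sigma>"
  unfolding orbit_closure_def toric_variety_eq by blast

text \<open>In a chart with \<open>\<rho> \<subseteq> \<tau>\<close> the complement is the union of
  the principal open sets of the characters not orthogonal to \<open>\<rho>\<close>; all other
  charts miss the set.\<close>

lemma closedin_orbit_closure: "closedin (toric_zariski N \<Sigma>) (orbit_closure \<rho>)"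
proof -
  have "openin (affine_zariski (A \<tau>)) {x \<in> points (A \<tau>). chart N \<Sigma> \<tau> x \<in> toric_variety N \<Sigma> - orbit_closure \<rho>}"
    if \<tau>: "\<tau> \<in> \<Sigma>" for \<tau>
  proof (cases "\<rho> \<subseteq> \<tau>")
    case True
    let ?B = "{{x \<in> points (A \<tau>). x (char_fun m) \<noteq> 0} | m. m \<in> Q \<tau> \<and> (\<exists>u\<in>\<rho>. m \<bullet> u \<noteq> 0)}"
    let ?W = "{x \<in> points (A \<tau>). chart N \<Sigma> \<tau> x \<in> toric_variety N \<Sigma> - orbit_closure \<rho>}"
    have *: "hom_point N \<tau> \<zeta> \<in> \<Union>?B \<longleftrightarrow> chart N \<Sigma> \<tau> (hom_point N \<tau> \<zeta>) \<in> toric_variety N \<Sigma> - orbit_closure \<rho>"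
      if \<zeta>: "monoid_hom N \<tau> \<zeta>" for \<zeta>
    proof -
      have "tpoint \<tau> \<zeta> \<in> toric_variety N \<Sigma>"
        unfolding toric_variety_eq using \<tau> \<zeta> by blast
      then have "tpoint \<tau> \<zeta> \<in> toric_variety N \<Sigma> - orbit_closure \<rho> \<longleftrightarrow> \<not> \<rho> \<subseteq> orbit_cone N \<tau> \<zeta>"
        by (simp add: tpoint_in_orbit_closure_iff[OF \<tau> \<zeta>])
      also have "\<dots> \<longleftrightarrow> (\<exists>m\<in>Q \<tau>. \<zeta> m \<noteq> 0 \<and> (\<exists>u\<in>\<rho>. m \<bullet> u \<noteq> 0))"
        using True by (auto simp: orbit_cone_def subset_iff)
      also have "\<dots> \<longleftrightarrow> (\<exists>m\<in>Q \<tau>. hom_point N \<tau> \<zeta> (char_fun m) \<noteq> 0 \<and> (\<exists>u\<in>\<rho>. m \<bullet> u \<noteq> 0))"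
        by (intro bex_cong refl) (simp add: hom_point_char)
      also have "\<dots> \<longleftrightarrow> hom_point N \<tau> \<zeta> \<in> \<Union>?B"
        using hom_point_in_points[OF \<zeta>] by blast
      finally show ?thesis
        by simp
    qed
    have iff: "x \<in> \<Union>?B \<longleftrightarrow> x \<in> ?W" if x: "x \<in> points (A \<tau>)" for x
    proof -
      obtain \<zeta> where \<zeta>: "monoid_hom N \<tau> \<zeta>" "x = hom_point N \<tau> \<zeta>"
        using x by (rule pointsE)
      show ?thesis
        using *[OF \<zeta>(1)] x unfolding \<zeta>(2) mem_Collect_eq by (simp only: simp_thms)
    qed
    have "\<Union>?B \<subseteq> points (A \<tau>)" "?W \<subseteq> points (A \<tau>)"
      by auto
    then have "x \<in> ?W \<longleftrightarrow> x \<in> \<Union>?B" for x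
      using iff[of x] by (cases "x \<in> points (A \<tau>)") (simp_all only: simp_thms, blast)
    then have "?W = \<Union>?B"
      by (rule set_eqI)
    moreover have "openin (affine_zariski (A \<tau>)) (\<Union>?B)"
      by (intro openin_Union) (auto intro: openin_affine_zariski_basis coordinate_ring_single)
    ultimately show ?thesis
      by simp
  next
    case False
    have "{x \<in> points (A \<tau>). chart N \<Sigma> \<tau> x \<in> toric_variety N \<Sigma> - orbit_closure \<rho>} = points (A \<tau>)"
    proof -
      have "chart N \<Sigma> \<tau> x \<in> toric_variety N \<Sigma> - orbit_closure \<rho>" if x: "x \<in> points (A \<tau>)" for x
      proof -
        obtain \<zeta> where \<zeta>: "monoid_hom N \<tau> \<zeta>" "x = hom_point N \<tau> \<zeta>"
          using x by (rule pointsE)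
        have "tpoint \<tau> \<zeta> \<in> toric_variety N \<Sigma>"
          unfolding toric_variety_eq using \<tau> \<zeta> by blast
        then show ?thesis
          using False orbit_cone_subset[of \<tau> \<zeta>] \<zeta>(2) by (auto simp: tpoint_in_orbit_closure_iff[OF \<tau> \<zeta>(1)])
      qed
      then show ?thesis
        by blast
    qed
    then show ?thesis
      by (metis openin_topspace topspace_affine_zariski)
  qed
  then have "openin (toric_zariski N \<Sigma>) (toric_variety N \<Sigma> - orbit_closure \<rho>)"
    unfolding openin_toric_zariski_iff by blast
  then show ?thesis
    unfolding closedin_def topspace_toric_zariski using orbit_closure_subset by blast
qed

lemma face_point_eq:
  assumes "\<tau> \<in> \<Sigma>" "\<rho> \<in> \<Sigma>" "\<rho> \<subseteq> \<tau>"
  shows "tpoint \<tau> (face_hom \<rho> w) = tpoint \<rho> (face_hom \<rho> w)"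
  using assms by (intro tpoint_eqI monoid_hom_face_hom) auto

lemma face_point_in_orbit_closure:
  assumes "\<rho> \<in> \<Sigma>"
  shows "tpoint \<rho> (face_hom \<rho> w) \<in> orbit_closure \<rho>"
  using tpoint_in_orbit_closure_iff[OF assms monoid_hom_face_hom[OF subset_refl]]
    orbit_cone_face_hom[OF subset_refl] by blast

text \<open>At points of the orbit closure every character that is not orthogonal to
  \<open>\<rho>\<close> vanishes.\<close>

lemma orbit_closure_nonvanishing_key:
  assumes "\<tau> \<in> \<Sigma>" "x \<in> points (A \<tau>)" "chart N \<Sigma> \<tau> x \<in> orbit_closure \<rho>" "f \<in> A \<tau>" "x f \<noteq> 0"
  shows "\<rho> \<subseteq> \<tau> \<and> (\<exists>m\<in>Poly_Mapping.keys f. \<forall>u\<in>\<rho>. m \<bullet> u = 0)"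
proof -
  obtain \<zeta> where \<zeta>: "monoid_hom N \<tau> \<zeta>" "x = hom_point N \<tau> \<zeta>"
    using assms(2) by (rule pointsE)
  have \<rho>: "\<rho> \<subseteq> orbit_cone N \<tau> \<zeta>"
    using assms(3) tpoint_in_orbit_closure_iff[OF assms(1) \<zeta>(1)] \<zeta>(2) by simp
  have "eval_hom \<zeta> f \<noteq> 0"
    using assms(4,5) \<zeta>(2) by (simp add: hom_point_apply)
  then obtain m where m: "m \<in> Poly_Mapping.keys f" "\<zeta> m \<noteq> 0"
    unfolding eval_hom_def by (metis (no_types, lifting) mult_zero_right sum.neutral)
  have "m \<in> Q \<tau>"
    using m(1) assms(4) by (auto simp: coordinate_ring_eq)
  then have "\<forall>u\<in>\<rho>. m \<bullet> u = 0"
    using \<rho> m(2) by (auto simp: orbit_cone_def)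
  then show ?thesis
    using m(1) \<rho> orbit_cone_subset by blast
qed

text \<open>Two closed sets that do not contain the orbit closure avoid principal open sets of
  functions \<open>f\<close> and \<open>g\<close>, possibly in different charts. The points of
  \<open>face_hom\<close> are the same in all charts above \<open>\<rho>\<close>, and a generic one
  is a zero of neither function, so it lies outside both sets.\<close>

lemma irreducible_orbit_closure:
  assumes \<rho>: "\<rho> \<in> \<Sigma>"
  shows "irreducible_in (toric_zariski N \<Sigma>) (orbit_closure \<rho>)"
  unfolding irreducible_in_def topspace_toric_zariski
proof (intro conjI allI impI; (elim conjE)?)
  show "orbit_closure \<rho> \<subseteq> toric_variety N \<Sigma>"
    by (rule orbit_closure_subset)
  show "orbit_closure \<rho> \<noteq> {}"
    using face_point_in_orbit_closure[OF \<rho>] by blast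
  fix C D
  assume C: "closedin (toric_zariski N \<Sigma>) C" and D: "closedin (toric_zariski N \<Sigma>) D"
    and sub: "orbit_closure \<rho> \<subseteq> C \<union> D"
  have test: "\<exists>\<tau> f. \<tau> \<in> \<Sigma> \<and> \<rho> \<subseteq> \<tau> \<and> f \<in> A \<tau> \<and> (\<exists>m\<in>Poly_Mapping.keys f. \<forall>u\<in>\<rho>. m \<bullet> u = 0) \<and>
      (\<forall>x\<in>points (A \<tau>). x f \<noteq> 0 \<longrightarrow> chart N \<Sigma> \<tau> x \<notin> E)"
    if E: "closedin (toric_zariski N \<Sigma>) E" "\<not> orbit_closure \<rho> \<subseteq> E" for E
  proof -
    obtain \<tau> \<zeta> where p: "\<tau> \<in> \<Sigma>" "monoid_hom N \<tau> \<zeta>" "\<rho> \<subseteq> orbit_cone N \<tau> \<zeta>" "tpoint \<tau> \<zeta> \<notin> E"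
      using E(2) unfolding orbit_closure_def by blast
    let ?W = "{x \<in> points (A \<tau>). chart N \<Sigma> \<tau> x \<in> toric_variety N \<Sigma> - E}"
    have "openin (toric_zariski N \<Sigma>) (toric_variety N \<Sigma> - E)"
      using E(1) unfolding closedin_def topspace_toric_zariski by blast
    then have W: "openin (affine_zariski (A \<tau>)) ?W"
      unfolding openin_toric_zariski_iff using p(1) by blast
    have "hom_point N \<tau> \<zeta> \<in> ?W"
      using p hom_point_in_points[OF p(2)] unfolding toric_variety_eq by blast
    then obtain f where f: "f \<in> A \<tau>" "hom_point N \<tau> \<zeta> f \<noteq> 0" "{y \<in> points (A \<tau>). y f \<noteq> 0} \<subseteq> ?W"
      using affine_zariski_neighbourhood[OF W] by blast
    have "\<rho> \<subseteq> \<tau> \<and> (\<exists>m\<in>Poly_Mapping.keys f. \<forall>u\<in>\<rho>. m \<bullet> u = 0)"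
      by (rule orbit_closure_nonvanishing_key[OF p(1) hom_point_in_points[OF p(2)] _ f(1,2)])
        (simp add: tpoint_in_orbit_closure_iff[OF p(1,2)] p(3))
    then show ?thesis
      using p(1) f(1,3) by blast
  qed
  show "orbit_closure \<rho> \<subseteq> C \<or> orbit_closure \<rho> \<subseteq> D"
  proof (rule ccontr)
    assume "\<not> (orbit_closure \<rho> \<subseteq> C \<or> orbit_closure \<rho> \<subseteq> D)"
    then have nC: "\<not> orbit_closure \<rho> \<subseteq> C" and nD: "\<not> orbit_closure \<rho> \<subseteq> D"
      by auto
    obtain \<tau> f where f: "\<tau> \<in> \<Sigma>" "\<rho> \<subseteq> \<tau>" "f \<in> A \<tau>" "\<exists>m\<in>Poly_Mapping.keys f. \<forall>u\<in>\<rho>. m \<bullet> u = 0"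
      "\<And>x. x \<in> points (A \<tau>) \<Longrightarrow> x f \<noteq> 0 \<Longrightarrow> chart N \<Sigma> \<tau> x \<notin> C"
      using test[OF C nC] by blast
    obtain \<tau>' g where g: "\<tau>' \<in> \<Sigma>" "\<rho> \<subseteq> \<tau>'" "g \<in> A \<tau>'" "\<exists>m\<in>Poly_Mapping.keys g. \<forall>u\<in>\<rho>. m \<bullet> u = 0"
      "\<And>x. x \<in> points (A \<tau>') \<Longrightarrow> x g \<noteq> 0 \<Longrightarrow> chart N \<Sigma> \<tau>' x \<notin> D"
      using test[OF D nD] by blast
    obtain w where w: "\<forall>h\<in>{f, g}. eval_hom (face_hom \<rho> w) h \<noteq> 0"
      using generic_face_hom[of "{f, g}" \<rho>] f(4) g(4) by auto
    have "tpoint \<tau> (face_hom \<rho> w) \<notin> C"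
      using w f(3) by (intro f(5) hom_point_in_points monoid_hom_face_hom f(2)) (simp add: hom_point_apply)
    moreover have "tpoint \<tau>' (face_hom \<rho> w) \<notin> D"
      using w g(3) by (intro g(5) hom_point_in_points monoid_hom_face_hom g(2)) (simp add: hom_point_apply)
    ultimately show False
      using face_point_in_orbit_closure[OF \<rho>, of w] sub
      by (simp add: face_point_eq[OF f(1) \<rho> f(2)] face_point_eq[OF g(1) \<rho> g(2)]) blast
  qed
qed

text \<open>A function with an exponent orthogonal to \<open>\<rho>\<close> is nonzero at a generic
  point of the orbit, by \<open>generic_face_hom\<close>; the other inclusion is
  \<open>orbit_closure_nonvanishing_key\<close>.\<close>

lemma chart_ideal_orbit_closure:
  assumes "\<tau> \<in> \<Sigma>" "\<rho> \<in> \<Sigma>" "\<rho> \<subseteq> \<tau>"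
  shows "chart_ideal N \<Sigma> \<tau> (orbit_closure \<rho>) = {f \<in> A \<tau>. \<forall>m\<in>Poly_Mapping.keys f. \<exists>u\<in>\<rho>. m \<bullet> u \<noteq> 0}"
proof -
  have "\<forall>m\<in>Poly_Mapping.keys f. \<exists>u\<in>\<rho>. m \<bullet> u \<noteq> 0" if f: "f \<in> chart_ideal N \<Sigma> \<tau> (orbit_closure \<rho>)" for f
  proof (rule ccontr)
    assume "\<not> (\<forall>m\<in>Poly_Mapping.keys f. \<exists>u\<in>\<rho>. m \<bullet> u \<noteq> 0)"
    then have "\<exists>m\<in>Poly_Mapping.keys f. \<forall>u\<in>\<rho>. m \<bullet> u = 0"
      by blast
    then have "\<exists>w. \<forall>h\<in>{f}. eval_hom (face_hom \<rho> w) h \<noteq> 0"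
      by (intro generic_face_hom) simp_all
    then obtain w where w: "eval_hom (face_hom \<rho> w) f \<noteq> 0"
      by blast
    have "tpoint \<tau> (face_hom \<rho> w) \<in> orbit_closure \<rho>"
      using face_point_eq[OF assms] face_point_in_orbit_closure[OF assms(2)] by simp
    then have "hom_point N \<tau> (face_hom \<rho> w) f = 0"
      using f hom_point_in_points[OF monoid_hom_face_hom[OF assms(3)]] unfolding chart_ideal_def by blast
    moreover have "f \<in> A \<tau>"
      using f by (simp add: chart_ideal_def)
    ultimately show False
      using w by (simp add: hom_point_apply)
  qed
  moreover have "f \<in> chart_ideal N \<Sigma> \<tau> (orbit_closure \<rho>)"
    if f: "f \<in> A \<tau>" "\<forall>m\<in>Poly_Mapping.keys f. \<exists>u\<in>\<rho>. m \<bullet> u \<noteq> 0" for f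
    unfolding chart_ideal_def using f orbit_closure_nonvanishing_key[OF assms(1) _ _ f(1)] by blast
  ultimately show ?thesis
    by (auto simp: chart_ideal_def)
qed

lemma orbit_closure_meets_chart:
  assumes "\<tau> \<in> \<Sigma>" "orbit_closure \<rho> \<inter> chart N \<Sigma> \<tau> ` points (A \<tau>) \<noteq> {}"
  shows "\<rho> \<subseteq> \<tau>"
proof -
  obtain x where x: "x \<in> points (A \<tau>)" "chart N \<Sigma> \<tau> x \<in> orbit_closure \<rho>"
    using assms(2) by blast
  from x(1) obtain \<zeta> where \<zeta>: "monoid_hom N \<tau> \<zeta>" "x = hom_point N \<tau> \<zeta>"
    by (rule pointsE)
  then show ?thesis
    using x(2) tpoint_in_orbit_closure_iff[OF assms(1) \<zeta>(1)] orbit_cone_subset[of \<tau> \<zeta>] by auto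
qed

section \<open>Rays of the fan and the components of the boundary\<close>

definition primitive_ray :: "'a set \<Rightarrow> 'a \<Rightarrow> bool" where
  "primitive_ray \<rho> u \<longleftrightarrow> \<rho> \<in> \<Sigma> \<and> u \<noteq> 0 \<and> \<rho> = convex_cone hull {u} \<and>
    (\<forall>m\<in>dual_lattice N. m \<bullet> u \<in> \<int>) \<and> (\<exists>e\<in>dual_lattice N. e \<bullet> u = 1)"

lemma primitive_ray_in_fan: "primitive_ray \<rho> u \<Longrightarrow> \<rho> \<in> \<Sigma>"
  unfolding primitive_ray_def by blast

lemma primitive_ray_in: "primitive_ray \<rho> u \<Longrightarrow> u \<in> \<rho>"
  by (auto simp: primitive_ray_def hull_inc)

lemma primitive_ray_perp:
  assumes "primitive_ray \<rho> u"
  shows "(\<forall>x\<in>\<rho>. m \<bullet> x = 0) \<longleftrightarrow> m \<bullet> u = 0"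
proof
  assume "m \<bullet> u = 0"
  then show "\<forall>x\<in>\<rho>. m \<bullet> x = 0"
    using assms by (auto simp: primitive_ray_def convex_cone_hull_singleton)
qed (use primitive_ray_in[OF assms] in blast)

lemma cone_rays:
  assumes \<tau>: "\<tau> \<in> \<Sigma>"
  obtains R where "\<tau> = convex_cone hull R" "\<And>r. r \<in> R \<Longrightarrow> \<exists>\<rho> u. primitive_ray \<rho> u \<and> \<rho> \<subseteq> \<tau> \<and> r \<in> \<rho>"
proof -
  obtain G where G: "finite G" "G \<subseteq> N" "\<tau> = convex_cone hull G"
    "convex_cone hull G \<inter> uminus ` (convex_cone hull G) = {0}"
    using cone_generators[OF \<tau>] by blast
  obtain R where R: "R \<subseteq> G" "convex_cone hull R = \<tau>"
    "\<And>r. r \<in> R \<Longrightarrow> r \<noteq> 0 \<and> convex_cone hull {r} face_of \<tau>"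
    using cone_generated_by_rays[OF G(1,4)] G(3) by auto
  have "\<exists>\<rho> u. primitive_ray \<rho> u \<and> \<rho> \<subseteq> \<tau> \<and> r \<in> \<rho>" if r: "r \<in> R" for r
  proof -
    have "r \<in> N" "r \<noteq> 0"
      using R(1,3) G(2) r by auto
    then obtain u where u: "u \<noteq> 0" "convex_cone hull {u} = convex_cone hull {r}"
      "\<forall>m\<in>dual_lattice N. m \<bullet> u \<in> \<int>" "\<exists>e\<in>dual_lattice N. e \<bullet> u = 1"
      using primitive_vector_exists[OF lattice] by blast
    have face: "convex_cone hull {r} face_of \<tau>"
      using R(3)[OF r] by blast
    then have "convex_cone hull {r} \<in> \<Sigma>"
      by (rule face_in_fan[OF \<tau>]) (rule convex_cone_hull_nonempty)
    then have "primitive_ray (convex_cone hull {r}) u"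
      unfolding primitive_ray_def using u by blast
    moreover have "r \<in> convex_cone hull {r}"
      by (simp add: hull_inc)
    ultimately show ?thesis
      using face_of_imp_subset[OF face] by blast
  qed
  then show thesis
    using that R(2) by blast
qed

lemma ray_outside_cone:
  assumes "\<tau> \<in> \<Sigma>" "\<sigma> \<in> \<Sigma>" "\<not> \<tau> \<subseteq> \<sigma>"
  obtains \<rho> u where "primitive_ray \<rho> u" "\<rho> \<subseteq> \<tau>" "\<not> \<rho> \<subseteq> \<sigma>"
proof -
  obtain R where R: "\<tau> = convex_cone hull R" "\<And>r. r \<in> R \<Longrightarrow> \<exists>\<rho> u. primitive_ray \<rho> u \<and> \<rho> \<subseteq> \<tau> \<and> r \<in> \<rho>"
    using cone_rays[OF assms(1)] by blast
  have "\<not> R \<subseteq> \<sigma>"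
    using hull_minimal[of R \<sigma> convex_cone] cone_convex_cone[OF assms(2)] R(1) assms(3) by blast
  then show thesis
    using R(2) that by blast
qed

lemma nonneg_on_rays_imp_nonneg:
  assumes "\<tau> \<in> \<Sigma>" "\<And>\<rho> u. primitive_ray \<rho> u \<Longrightarrow> \<rho> \<subseteq> \<tau> \<Longrightarrow> 0 \<le> m \<bullet> u" "x \<in> \<tau>"
  shows "0 \<le> m \<bullet> x"
proof -
  obtain R where R: "\<tau> = convex_cone hull R" "\<And>r. r \<in> R \<Longrightarrow> \<exists>\<rho> u. primitive_ray \<rho> u \<and> \<rho> \<subseteq> \<tau> \<and> r \<in> \<rho>"
    using cone_rays[OF assms(1)] by blast
  have "0 \<le> m \<bullet> r" if r: "r \<in> R" for r
  proof -
    obtain \<rho> u where \<rho>: "primitive_ray \<rho> u" "\<rho> \<subseteq> \<tau>" "r \<in> \<rho>"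
      using R(2)[OF r] by blast
    then obtain t where "0 \<le> t" "r = t *\<^sub>R u"
      by (auto simp: primitive_ray_def convex_cone_hull_singleton)
    then show ?thesis
      using assms(2)[OF \<rho>(1,2)] by simp
  qed
  then show ?thesis
    using convex_cone_hull_nonneg[of R m x] R(1) assms(3) by blast
qed

lemma primitive_ray_subset_eq:
  assumes "primitive_ray \<rho> u" "primitive_ray \<rho>' u'" "\<rho>' \<subseteq> \<rho>"
  shows "\<rho>' = \<rho>"
proof -
  obtain t where t: "0 \<le> t" "u' = t *\<^sub>R u"
    using primitive_ray_in[OF assms(2)] assms(1,3) by (auto simp: primitive_ray_def convex_cone_hull_singleton)
  then have "t > 0"
    using assms(2) by (cases "t = 0") (auto simp: primitive_ray_def)
  have "u \<in> convex_cone hull {u'}"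
    unfolding convex_cone_hull_singleton using t \<open>t > 0\<close>
    by (auto intro!: exI[of _ "inverse t"])
  then have "convex_cone hull {u} \<subseteq> convex_cone hull {u'}"
    by (intro hull_minimal) (auto simp: convex_cone_convex_cone_hull)
  then show ?thesis
    using assms by (auto simp: primitive_ray_def)
qed

text \<open>A point lies outside the chart of \<open>\<sigma>\<close> if and only if its orbit cone
  is not contained in \<open>\<sigma>\<close>. As the cone is generated by its rays, one of them is
  then not contained in \<open>\<sigma>\<close> either. So the complement of the chart is a finite
  union of irreducible closed sets.\<close>

lemma boundary_components_eq:
  assumes \<sigma>: "\<sigma> \<in> \<Sigma>"
  shows "boundary_components N \<sigma> \<Sigma> = {orbit_closure \<rho> | \<rho> u. primitive_ray \<rho> u \<and> \<not> \<rho> \<subseteq> \<sigma>}"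
    (is "_ = ?C")
proof -
  have "toric_variety N \<Sigma> - chart N \<Sigma> \<sigma> ` points (A \<sigma>) = \<Union>?C"
  proof (intro subset_antisym subsetI)
    fix p assume p: "p \<in> toric_variety N \<Sigma> - chart N \<Sigma> \<sigma> ` points (A \<sigma>)"
    then obtain \<tau> \<zeta> where \<zeta>: "\<tau> \<in> \<Sigma>" "monoid_hom N \<tau> \<zeta>" "p = tpoint \<tau> \<zeta>"
      by (auto simp: toric_variety_eq)
    have "\<not> orbit_cone N \<tau> \<zeta> \<subseteq> \<sigma>"
      using p tpoint_in_chart_iff[OF \<zeta>(1) \<sigma> \<zeta>(2)] \<zeta>(3) by blast
    then obtain \<rho> u where "primitive_ray \<rho> u" "\<rho> \<subseteq> orbit_cone N \<tau> \<zeta>" "\<not> \<rho> \<subseteq> \<sigma>"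
      using ray_outside_cone[OF orbit_cone_in_fan[OF \<zeta>(1,2)] \<sigma>] by blast
    moreover from this have "p \<in> orbit_closure \<rho>"
      using tpoint_in_orbit_closure_iff[OF \<zeta>(1,2)] \<zeta>(3) by simp
    ultimately show "p \<in> \<Union>?C"
      by blast
  next
    fix p assume "p \<in> \<Union>?C"
    then obtain \<rho> \<tau> \<zeta> where p: "\<not> \<rho> \<subseteq> \<sigma>" "\<tau> \<in> \<Sigma>" "monoid_hom N \<tau> \<zeta>" "p = tpoint \<tau> \<zeta>" "\<rho> \<subseteq> orbit_cone N \<tau> \<zeta>"
      unfolding orbit_closure_def by blast
    then have "p \<notin> chart N \<Sigma> \<sigma> ` points (A \<sigma>)"
      using tpoint_in_chart_iff[OF p(2) \<sigma> p(3)] by auto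
    then show "p \<in> toric_variety N \<Sigma> - chart N \<Sigma> \<sigma> ` points (A \<sigma>)"
      using p unfolding toric_variety_eq by blast
  qed
  moreover have "irreducible_components (toric_zariski N \<Sigma>) (\<Union>?C) = ?C"
  proof (rule irreducible_components_finite_Union)
    have "finite \<Sigma>"
      using fan by (simp add: is_fan_def)
    then show "finite ?C"
      by (rule finite_surj[of _ _ orbit_closure]) (use primitive_ray_in_fan in blast)
    show "closedin (toric_zariski N \<Sigma>) C \<and> irreducible_in (toric_zariski N \<Sigma>) C" if "C \<in> ?C" for C
      using that closedin_orbit_closure irreducible_orbit_closure[OF primitive_ray_in_fan] by blast
    fix C C' assume "C \<in> ?C" "C' \<in> ?C" "C \<subseteq> C'"
    then obtain \<rho> u \<rho>' u' where *: "C = orbit_closure \<rho>" "primitive_ray \<rho> u" "C' = orbit_closure \<rho>'" "primitive_ray \<rho>' u'"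
      by blast
    have "\<rho> \<in> \<Sigma>"
      using *(2) by (rule primitive_ray_in_fan)
    \<comment> \<open>The orbit cone of the distinguished point of \<open>\<rho>\<close> is
      contained in \<open>\<rho>\<close>, so an inclusion of orbit closures gives an inclusion of
      rays, hence equality.\<close>
    then have "tpoint \<rho> (face_hom \<rho> 0) \<in> orbit_closure \<rho>'"
      using face_point_in_orbit_closure[of \<rho> 0] *(1,3) \<open>C \<subseteq> C'\<close> by blast
    then have "\<rho>' \<subseteq> orbit_cone N \<rho> (face_hom \<rho> 0)"
      using tpoint_in_orbit_closure_iff[OF \<open>\<rho> \<in> \<Sigma>\<close> monoid_hom_face_hom[OF subset_refl]] by blast
    then have "\<rho>' = \<rho>"
      using orbit_cone_subset[of \<rho> "face_hom \<rho> 0"] primitive_ray_subset_eq[OF *(2,4)] by blast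
    then show "C = C'"
      using * by simp
  qed
  ultimately show ?thesis
    unfolding boundary_components_def by simp
qed

end

section \<open>Orders along boundary divisors\<close>

text \<open>The monomial valuation given by \<open>u\<close>. For \<open>f = 0\<close> the minimum
  is taken over the empty set and has no meaning.\<close>

definition order_min :: "'a::euclidean_space \<Rightarrow> ('a \<Rightarrow>\<^sub>0 real) \<Rightarrow> real" where
  "order_min u f = Min ((\<lambda>m. m \<bullet> u) ` Poly_Mapping.keys f)"

lemma order_min_le: "m \<in> Poly_Mapping.keys f \<Longrightarrow> order_min u f \<le> m \<bullet> u"
  by (simp add: order_min_def)

lemma order_min_attained:
  assumes "f \<noteq> 0"
  obtains m where "m \<in> Poly_Mapping.keys f" "m \<bullet> u = order_min u f"
proof -
  have "order_min u f \<in> (\<lambda>m. m \<bullet> u) ` Poly_Mapping.keys f"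
    unfolding order_min_def using assms by (intro Min_in) auto
  then show thesis
    using that by auto
qed

lemma le_order_min_iff: "f \<noteq> 0 \<Longrightarrow> c \<le> order_min u f \<longleftrightarrow> (\<forall>m\<in>Poly_Mapping.keys f. c \<le> m \<bullet> u)"
  by (simp add: order_min_def)

lemma keys_mult_obtain:
  fixes f g :: "'a::comm_monoid_add \<Rightarrow>\<^sub>0 'b::semiring_0"
  assumes "k \<in> Poly_Mapping.keys (f * g)"
  obtains m m' where "m \<in> Poly_Mapping.keys f" "m' \<in> Poly_Mapping.keys g" "k = m + m'"
  using assms Poly_Mapping.keys_mult[of f g] by blast

lemma order_min_vertex:
  fixes f :: "'a::euclidean_space \<Rightarrow>\<^sub>0 real"
  assumes "f \<noteq> 0"
    and w: "\<And>m m'. m \<in> Poly_Mapping.keys f \<Longrightarrow> m' \<in> Poly_Mapping.keys f \<Longrightarrow> m \<noteq> m' \<Longrightarrow> m \<bullet> w \<noteq> m' \<bullet> w"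
  obtains m0 where "m0 \<in> Poly_Mapping.keys f" "m0 \<bullet> u = order_min u f"
    "\<And>m. m \<in> Poly_Mapping.keys f \<Longrightarrow> m \<bullet> u = order_min u f \<Longrightarrow> m \<noteq> m0 \<Longrightarrow> m0 \<bullet> w < m \<bullet> w"
proof -
  let ?K = "{m \<in> Poly_Mapping.keys f. m \<bullet> u = order_min u f}"
  have "?K \<noteq> {}" "finite ?K"
    using order_min_attained[OF assms(1), of u] by auto
  then have "Min ((\<lambda>m. m \<bullet> w) ` ?K) \<in> (\<lambda>m. m \<bullet> w) ` ?K"
    by (intro Min_in) auto
  then obtain m0 where m0: "m0 \<in> ?K" "Min ((\<lambda>m. m \<bullet> w) ` ?K) = m0 \<bullet> w"
    by blast
  have "m0 \<bullet> w < m \<bullet> w" if "m \<in> ?K" "m \<noteq> m0" for m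
  proof -
    have "m0 \<bullet> w \<le> m \<bullet> w"
      unfolding m0(2)[symmetric] using that(1) \<open>finite ?K\<close> by (intro Min_le) auto
    moreover have "m0 \<bullet> w \<noteq> m \<bullet> w"
      using w[of m0 m] m0(1) that by auto
    ultimately show ?thesis
      by simp
  qed
  then show thesis
    using that[of m0] m0(1) by blast
qed

text \<open>
  Choosing among the exponents of minimal order those that minimise a generic linear form singles
  out one exponent of each factor, so that no cancellation occurs at their sum.
\<close>

lemma order_min_mult:
  fixes f g :: "'a::euclidean_space \<Rightarrow>\<^sub>0 real"
  assumes f: "f \<noteq> 0" and g: "g \<noteq> 0"
  shows "f * g \<noteq> 0" "order_min u (f * g) = order_min u f + order_min u g"
proof -
  obtain w where w: "\<forall>m\<in>Poly_Mapping.keys f \<union> Poly_Mapping.keys g.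
      \<forall>m'\<in>Poly_Mapping.keys f \<union> Poly_Mapping.keys g. m \<noteq> m' \<longrightarrow> m \<bullet> w \<noteq> m' \<bullet> w"
    using finite_distinct_inner_exists[of "Poly_Mapping.keys f \<union> Poly_Mapping.keys g"] by auto
  obtain a where a: "a \<in> Poly_Mapping.keys f" "a \<bullet> u = order_min u f"
    "\<And>m. m \<in> Poly_Mapping.keys f \<Longrightarrow> m \<bullet> u = order_min u f \<Longrightarrow> m \<noteq> a \<Longrightarrow> a \<bullet> w < m \<bullet> w"
    using order_min_vertex[OF f, of w u] w by blast
  obtain b where b: "b \<in> Poly_Mapping.keys g" "b \<bullet> u = order_min u g"
    "\<And>m. m \<in> Poly_Mapping.keys g \<Longrightarrow> m \<bullet> u = order_min u g \<Longrightarrow> m \<noteq> b \<Longrightarrow> b \<bullet> w < m \<bullet> w"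
    using order_min_vertex[OF g, of w u] w by blast
  have unique: "m = a \<and> m' = b"
    if m: "m \<in> Poly_Mapping.keys f" "m' \<in> Poly_Mapping.keys g" and eq: "m + m' = a + b" for m m'
  proof -
    have "m \<bullet> u + m' \<bullet> u = a \<bullet> u + b \<bullet> u" "m \<bullet> w + m' \<bullet> w = a \<bullet> w + b \<bullet> w"
      using eq by (metis inner_add_left)+
    \<comment> \<open>Both summands are bounded below by their minima, so equal sums force both to
      be minimal for \<open>u\<close>. Then \<open>m \<noteq> a\<close> and
      \<open>m' \<noteq> b\<close> together would make the sum of the values at \<open>w\<close> too
      large.\<close>
    moreover from this have mu: "m \<bullet> u = order_min u f" "m' \<bullet> u = order_min u g"
      using order_min_le[OF m(1), of u] order_min_le[OF m(2), of u] a(2) b(2) by linarith+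
    ultimately have "m = a \<or> m' = b"
      using a(3)[OF m(1) mu(1)] b(3)[OF m(2) mu(2)] by fastforce
    then show ?thesis
      using eq by auto
  qed
  have "Poly_Mapping.lookup (f * g) (a + b) = (\<Sum>m\<in>Poly_Mapping.keys f. \<Sum>m'\<in>Poly_Mapping.keys g.
      if m = a then (if m' = b then Poly_Mapping.lookup f a * Poly_Mapping.lookup g b else 0) else 0)"
    unfolding poly_mapping_mult_expansion lookup_sum
  proof (intro sum.cong refl)
    fix m m' assume m: "m \<in> Poly_Mapping.keys f" "m' \<in> Poly_Mapping.keys g"
    show "Poly_Mapping.lookup (Poly_Mapping.single (m + m') (Poly_Mapping.lookup f m * Poly_Mapping.lookup g m')) (a + b) =
        (if m = a then (if m' = b then Poly_Mapping.lookup f a * Poly_Mapping.lookup g b else 0) else 0)"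
      using unique[OF m] by (auto simp: lookup_single when_def)
  qed
  also have "\<dots> = (\<Sum>m\<in>Poly_Mapping.keys f. if m = a then Poly_Mapping.lookup f a * Poly_Mapping.lookup g b else 0)"
    using b(1) by (intro sum.cong) simp_all
  also have "\<dots> = Poly_Mapping.lookup f a * Poly_Mapping.lookup g b"
    using a(1) by simp
  finally have "Poly_Mapping.lookup (f * g) (a + b) \<noteq> 0"
    using a(1) b(1) by (simp add: in_keys_iff)
  then have ab: "a + b \<in> Poly_Mapping.keys (f * g)"
    by (simp add: in_keys_iff)
  then show "f * g \<noteq> 0"
    by auto
  have "order_min u f + order_min u g \<le> order_min u (f * g)"
  proof -
    have "order_min u f + order_min u g \<le> k \<bullet> u" if "k \<in> Poly_Mapping.keys (f * g)" for k
      using that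
      by (rule keys_mult_obtain) (simp add: inner_add_left add_mono order_min_le)
    then show ?thesis
      by (simp add: le_order_min_iff[OF \<open>f * g \<noteq> 0\<close>])
  qed
  then show "order_min u (f * g) = order_min u f + order_min u g"
    using order_min_le[OF ab, of u] a(2) b(2) by (simp add: inner_add_left)
qed

lemma keys_sum_obtain:
  assumes "m \<in> Poly_Mapping.keys (sum f I)"
  obtains i where "i \<in> I" "m \<in> Poly_Mapping.keys (f i)"
proof -
  have "(\<Sum>i\<in>I. Poly_Mapping.lookup (f i) m) \<noteq> 0"
    using assms by (simp add: in_keys_iff lookup_sum)
  then obtain i where "i \<in> I" "Poly_Mapping.lookup (f i) m \<noteq> 0"
    by (metis sum.neutral)
  then show thesis
    using that by (simp add: in_keys_iff)
qed

lemma keys_char_fun_mult: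
  fixes f :: "'a::comm_monoid_add \<Rightarrow>\<^sub>0 real"
  assumes "k \<in> Poly_Mapping.keys (char_fun m * f)"
  obtains m' where "m' \<in> Poly_Mapping.keys f" "k = m + m'"
proof -
  obtain m1 m' where "m1 \<in> Poly_Mapping.keys (char_fun m :: 'a \<Rightarrow>\<^sub>0 real)" "m' \<in> Poly_Mapping.keys f" "k = m1 + m'"
    using keys_mult_obtain[OF assms] by blast
  then show thesis
    using that by simp
qed

text \<open>Exponents add under multiplication, and each of the \<open>k\<close> factors from
  \<open>p\<close> contributes at least 1.\<close>

lemma ideal_power_order:
  assumes "\<And>f m. f \<in> p \<Longrightarrow> m \<in> Poly_Mapping.keys f \<Longrightarrow> 1 \<le> m \<bullet> u"
    and "\<And>f m. f \<in> A \<Longrightarrow> m \<in> Poly_Mapping.keys f \<Longrightarrow> 0 \<le> m \<bullet> u"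
    and "h \<in> ideal_power A p k" "m \<in> Poly_Mapping.keys h"
  shows "of_nat k \<le> m \<bullet> u"
  using assms(3,4)
proof (induction k arbitrary: h m)
  case 0
  then show ?case
    using assms(2) by simp
next
  case (Suc k)
  obtain r :: nat and g h' where h: "h = (\<Sum>i<r. g i * h' i)" "\<forall>i<r. g i \<in> p \<and> h' i \<in> ideal_power A p k"
    using Suc.prems(1) by auto
  obtain i where i: "i < r" "m \<in> Poly_Mapping.keys (g i * h' i)"
    using keys_sum_obtain[of m "\<lambda>i. g i * h' i" "{..<r}"] Suc.prems(2) h(1) by auto
  obtain m1 m2 where m: "m1 \<in> Poly_Mapping.keys (g i)" "m2 \<in> Poly_Mapping.keys (h' i)" "m = m1 + m2"
    using keys_mult_obtain[OF i(2)] by blast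
  have "1 \<le> m1 \<bullet> u"
    using assms(1) h(2) i(1) m(1) by blast
  moreover have "of_nat k \<le> m2 \<bullet> u"
    using Suc.IH h(2) i(1) m(2) by blast
  ultimately show ?case
    by (simp add: m(3) inner_add_left)
qed

lemma char_fun_mult_ideal_power:
  fixes A p :: "('a::euclidean_space \<Rightarrow>\<^sub>0 real) set"
  assumes "char_fun e \<in> p" "c \<in> A"
  shows "char_fun (of_nat k *\<^sub>R e) * c \<in> ideal_power A p k"
proof (induction k)
  case 0
  have "char_fun 0 * c = c"
    by simp
  then show ?case
    using assms(2) by simp
next
  case (Suc k)
  have "char_fun (of_nat (Suc k) *\<^sub>R e) = char_fun e * char_fun (of_nat k *\<^sub>R e)"
    by (simp add: mult_single scaleR_left_distrib)
  then have "char_fun (of_nat (Suc k) *\<^sub>R e) * c = (\<Sum>i<Suc 0. char_fun e * (char_fun (of_nat k *\<^sub>R e) * c))"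
    by (simp add: mult.assoc)
  then show ?case
    unfolding ideal_power.simps mem_Collect_eq using Suc assms(1)
    by - (rule exI[of _ "Suc 0"], rule exI[of _ "\<lambda>_. char_fun e"],
      rule exI[of _ "\<lambda>_. char_fun (of_nat k *\<^sub>R e) * c"], simp)
qed

context toric_fan
begin

lemma primitive_ray_Ints: "primitive_ray \<rho> u \<Longrightarrow> m \<in> dual_lattice N \<Longrightarrow> m \<bullet> u \<in> \<int>"
  unfolding primitive_ray_def by blast

lemma primitive_ray_character_monoid:
  assumes "primitive_ray \<rho> u"
  shows "m \<in> Q \<rho> \<longleftrightarrow> m \<in> dual_lattice N \<and> 0 \<le> m \<bullet> u"
proof -
  have "0 \<le> m \<bullet> x" if "0 \<le> m \<bullet> u" "x \<in> \<rho>" for x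
    using that assms by (auto simp: primitive_ray_def convex_cone_hull_singleton)
  then show ?thesis
    using primitive_ray_in[OF assms] by (auto simp: character_monoid_def)
qed

text \<open>Upper bound: a multiplier \<open>s\<close> outside the ideal has an exponent with value
  0 at \<open>u\<close>, so the order of \<open>s * a\<close> is at most that of \<open>a\<close>,
  while elements of the \<open>y\<close>-th ideal power have order at least \<open>y\<close>. Lower
  bound: \<open>char_fun e\<close> with \<open>e \<bullet> u = 1\<close> is a uniformizer, and
  \<open>char_fun m0\<close> is a unit at the generic point of the divisor.\<close>

lemma local_order_orbit_closure:
  assumes \<tau>: "\<tau> \<in> \<Sigma>" and ray: "primitive_ray \<rho> u" and sub: "\<rho> \<subseteq> \<tau>" and a: "a \<in> A \<tau>" "a \<noteq> 0"
  shows "of_nat (local_order (A \<tau>) (chart_ideal N \<Sigma> \<tau> (orbit_closure \<rho>)) a) = order_min u a"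
proof -
  let ?p = "chart_ideal N \<Sigma> \<tau> (orbit_closure \<rho>)"
  have \<rho>: "\<rho> \<in> \<Sigma>"
    using ray by (rule primitive_ray_in_fan)
  have p: "?p = {f \<in> A \<tau>. \<forall>m\<in>Poly_Mapping.keys f. m \<bullet> u \<noteq> 0}"
    unfolding chart_ideal_orbit_closure[OF \<tau> \<rho> sub] using primitive_ray_perp[OF ray] by blast
  have nonneg: "0 \<le> m \<bullet> u" if "f \<in> A \<tau>" "m \<in> Poly_Mapping.keys f" for f m
    using that primitive_ray_in[OF ray] sub by (auto simp: coordinate_ring_eq character_monoid_def)
  have int: "m \<bullet> u \<in> \<int>" if "f \<in> A \<tau>" "m \<in> Poly_Mapping.keys f" for f m
    using that primitive_ray_Ints[OF ray] by (auto simp: coordinate_ring_eq character_monoid_def)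
  have ge1: "1 \<le> m \<bullet> u" if f: "f \<in> ?p" "m \<in> Poly_Mapping.keys f" for f m
  proof -
    have "f \<in> A \<tau>" "m \<bullet> u \<noteq> 0"
      using f p by auto
    then show ?thesis
      using nonneg[OF _ f(2)] int[OF _ f(2)] by (auto elim!: Ints_cases)
  qed
  obtain ma where ma: "ma \<in> Poly_Mapping.keys a" "ma \<bullet> u = order_min u a"
    using order_min_attained[OF a(2)] by blast
  obtain K :: nat where K: "order_min u a = of_nat K"
  proof -
    obtain k where k: "ma \<bullet> u = of_int k"
      using int[OF a(1) ma(1)] by (elim Ints_cases)
    then have "0 \<le> k"
      using nonneg[OF a(1) ma(1)] by simp
    then show thesis
      using that[of "nat k"] k ma(2) by simp
  qed
  obtain m0 where m0: "m0 \<in> Q \<tau>" "\<rho> = {x \<in> \<tau>. m0 \<bullet> x = 0}"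
    using subcone_cut[OF \<tau> \<rho> sub] by blast
  have m0u: "m0 \<bullet> u = 0"
    using m0(2) primitive_ray_in[OF ray] by blast
  have bound: "y \<le> K" if y: "\<exists>s\<in>A \<tau> - ?p. s * a \<in> ideal_power (A \<tau>) ?p y" for y
  proof -
    obtain s where s: "s \<in> A \<tau>" "s \<notin> ?p" "s * a \<in> ideal_power (A \<tau>) ?p y"
      using y by blast
    then obtain ms where ms: "ms \<in> Poly_Mapping.keys s" "ms \<bullet> u = 0"
      using p by auto
    then have "s \<noteq> 0" "order_min u s \<le> 0"
      using order_min_le[OF ms(1), of u] by auto
    moreover have "of_nat y \<le> order_min u (s * a)"
      unfolding le_order_min_iff[OF order_min_mult(1)[OF \<open>s \<noteq> 0\<close> a(2)]]
      by (intro ballI, rule ideal_power_order[where p = ?p and A = "A \<tau>"])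
        (rule ge1 nonneg s(3) | assumption)+
    ultimately have "real y \<le> of_nat K"
      using order_min_mult(2)[OF \<open>s \<noteq> 0\<close> a(2), of u] K by simp
    then show ?thesis
      by simp
  qed
  have "\<exists>s\<in>A \<tau> - ?p. s * a \<in> ideal_power (A \<tau>) ?p K"
  proof -
    obtain e' where e': "e' \<in> dual_lattice N" "e' \<bullet> u = 1"
      using ray unfolding primitive_ray_def by blast
    have "e' \<in> Q \<rho>"
      using e' primitive_ray_character_monoid[OF ray] by simp
    \<comment> \<open>The character \<open>e'\<close> is known to be nonnegative only on the ray;
      multiples of \<open>m0\<close> make it so on \<open>\<tau>\<close> and do not change its value
      at \<open>u\<close>.\<close>
    then obtain L' where L': "e' + of_nat L' *\<^sub>R m0 \<in> Q \<tau>"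
      using localization[OF \<tau> m0] by blast
    define e where "e = e' + of_nat L' *\<^sub>R m0"
    have e: "e \<in> Q \<tau>" "e \<bullet> u = 1"
      using L' e'(2) m0u by (simp_all add: e_def inner_add_left)
    have keys: "m \<in> dual_lattice N" "of_nat K \<le> m \<bullet> u" if "m \<in> Poly_Mapping.keys a" for m
      using that a(1) order_min_le[OF that, of u] K by (auto simp: coordinate_ring_eq character_monoid_def)
    \<comment> \<open>The quotient of \<open>a\<close> by the \<open>K\<close>-th power of the
      uniformizer is regular on the chart of the ray, because \<open>a\<close> has order
      \<open>K\<close>. A power of \<open>char_fun m0\<close>, the later \<open>s\<close>, clears
      its denominators on the chart of \<open>\<tau>\<close>.\<close>
    have "(\<lambda>m. m - of_nat K *\<^sub>R e) ` Poly_Mapping.keys a \<subseteq> Q \<rho>"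
    proof clarify
      fix m assume m: "m \<in> Poly_Mapping.keys a"
      have "e \<in> dual_lattice N"
        using e(1) by (simp add: character_monoid_def)
      then show "m - of_nat K *\<^sub>R e \<in> Q \<rho>"
        unfolding primitive_ray_character_monoid[OF ray] using keys[OF m] e(2)
        by (auto simp: inner_diff_left
            intro!: additive_subgroup_diff additive_subgroup_scale_nat additive_subgroup_dual_lattice)
    qed
    then obtain L where L: "\<forall>m\<in>(\<lambda>m. m - of_nat K *\<^sub>R e) ` Poly_Mapping.keys a. m + of_nat L *\<^sub>R m0 \<in> Q \<tau>"
      using localization_finite[OF \<tau> m0, of "(\<lambda>m. m - of_nat K *\<^sub>R e) ` Poly_Mapping.keys a"] by auto
    define s where "s = (char_fun (of_nat L *\<^sub>R m0) :: 'a \<Rightarrow>\<^sub>0 real)"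
    define c where "c = char_fun (of_nat L *\<^sub>R m0 - of_nat K *\<^sub>R e) * a"
    have "c \<in> A \<tau>"
      unfolding coordinate_ring_eq
    proof (intro CollectI subsetI)
      fix k assume "k \<in> Poly_Mapping.keys c"
      then obtain m where m: "m \<in> Poly_Mapping.keys a" "k = of_nat L *\<^sub>R m0 - of_nat K *\<^sub>R e + m"
        unfolding c_def using keys_char_fun_mult by blast
      then have "k = m - of_nat K *\<^sub>R e + of_nat L *\<^sub>R m0"
        by simp
      then show "k \<in> Q \<tau>"
        using L m(1) by simp
    qed
    moreover have "char_fun e \<in> ?p"
      using e by (simp add: p coordinate_ring_single)
    ultimately have "char_fun (of_nat K *\<^sub>R e) * c \<in> ideal_power (A \<tau>) ?p K"
      by (intro char_fun_mult_ideal_power)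
    moreover have "char_fun (of_nat K *\<^sub>R e) * c = s * a"
      by (simp add: c_def s_def mult_single flip: mult.assoc)
    moreover have "s \<in> A \<tau>"
      unfolding s_def by (intro coordinate_ring_single character_monoid_scale m0(1))
    moreover have "s \<notin> ?p"
      using m0u by (simp add: p s_def)
    ultimately show ?thesis
      by auto
  qed
  then have "local_order (A \<tau>) ?p a = K"
    unfolding local_order_def using bound by (intro Greatest_equality) blast+
  then show ?thesis
    using K by simp
qed

text \<open>The description by \<open>THE\<close> is unambiguous since \<open>order_min\<close> is
  additive on products: the difference for \<open>b * f = a\<close> is the order of
  \<open>f\<close>, whatever the chart and the fraction. A fraction exists in the chart of
  \<open>\<rho>\<close> itself, with a power of the uniformizer as denominator that is large enough
  to cancel the pole.\<close>

lemma order_along_orbit_closure: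
  assumes ray: "primitive_ray \<rho> u" and f: "f \<noteq> 0" "Poly_Mapping.keys f \<subseteq> dual_lattice N"
  shows "of_int (order_along N \<Sigma> (orbit_closure \<rho>) f) = order_min u f"
proof -
  let ?Z = "orbit_closure \<rho>"
  define P where "P = (\<lambda>d. \<exists>\<tau>\<in>\<Sigma>. \<exists>a\<in>A \<tau>. \<exists>b\<in>A \<tau>.
     ?Z \<inter> chart N \<Sigma> \<tau> ` points (A \<tau>) \<noteq> {} \<and> b \<noteq> 0 \<and> b * f = a \<and>
     d = int (local_order (A \<tau>) (chart_ideal N \<Sigma> \<tau> ?Z) a) - int (local_order (A \<tau>) (chart_ideal N \<Sigma> \<tau> ?Z) b))"
  have \<rho>: "\<rho> \<in> \<Sigma>"
    using ray by (rule primitive_ray_in_fan)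
  have unique: "of_int d = order_min u f" if d: "P d" for d
  proof -
    obtain \<tau> a b where *: "\<tau> \<in> \<Sigma>" "a \<in> A \<tau>" "b \<in> A \<tau>" "?Z \<inter> chart N \<Sigma> \<tau> ` points (A \<tau>) \<noteq> {}" "b \<noteq> 0" "b * f = a"
      "d = int (local_order (A \<tau>) (chart_ideal N \<Sigma> \<tau> ?Z) a) - int (local_order (A \<tau>) (chart_ideal N \<Sigma> \<tau> ?Z) b)"
      using d unfolding P_def by blast
    have sub: "\<rho> \<subseteq> \<tau>"
      by (rule orbit_closure_meets_chart[OF *(1,4)])
    have "a \<noteq> 0" "order_min u a = order_min u b + order_min u f"
      using order_min_mult[OF *(5) f(1)] *(6) by auto
    then show ?thesis
      using local_order_orbit_closure[OF *(1) ray sub *(2)] local_order_orbit_closure[OF *(1) ray sub *(3,5)] *(7)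
      by simp
  qed
  have "\<exists>d. P d"
  proof -
    obtain e where e: "e \<in> dual_lattice N" "e \<bullet> u = 1"
      using ray unfolding primitive_ray_def by blast
    obtain k :: nat where k: "- order_min u f \<le> of_nat k"
      using real_arch_simple by blast
    let ?b = "char_fun (of_nat k *\<^sub>R e)"
    have "?b \<in> A \<rho>"
      using e by (intro coordinate_ring_single)
        (auto simp: primitive_ray_character_monoid[OF ray] intro!: additive_subgroup_scale_nat additive_subgroup_dual_lattice)
    moreover have "?b * f \<in> A \<rho>"
      unfolding coordinate_ring_eq
    proof (intro CollectI subsetI)
      fix j assume "j \<in> Poly_Mapping.keys (?b * f)"
      then obtain m where m: "m \<in> Poly_Mapping.keys f" "j = of_nat k *\<^sub>R e + m"
        using keys_char_fun_mult by blast
      have "m \<in> dual_lattice N"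
        using m(1) f(2) by blast
      then show "j \<in> Q \<rho>"
        using e order_min_le[OF m(1), of u] k
        by (auto simp: primitive_ray_character_monoid[OF ray] m(2) inner_add_left
            intro!: additive_subgroup_add additive_subgroup_scale_nat additive_subgroup_dual_lattice)
    qed
    moreover have "?Z \<inter> chart N \<Sigma> \<rho> ` points (A \<rho>) \<noteq> {}"
      using face_point_in_orbit_closure[OF \<rho>, of 0] hom_point_in_points[OF monoid_hom_face_hom[OF subset_refl]]
      by blast
    moreover have "?b \<noteq> 0"
      by (simp add: single_zero flip: keys_eq_empty)
    ultimately show ?thesis
      unfolding P_def using \<rho> by blast
  qed
  then obtain d where d: "P d"
    by blast
  have "order_along N \<Sigma> ?Z f = (THE d. P d)"
    unfolding order_along_def P_def ..
  also have "\<dots> = d"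
    using d unique by (intro the_equality) (metis of_int_eq_iff)+
  finally show ?thesis
    using unique[OF d] by simp
qed

lemma order_along_ge_iff:
  assumes "primitive_ray \<rho> u" "f \<in> A \<sigma>" "f \<noteq> 0"
  shows "- int n \<le> order_along N \<Sigma> (orbit_closure \<rho>) f \<longleftrightarrow> (\<forall>m\<in>Poly_Mapping.keys f. - of_nat n \<le> m \<bullet> u)"
proof -
  have "Poly_Mapping.keys f \<subseteq> dual_lattice N"
    using assms(2) by (auto simp: coordinate_ring_eq character_monoid_def)
  then have "of_int (order_along N \<Sigma> (orbit_closure \<rho>) f) = order_min u f"
    by (rule order_along_orbit_closure[OF assms(1,3)])
  moreover have "- int n \<le> order_along N \<Sigma> (orbit_closure \<rho>) f \<longleftrightarrow>
      (of_int (- int n) :: real) \<le> of_int (order_along N \<Sigma> (orbit_closure \<rho>) f)"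
    by (simp only: of_int_le_iff)
  ultimately show ?thesis
    by (simp add: le_order_min_iff[OF assms(3)])
qed

end

section \<open>Completeness\<close>

lemma eval_hom_uminus: "eval_hom \<zeta> (- f) = - eval_hom \<zeta> f"
  using eval_hom_add[of \<zeta> f "- f"] by (simp add: add_eq_0_iff)

lemma eval_hom_diff: "eval_hom \<zeta> (f - g) = eval_hom \<zeta> f - eval_hom \<zeta> g"
  using eval_hom_add[of \<zeta> f "- g"] by (simp add: eval_hom_uminus)

lemma coordinate_ring_diff:
  "f \<in> coordinate_ring N \<tau> \<Longrightarrow> g \<in> coordinate_ring N \<tau> \<Longrightarrow> f - g \<in> coordinate_ring N \<tau>"
  using coordinate_ring_add[of f N \<tau> "- g"] by (simp add: coordinate_ring_uminus)

text \<open>The polynomial \<open>\<chi>\<^sup>m T\<^sup>i - \<chi>\<^sup>m' T\<^sup>j\<close> in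
  one variable \<open>T\<close> over the coordinate ring. Its two terms may share the power of
  \<open>T\<close> or cancel, which is why its keys are only bounded from above.\<close>

definition binomial_test :: "'a \<Rightarrow> nat \<Rightarrow> 'a \<Rightarrow> nat \<Rightarrow> (nat \<Rightarrow>\<^sub>0 nat) \<Rightarrow>\<^sub>0 ('a \<Rightarrow>\<^sub>0 real)" where
  "binomial_test m i m' j =
     Poly_Mapping.single (Poly_Mapping.single 0 i) (char_fun m) +
     Poly_Mapping.single (Poly_Mapping.single 0 j) (- char_fun m')"

lemma keys_binomial_test:
  "Poly_Mapping.keys (binomial_test m i m' j) \<subseteq> {Poly_Mapping.single 0 i, Poly_Mapping.single 0 j}"
  using Poly_Mapping.keys_add[of "Poly_Mapping.single (Poly_Mapping.single (0::nat) i) (char_fun m)"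
      "Poly_Mapping.single (Poly_Mapping.single (0::nat) j) (- char_fun m')"]
  by (auto simp: binomial_test_def split: if_splits)

lemma lookup_binomial_test:
  "Poly_Mapping.lookup (binomial_test m i m' j) \<alpha> =
    (if \<alpha> = Poly_Mapping.single 0 i then char_fun m else 0) +
    (if \<alpha> = Poly_Mapping.single 0 j then - char_fun m' else 0)"
  by (auto simp: binomial_test_def lookup_add lookup_single when_def)

lemma binomial_test_in_polynomials:
  assumes "m \<in> character_monoid N \<tau>" "m' \<in> character_monoid N \<tau>"
  shows "binomial_test m i m' j \<in> polynomials 1 (coordinate_ring N \<tau>)"
proof -
  have "Poly_Mapping.keys \<alpha> \<subseteq> {..<1}" if "\<alpha> \<in> Poly_Mapping.keys (binomial_test m i m' j)" for \<alpha>
    using that keys_binomial_test[of m i m' j] by (auto split: if_splits)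
  moreover have "Poly_Mapping.lookup (binomial_test m i m' j) \<alpha> \<in> coordinate_ring N \<tau>" for \<alpha>
    using assms by (auto simp: lookup_binomial_test
        intro!: coordinate_ring_diff coordinate_ring_uminus coordinate_ring_single coordinate_ring_0)
  ultimately show ?thesis
    unfolding polynomials_def by blast
qed

lemma eval_binomial_test:
  assumes "m \<in> character_monoid N \<tau>" "m' \<in> character_monoid N \<tau>"
  shows "eval_polynomial 1 (hom_point N \<tau> \<zeta>) (binomial_test m i m' j) t = \<zeta> m * t 0 ^ i - \<zeta> m' * t 0 ^ j"
proof -
  let ?F = "binomial_test m i m' j" and ?K = "{Poly_Mapping.single (0::nat) i, Poly_Mapping.single 0 j}"
  have coeff: "Poly_Mapping.lookup ?F \<alpha> \<in> coordinate_ring N \<tau>" for \<alpha>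
    using assms by (auto simp: lookup_binomial_test
        intro!: coordinate_ring_diff coordinate_ring_uminus coordinate_ring_single coordinate_ring_0)
  have "eval_polynomial 1 (hom_point N \<tau> \<zeta>) ?F t =
      (\<Sum>\<alpha>\<in>Poly_Mapping.keys ?F. eval_hom \<zeta> (Poly_Mapping.lookup ?F \<alpha>) * t 0 ^ Poly_Mapping.lookup \<alpha> 0)"
    unfolding eval_polynomial_def by (simp add: hom_point_apply coeff)
  also have "\<dots> = (\<Sum>\<alpha>\<in>?K. eval_hom \<zeta> (Poly_Mapping.lookup ?F \<alpha>) * t 0 ^ Poly_Mapping.lookup \<alpha> 0)"
    by (rule sum.mono_neutral_left) (use keys_binomial_test[of m i m' j] in \<open>auto simp: in_keys_iff subset_iff\<close>)
  also have "\<dots> = \<zeta> m * t 0 ^ i - \<zeta> m' * t 0 ^ j"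
  proof (cases "i = j")
    case True
    then show ?thesis
      by (simp add: lookup_binomial_test eval_hom_diff left_diff_distrib)
  next
    case False
    then have "Poly_Mapping.single (0::nat) i \<noteq> Poly_Mapping.single 0 j"
      using inj_single[of "0::nat"] by (metis injD)
    then show ?thesis
      by (simp add: lookup_binomial_test eval_hom_uminus)
  qed
  finally show ?thesis .
qed

text \<open>The point with coordinate \<open>c\<close> of the affine line, whose points are
  functions on \<open>{..<1}\<close>.\<close>

definition diagonal_point :: "complex \<Rightarrow> nat \<Rightarrow> complex" where
  "diagonal_point c = restrict (\<lambda>_. c) {..<1}"

lemma diagonal_point_in: "diagonal_point c \<in> affine_space 1"
  by (simp add: diagonal_point_def affine_space_def)

text \<open>Polynomials are continuous for the Euclidean topology. So the single point 0 is not
  Zariski open, and a Zariski closed subset of the line with all \<open>c \<noteq> 0\<close> also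
  contains 0.\<close>

lemma open_affine_line_preimage:
  assumes "openin (affine_space_zariski 1) W"
  shows "open {c. diagonal_point c \<in> W}"
proof -
  have "generate_topology_on {{t \<in> affine_space 1. eval_polynomial 1 of_real F t \<noteq> 0} | F.
      F \<in> polynomials 1 (UNIV :: real set)} W"
    using openin_topology_generated_by assms unfolding affine_space_zariski_def by blast
  then show ?thesis
  proof (induction W rule: generate_topology_on.induct)
    case Empty
    then show ?case by simp
  next
    case (Int a b)
    then show ?case
      by (simp add: Collect_conj_eq open_Int)
  next
    case (UN K)
    have "{c. diagonal_point c \<in> \<Union>K} = (\<Union>k\<in>K. {c. diagonal_point c \<in> k})"
      by auto
    then show ?case
      using UN.IH by (simp add: open_UN)
  next
    case (Basis s)
    then obtain F where s: "s = {t \<in> affine_space 1. eval_polynomial 1 of_real F t \<noteq> 0}"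
      by blast
    have "{c. diagonal_point c \<in> s} = {c. eval_polynomial 1 of_real F (diagonal_point c) \<noteq> 0}"
      unfolding s using diagonal_point_in by blast
    moreover have "eval_polynomial 1 of_real F (diagonal_point c) =
        (\<Sum>\<alpha>\<in>Poly_Mapping.keys F. of_real (Poly_Mapping.lookup F \<alpha>) * c ^ Poly_Mapping.lookup \<alpha> 0)" for c
      by (simp add: eval_polynomial_def diagonal_point_def)
    moreover have "open {c :: complex. (\<Sum>\<alpha>\<in>Poly_Mapping.keys F. of_real (Poly_Mapping.lookup F \<alpha>) *
        c ^ Poly_Mapping.lookup \<alpha> 0) \<noteq> 0}"
      by (intro open_Collect_neq continuous_intros)
    ultimately show ?case
      by simp
  qed
qed

lemma topspace_affine_line: "topspace (affine_space_zariski 1) = affine_space 1"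
proof -
  have "(1 :: (nat \<Rightarrow>\<^sub>0 nat) \<Rightarrow>\<^sub>0 real) \<in> polynomials 1 UNIV"
    by (auto simp: polynomials_def)
  moreover have "eval_polynomial 1 of_real (1 :: (nat \<Rightarrow>\<^sub>0 nat) \<Rightarrow>\<^sub>0 real) t = 1" for t
    by (simp add: eval_polynomial_def)
  ultimately have "affine_space 1 \<in> {{t \<in> affine_space 1. eval_polynomial 1 of_real F t \<noteq> 0} | F.
      F \<in> polynomials 1 (UNIV :: real set)}"
    by (intro CollectI exI[of _ "1 :: (nat \<Rightarrow>\<^sub>0 nat) \<Rightarrow>\<^sub>0 real"]) auto
  then show ?thesis
    unfolding affine_space_zariski_def topology_generated_by_topspace by blast
qed

lemma topspace_affine_product_zariski:
  "topspace (affine_product_zariski 1 (coordinate_ring N \<tau>)) = points (coordinate_ring N \<tau>) \<times> affine_space 1"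
proof -
  have F: "Poly_Mapping.single (Poly_Mapping.single 0 0) (char_fun 0) \<in> polynomials 1 (coordinate_ring N \<tau>)"
    by (auto simp: polynomials_def lookup_single when_def coordinate_ring_single character_monoid_0
        simp del: single_one split: if_splits)
  moreover have "eval_polynomial 1 x (Poly_Mapping.single (Poly_Mapping.single 0 0) (char_fun 0)) t \<noteq> 0"
    if "x \<in> points (coordinate_ring N \<tau>)" for x :: "'a point" and t
  proof -
    have "x (Poly_Mapping.single 0 1) = of_real 1"
      using that unfolding points_def by blast
    then show ?thesis
      by (simp add: eval_polynomial_def)
  qed
  ultimately have "points (coordinate_ring N \<tau>) \<times> affine_space 1 \<in>
    {{(x, t) \<in> points (coordinate_ring N \<tau>) \<times> affine_space 1. eval_polynomial 1 x F t \<noteq> 0} | F.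
      F \<in> polynomials 1 (coordinate_ring N \<tau>)}"
    by (intro CollectI exI[of _ "Poly_Mapping.single (Poly_Mapping.single 0 0) (char_fun 0)"]) auto
  then show ?thesis
    unfolding affine_product_zariski_def topology_generated_by_topspace by blast
qed

text \<open>
  The binomial equations of the closure of the graph of the one-parameter subgroup \<open>u\<close>, on which
  \<open>\<chi>\<^sup>m\<close> equals the power of the coordinate \<open>c\<close> with exponent \<open>m \<bullet> u\<close>.
\<close>

definition graph_relations :: "'a::euclidean_space set \<Rightarrow> 'a \<Rightarrow> 'a set \<Rightarrow> ('a \<Rightarrow> complex) \<Rightarrow> complex \<Rightarrow> bool" where
  "graph_relations N u \<tau> \<zeta> c \<longleftrightarrow>
    (\<forall>m\<in>character_monoid N \<tau>. \<forall>m'\<in>character_monoid N \<tau>. \<forall>i j :: nat.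
      m \<bullet> u + of_nat i = m' \<bullet> u + of_nat j \<longrightarrow> \<zeta> m * c ^ i = \<zeta> m' * c ^ j)"

lemma graph_relations_cong:
  "(\<And>m. m \<in> character_monoid N \<tau> \<Longrightarrow> \<zeta> m = \<zeta>' m) \<Longrightarrow>
    graph_relations N u \<tau> \<zeta> c \<longleftrightarrow> graph_relations N u \<tau> \<zeta>' c"
  by (simp add: graph_relations_def)

context toric_fan
begin

text \<open>Adding the same multiple of \<open>m0\<close> to both characters preserves the balance
  of exponents and multiplies both sides of the relation by the same unit.\<close>

lemma graph_relations_extension:
  assumes \<tau>: "\<tau> \<in> \<Sigma>" and \<gamma>: "\<gamma> \<in> \<Sigma>" "\<gamma> \<subseteq> \<tau>" and \<xi>: "monoid_hom N \<gamma> \<xi>"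
  shows "graph_relations N u \<tau> \<xi> c \<longleftrightarrow> graph_relations N u \<gamma> \<xi> c"
proof
  assume "graph_relations N u \<gamma> \<xi> c"
  then show "graph_relations N u \<tau> \<xi> c"
    using character_monoid_mono[OF \<gamma>(2), of N] unfolding graph_relations_def by blast
next
  assume *: "graph_relations N u \<tau> \<xi> c"
  obtain m0 where m0: "m0 \<in> Q \<tau>" "\<gamma> = {x \<in> \<tau>. m0 \<bullet> x = 0}"
    using subcone_cut[OF \<tau> \<gamma>] by blast
  have "m0 \<in> Q \<gamma>"
    using cut_subset[OF m0] by blast
  have nz: "\<xi> m0 \<noteq> 0"
    by (rule cut_unit[OF m0 \<xi>])
  show "graph_relations N u \<gamma> \<xi> c"
    unfolding graph_relations_def
  proof (intro ballI allI impI)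
    fix m m' and i j :: nat
    assume m: "m \<in> Q \<gamma>" "m' \<in> Q \<gamma>" and eq: "m \<bullet> u + of_nat i = m' \<bullet> u + of_nat j"
    obtain L where L: "m + of_nat L *\<^sub>R m0 \<in> Q \<tau>" "m' + of_nat L *\<^sub>R m0 \<in> Q \<tau>"
      using localization_finite[OF \<tau> m0, of "{m, m'}"] m by auto
    have "(m + of_nat L *\<^sub>R m0) \<bullet> u + of_nat i = (m' + of_nat L *\<^sub>R m0) \<bullet> u + of_nat j"
      using eq by (simp add: inner_add_left)
    then have "\<xi> (m + of_nat L *\<^sub>R m0) * c ^ i = \<xi> (m' + of_nat L *\<^sub>R m0) * c ^ j"
      using * L unfolding graph_relations_def by blast
    then show "\<xi> m * c ^ i = \<xi> m' * c ^ j"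
      using nz by (simp add: hom_shift[OF \<xi> _ \<open>m0 \<in> Q \<gamma>\<close>] m)
  qed
qed

lemma graph_relations_tpoint:
  assumes "\<tau> \<in> \<Sigma>" "\<tau>' \<in> \<Sigma>" "monoid_hom N \<tau> \<zeta>" "monoid_hom N \<tau>' \<zeta>'" "tpoint \<tau> \<zeta> = tpoint \<tau>' \<zeta>'"
  shows "graph_relations N u \<tau> \<zeta> c \<longleftrightarrow> graph_relations N u \<tau>' \<zeta>' c"
proof -
  have "\<exists>\<xi>. monoid_hom N (\<tau> \<inter> \<tau>') \<xi> \<and> (\<forall>m\<in>Q \<tau>. \<zeta> m = \<xi> m) \<and> (\<forall>m\<in>Q \<tau>'. \<zeta>' m = \<xi> m)"
    by (rule iffD1[OF tpoint_eq_iff[OF assms(1-4)] assms(5)])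
  then obtain \<xi> where \<xi>: "monoid_hom N (\<tau> \<inter> \<tau>') \<xi>" "\<And>m. m \<in> Q \<tau> \<Longrightarrow> \<zeta> m = \<xi> m"
    "\<And>m. m \<in> Q \<tau>' \<Longrightarrow> \<zeta>' m = \<xi> m"
    by blast
  have \<gamma>: "\<tau> \<inter> \<tau>' \<in> \<Sigma>"
    by (rule Int_in_fan[OF assms(1,2)])
  have "graph_relations N u \<tau> \<zeta> c \<longleftrightarrow> graph_relations N u \<tau> \<xi> c"
    "graph_relations N u \<tau>' \<zeta>' c \<longleftrightarrow> graph_relations N u \<tau>' \<xi> c"
    using \<xi>(2,3) by (auto intro!: graph_relations_cong)
  then show ?thesis
    using graph_relations_extension[OF assms(1) \<gamma> _ \<xi>(1)] graph_relations_extension[OF assms(2) \<gamma> _ \<xi>(1)]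
    by simp
qed

lemma openin_toric_product_iff:
  "openin (toric_product_zariski 1 N \<Sigma>) W \<longleftrightarrow> W \<subseteq> toric_variety N \<Sigma> \<times> affine_space 1 \<and>
    (\<forall>\<tau>\<in>\<Sigma>. openin (affine_product_zariski 1 (A \<tau>))
      {z \<in> points (A \<tau>) \<times> affine_space 1. (chart N \<Sigma> \<tau> (fst z), snd z) \<in> W})"
  unfolding toric_product_zariski_def openin_final_topology topspace_affine_product_zariski
  by (simp add: case_prod_beta)

lemma chart_in_toric_variety: "\<tau> \<in> \<Sigma> \<Longrightarrow> x \<in> points (A \<tau>) \<Longrightarrow> chart N \<Sigma> \<tau> x \<in> toric_variety N \<Sigma>"
  unfolding toric_variety_eq by (erule pointsE) blast

lemma topspace_toric_product: "topspace (toric_product_zariski 1 N \<Sigma>) = toric_variety N \<Sigma> \<times> affine_space 1"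
proof -
  have "openin (affine_product_zariski 1 (A \<tau>))
      {z \<in> points (A \<tau>) \<times> affine_space 1. (chart N \<Sigma> \<tau> (fst z), snd z) \<in> toric_variety N \<Sigma> \<times> affine_space 1}"
    if "\<tau> \<in> \<Sigma>" for \<tau>
  proof -
    have "{z \<in> points (A \<tau>) \<times> affine_space 1. (chart N \<Sigma> \<tau> (fst z), snd z) \<in> toric_variety N \<Sigma> \<times> affine_space 1} =
        topspace (affine_product_zariski 1 (A \<tau>))"
      unfolding topspace_affine_product_zariski using chart_in_toric_variety[OF that] by auto
    then show ?thesis
      by simp
  qed
  then have "openin (toric_product_zariski 1 N \<Sigma>) (toric_variety N \<Sigma> \<times> affine_space 1)"
    unfolding openin_toric_product_iff by blast
  moreover have "topspace (toric_product_zariski 1 N \<Sigma>) \<subseteq> toric_variety N \<Sigma> \<times> affine_space 1"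
    unfolding topspace_def openin_toric_product_iff by blast
  ultimately show ?thesis
    using openin_subset by blast
qed

definition graph_closure :: "'a \<Rightarrow> ('a toric_point \<times> (nat \<Rightarrow> complex)) set" where
  "graph_closure u = {(tpoint \<tau> \<zeta>, t) | \<tau> \<zeta> t.
    \<tau> \<in> \<Sigma> \<and> monoid_hom N \<tau> \<zeta> \<and> t \<in> affine_space 1 \<and> graph_relations N u \<tau> \<zeta> (t 0)}"

lemma tpoint_in_graph_closure_iff:
  assumes "\<tau> \<in> \<Sigma>" "monoid_hom N \<tau> \<zeta>"
  shows "(tpoint \<tau> \<zeta>, t) \<in> graph_closure u \<longleftrightarrow> t \<in> affine_space 1 \<and> graph_relations N u \<tau> \<zeta> (t 0)"
proof
  assume "(tpoint \<tau> \<zeta>, t) \<in> graph_closure u"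
  then obtain \<tau>' \<zeta>' where *: "\<tau>' \<in> \<Sigma>" "monoid_hom N \<tau>' \<zeta>'" "tpoint \<tau> \<zeta> = tpoint \<tau>' \<zeta>'"
    "t \<in> affine_space 1" "graph_relations N u \<tau>' \<zeta>' (t 0)"
    unfolding graph_closure_def by blast
  then show "t \<in> affine_space 1 \<and> graph_relations N u \<tau> \<zeta> (t 0)"
    using graph_relations_tpoint[OF assms(1) *(1) assms(2) *(2,3)] by simp
next
  assume "t \<in> affine_space 1 \<and> graph_relations N u \<tau> \<zeta> (t 0)"
  then show "(tpoint \<tau> \<zeta>, t) \<in> graph_closure u"
    unfolding graph_closure_def using assms by blast
qed

text \<open>In every chart the set is defined by the vanishing of the balanced binomials
  \<open>binomial_test\<close>, and \<open>graph_relations_tpoint\<close> makes these local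
  conditions agree on overlaps.\<close>

lemma closedin_graph_closure: "closedin (toric_product_zariski 1 N \<Sigma>) (graph_closure u)"
proof -
  let ?Y = "toric_variety N \<Sigma> \<times> affine_space 1"
  have sub: "graph_closure u \<subseteq> ?Y"
    unfolding graph_closure_def toric_variety_eq by blast
  have "openin (affine_product_zariski 1 (A \<tau>))
      {z \<in> points (A \<tau>) \<times> affine_space 1. (chart N \<Sigma> \<tau> (fst z), snd z) \<in> ?Y - graph_closure u}"
      (is "openin _ ?W") if \<tau>: "\<tau> \<in> \<Sigma>" for \<tau>
  proof -
    let ?D = "\<lambda>F. {(x, t) \<in> points (A \<tau>) \<times> affine_space 1. eval_polynomial 1 x F t \<noteq> 0}"
    let ?B = "{?D (binomial_test m i m' j) | m m' i j.
      m \<in> Q \<tau> \<and> m' \<in> Q \<tau> \<and> m \<bullet> u + of_nat i = m' \<bullet> u + of_nat j}"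
    have iff: "(x, t) \<in> ?W \<longleftrightarrow> (x, t) \<in> \<Union>?B" if x: "x \<in> points (A \<tau>)" and t: "t \<in> affine_space 1" for x t
    proof -
      obtain \<zeta> where \<zeta>: "monoid_hom N \<tau> \<zeta>" "x = hom_point N \<tau> \<zeta>"
        using x by (rule pointsE)
      have "(x, t) \<in> ?W \<longleftrightarrow> \<not> graph_relations N u \<tau> \<zeta> (t 0)"
        using x t chart_in_toric_variety[OF \<tau> x] tpoint_in_graph_closure_iff[OF \<tau> \<zeta>(1), of t u] \<zeta>(2) by auto
      also have "\<dots> \<longleftrightarrow> (\<exists>m m' i j. m \<in> Q \<tau> \<and> m' \<in> Q \<tau> \<and> m \<bullet> u + of_nat i = m' \<bullet> u + of_nat j \<and>
          \<zeta> m * t 0 ^ i - \<zeta> m' * t 0 ^ j \<noteq> 0)"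
        unfolding graph_relations_def by auto
      also have "\<dots> \<longleftrightarrow> (\<exists>m m' i j. (m \<in> Q \<tau> \<and> m' \<in> Q \<tau> \<and> m \<bullet> u + of_nat i = m' \<bullet> u + of_nat j) \<and>
          eval_polynomial 1 x (binomial_test m i m' j) t \<noteq> 0)"
        unfolding \<zeta>(2) by (intro ex_cong1) (auto simp: eval_binomial_test simp del: One_nat_def)
      also have "\<dots> \<longleftrightarrow> (x, t) \<in> \<Union>?B"
        using x t by blast
      finally show ?thesis .
    qed
    have sub: "?W \<subseteq> points (A \<tau>) \<times> affine_space 1" "\<Union>?B \<subseteq> points (A \<tau>) \<times> affine_space 1"
      by auto
    have "z \<in> ?W \<longleftrightarrow> z \<in> \<Union>?B" for z
    proof (cases "z \<in> points (A \<tau>) \<times> affine_space 1")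
      case True
      then obtain x t where z: "z = (x, t)" "x \<in> points (A \<tau>)" "t \<in> affine_space 1"
        by blast
      show ?thesis
        unfolding z(1) by (rule iff[OF z(2,3)])
    next
      case False
      have "z \<notin> ?W"
        using False sub(1) by (rule contra_subsetD[rotated])
      moreover have "z \<notin> \<Union>?B"
        using False sub(2) by (rule contra_subsetD[rotated])
      ultimately show ?thesis
        by (simp only: simp_thms)
    qed
    then have "?W = \<Union>?B"
      by (rule set_eqI)
    moreover have "openin (affine_product_zariski 1 (A \<tau>)) (?D F)" if "F \<in> polynomials 1 (A \<tau>)" for F
      unfolding affine_product_zariski_def by (intro topology_generated_by_Basis) (use that in blast)
    then have "openin (affine_product_zariski 1 (A \<tau>)) (\<Union>?B)"
      using binomial_test_in_polynomials[of _ N \<tau>] by (intro openin_Union) blast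
    ultimately show ?thesis
      by simp
  qed
  then have "openin (toric_product_zariski 1 N \<Sigma>) (?Y - graph_closure u)"
    unfolding openin_toric_product_iff by blast
  then show ?thesis
    unfolding closedin_def topspace_toric_product using sub by blast
qed

text \<open>The projection of the graph closure is closed and contains every
  \<open>c \<noteq> 0\<close>, hence also 0. A point above 0 is the limit of the one-parameter
  subgroup; it lies in some chart, and the cone of that chart has to contain
  \<open>u\<close>.\<close>

lemma lattice_point_covered:
  assumes closed: "closed_map (toric_product_zariski 1 N \<Sigma>) (affine_space_zariski 1) snd"
    and "\<Sigma> \<noteq> {}" and u: "u \<in> N"
  shows "\<exists>\<tau>\<in>\<Sigma>. u \<in> \<tau>"
proof -
  let ?E = "snd ` graph_closure u"
  have E: "closedin (affine_space_zariski 1) ?E"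
    using closed closedin_graph_closure unfolding closed_map_def by blast
  obtain \<sigma> where \<sigma>: "\<sigma> \<in> \<Sigma>"
    using \<open>\<Sigma> \<noteq> {}\<close> by blast
  have nonzero: "diagonal_point c \<in> ?E" if c: "c \<noteq> 0" for c
  proof -
    \<comment> \<open>The one-parameter subgroup \<open>u\<close> at the parameter \<open>c\<close>;
      as \<open>m \<bullet> u\<close> is an integer for the characters in question, the floor merely
      changes its type.\<close>
    define \<zeta> where "\<zeta> = (\<lambda>m. c powi \<lfloor>m \<bullet> u\<rfloor>)"
    have int: "m \<bullet> u = of_int \<lfloor>m \<bullet> u\<rfloor>" if "m \<in> Q \<sigma>" for m
      using that dual_lattice_inner_Ints[OF _ u, of m] by (simp add: character_monoid_def)
    have hom: "monoid_hom N \<sigma> \<zeta>"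
      unfolding monoid_hom_def \<zeta>_def
    proof (intro conjI ballI)
      fix m m' assume m: "m \<in> Q \<sigma>" "m' \<in> Q \<sigma>"
      have "\<lfloor>(m + m') \<bullet> u\<rfloor> = \<lfloor>m \<bullet> u\<rfloor> + \<lfloor>m' \<bullet> u\<rfloor>"
        unfolding inner_add_left by (subst int[OF m(1)], subst int[OF m(2)]) (simp flip: of_int_add)
      then show "c powi \<lfloor>(m + m') \<bullet> u\<rfloor> = c powi \<lfloor>m \<bullet> u\<rfloor> * c powi \<lfloor>m' \<bullet> u\<rfloor>"
        using c by (simp add: power_int_add)
    qed simp
    have "graph_relations N u \<sigma> \<zeta> c"
      unfolding graph_relations_def
    proof (intro ballI allI impI)
      fix m m' and i j :: nat
      assume m: "m \<in> Q \<sigma>" "m' \<in> Q \<sigma>" and eq: "m \<bullet> u + of_nat i = m' \<bullet> u + of_nat j"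
      have "real_of_int (\<lfloor>m \<bullet> u\<rfloor> + int i) = real_of_int (\<lfloor>m' \<bullet> u\<rfloor> + int j)"
        using eq int[OF m(1)] int[OF m(2)] by simp
      then have "\<lfloor>m \<bullet> u\<rfloor> + int i = \<lfloor>m' \<bullet> u\<rfloor> + int j"
        by (simp only: of_int_eq_iff)
      then have "c powi (\<lfloor>m \<bullet> u\<rfloor> + int i) = c powi (\<lfloor>m' \<bullet> u\<rfloor> + int j)"
        by (simp only:)
      then show "\<zeta> m * c ^ i = \<zeta> m' * c ^ j"
        using c by (simp add: \<zeta>_def power_int_add)
    qed
    moreover have "diagonal_point c 0 = c"
      by (simp add: diagonal_point_def)
    ultimately have "(tpoint \<sigma> \<zeta>, diagonal_point c) \<in> graph_closure u"
      unfolding tpoint_in_graph_closure_iff[OF \<sigma> hom] using diagonal_point_in by (simp only: simp_thms)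
    then show ?thesis
      by (metis image_eqI snd_conv)
  qed
  have "diagonal_point 0 \<in> ?E"
  proof (rule ccontr)
    assume not: "diagonal_point 0 \<notin> ?E"
    have "openin (affine_space_zariski 1) (affine_space 1 - ?E)"
      using E unfolding closedin_def topspace_affine_line by blast
    then have "open {c. diagonal_point c \<in> affine_space 1 - ?E}"
      by (rule open_affine_line_preimage)
    moreover have "{c. diagonal_point c \<in> affine_space 1 - ?E} = {0}"
    proof (intro set_eqI iffI)
      fix c assume "c \<in> {c. diagonal_point c \<in> affine_space 1 - ?E}"
      then show "c \<in> {0}"
        using nonzero[of c] by auto
    next
      fix c :: complex assume "c \<in> {0}"
      then show "c \<in> {c. diagonal_point c \<in> affine_space 1 - ?E}"
        using not diagonal_point_in by blast
    qed
    ultimately show False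
      using not_open_singleton[of "0::complex"] by simp
  qed
  then obtain p where "(p, diagonal_point 0) \<in> graph_closure u"
    by auto
  then obtain \<tau> \<zeta> where \<tau>: "\<tau> \<in> \<Sigma>" "monoid_hom N \<tau> \<zeta>" "graph_relations N u \<tau> \<zeta> (diagonal_point 0 0)"
    unfolding graph_closure_def by blast
  have "u \<in> \<tau>"
  proof (rule ccontr)
    assume "u \<notin> \<tau>"
    obtain G where G: "finite G" "G \<subseteq> N" "\<tau> = convex_cone hull G"
      using cone_generators[OF \<tau>(1)] by blast
    obtain m where m: "m \<in> Q \<tau>" "m \<bullet> u < 0"
      using rational_cone_separation[OF lattice G(1,2) u] \<open>u \<notin> \<tau>\<close> G(3) by blast
    then obtain k where k: "m \<bullet> u = of_int k"
      using dual_lattice_inner_Ints[OF _ u, of m] by (auto simp: character_monoid_def elim: Ints_cases)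
    then have "k < 0"
      using m(2) by simp
    \<comment> \<open>The relation between \<open>m\<close> with exponent \<open>- k\<close> and the
      trivial character with exponent 0 becomes \<open>0 = 1\<close> at \<open>c = 0\<close>, since
      \<open>- k\<close> is positive.\<close>
    then have "m \<bullet> u + of_nat (nat (- k)) = 0 \<bullet> u + of_nat 0"
      by (simp add: k)
    then have "\<zeta> m * 0 ^ nat (- k) = \<zeta> 0 * 0 ^ 0"
      using \<tau>(3) m(1) character_monoid_0 unfolding graph_relations_def diagonal_point_def
      by (metis (no_types, lifting) lessThan_iff restrict_apply zero_less_one)
    then show False
      using \<tau>(2) \<open>k < 0\<close> by (simp add: monoid_hom_def power_0_left)
  qed
  then show ?thesis
    using \<tau>(1) by blast
qed

end

section \<open>Covering of the span by cones and of the points by unit polydiscs\<close>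

locale complete_toric_fan = toric_fan +
  assumes nonempty: "\<Sigma> \<noteq> {}"
    and closed_projection: "closed_map (toric_product_zariski 1 N \<Sigma>) (affine_space_zariski 1) snd"
begin

lemma closed_cone: "\<tau> \<in> \<Sigma> \<Longrightarrow> closed \<tau>"
  by (rule cone_generators) (auto intro: closed_convex_cone_hull_finite)

text \<open>If \<open>w\<close> is missed by all cones, each cone has a separating form that is
  negative at \<open>w\<close>. A lattice point with the same signs under these finitely many forms
  would be missed as well.\<close>

lemma span_covered:
  assumes w: "w \<in> span N"
  shows "\<exists>\<tau>\<in>\<Sigma>. w \<in> \<tau>"
proof (rule ccontr)
  assume "\<not> (\<exists>\<tau>\<in>\<Sigma>. w \<in> \<tau>)"
  then have "\<forall>\<tau>\<in>\<Sigma>. \<exists>a. a \<bullet> w < 0 \<and> (\<forall>x\<in>\<tau>. 0 \<le> a \<bullet> x)"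
    using closed_cone_separation closed_cone cone_convex_cone by blast
  then obtain a where a: "\<And>\<tau>. \<tau> \<in> \<Sigma> \<Longrightarrow> a \<tau> \<bullet> w < 0" "\<And>\<tau> x. \<tau> \<in> \<Sigma> \<Longrightarrow> x \<in> \<tau> \<Longrightarrow> 0 \<le> a \<tau> \<bullet> x"
    by metis
  have "finite (a ` \<Sigma>)"
    using fan by (simp add: is_fan_def)
  moreover have "w \<bullet> g \<noteq> 0" if "g \<in> a ` \<Sigma>" for g
    using that a(1) by (metis imageE inner_commute less_irrefl)
  ultimately have "\<exists>q\<in>N. \<forall>g\<in>a ` \<Sigma>. sgn (q \<bullet> g) = sgn (w \<bullet> g)"
    by (intro subgroup_sign_approximation[OF additive_subgroup_lattice[OF lattice] w]) auto
  then obtain q where q: "q \<in> N" "\<forall>g\<in>a ` \<Sigma>. sgn (q \<bullet> g) = sgn (w \<bullet> g)"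
    by blast
  obtain \<tau> where \<tau>: "\<tau> \<in> \<Sigma>" "q \<in> \<tau>"
    using lattice_point_covered[OF closed_projection nonempty q(1)] by blast
  have "sgn (q \<bullet> a \<tau>) = sgn (w \<bullet> a \<tau>)"
    using q(2) \<tau>(1) by blast
  then show False
    using sgn_eq_real_cong(2)[of "q \<bullet> a \<tau>" "w \<bullet> a \<tau>"] a(1)[OF \<tau>(1)] a(2)[OF \<tau>]
    by (simp add: inner_commute)
qed

text \<open>
  The absolute value of a point of the torus orbit of \<open>\<delta>\<close> has the form \<open>\<chi>\<^sup>m \<mapsto> exp (- m \<bullet> w)\<close>.
  Extending \<open>m \<mapsto> ln |\<chi>\<^sup>m|\<close> from a subgroup to its span requires that real relations
  between lattice vectors are generated by integral ones.
\<close>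

lemma additive_functional_inner:
  fixes h :: "'a \<Rightarrow> real"
  assumes M: "additive_subgroup M" "M \<subseteq> dual_lattice N"
    and h: "\<And>m m'. m \<in> M \<Longrightarrow> m' \<in> M \<Longrightarrow> h (m - m') = h m - h m'"
  obtains w where "w \<in> span N" "\<And>m. m \<in> M \<Longrightarrow> h m = - (m \<bullet> w)"
proof -
  define \<Gamma> where "\<Gamma> = (\<lambda>m. (m, h m)) ` M"
  have sub: "additive_subgroup \<Gamma>"
    unfolding additive_subgroup_def
  proof (intro conjI ballI)
    have "h 0 = 0"
      using h[OF additive_subgroup_0[OF M(1)] additive_subgroup_0[OF M(1)]] by simp
    then show "0 \<in> \<Gamma>"
      unfolding \<Gamma>_def zero_prod_def using additive_subgroup_0[OF M(1)] by (metis imageI)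
    fix x y assume "x \<in> \<Gamma>" "y \<in> \<Gamma>"
    then obtain m m' where m: "m \<in> M" "m' \<in> M" "x = (m, h m)" "y = (m', h m')"
      unfolding \<Gamma>_def by blast
    have "x - y = (m - m', h (m - m'))"
      using m h by simp
    then show "x - y \<in> \<Gamma>"
      unfolding \<Gamma>_def using additive_subgroup_diff[OF M(1) m(1,2)] by simp
  qed
  obtain B where B: "B \<subseteq> N" "independent B" "N \<subseteq> span B"
    using maximal_independent_subset[of N] by blast
  have finB: "finite B"
    using B(2) independent_imp_finite by blast
  \<comment> \<open>This says that the span of the graph is again the graph of a function, that is,
    that the linear extension of \<open>h\<close> is well defined.\<close>
  have "(0, 1) \<notin> span \<Gamma>"
  proof
    assume in_span: "(0, 1) \<in> span \<Gamma>"
    \<comment> \<open>The test vectors \<open>(b, 0)\<close>, which pair integrally with the graph,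
      force the first component of the approximating element to vanish, and \<open>(0, 1)\<close>
      forces the second to be positive, against \<open>h 0 = 0\<close>.\<close>
    define G where "G = insert (0::'a, 1::real) ((\<lambda>b. (b, 0)) ` B)"
    have "finite G"
      using finB by (simp add: G_def)
    moreover have "q \<bullet> g \<in> \<int>" if g: "g \<in> G" "(0, 1) \<bullet> g = 0" and q: "q \<in> \<Gamma>" for g q
    proof -
      obtain b where b: "b \<in> B" "g = (b, 0)"
        using g by (auto simp: G_def)
      obtain m where "m \<in> M" "q = (m, h m)"
        using q unfolding \<Gamma>_def by blast
      then show ?thesis
        using b B(1) M(2) dual_lattice_inner_Ints[of m N b] by auto
    qed
    ultimately have "\<exists>q\<in>\<Gamma>. \<forall>g\<in>G. sgn (q \<bullet> g) = sgn ((0, 1) \<bullet> g)"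
      by (intro subgroup_sign_approximation[OF sub in_span])
    then obtain m where m: "m \<in> M" "\<And>g. g \<in> G \<Longrightarrow> sgn ((m, h m) \<bullet> g) = sgn ((0, 1) \<bullet> g)"
      unfolding \<Gamma>_def by blast
    have "m \<bullet> b = 0" if "b \<in> B" for b
      using m(2)[of "(b, 0)"] that by (simp add: G_def sgn_zero_iff)
    moreover have "m \<in> span B"
      using m(1) M(2) B(3) span_minimal[of N "span B"] by (auto simp: dual_lattice_def)
    ultimately have "orthogonal m m"
      using orthogonal_to_span[of m B m] by (auto simp: orthogonal_def)
    then have "m = 0"
      by (simp add: orthogonal_self)
    moreover have "h 0 = 0"
      using h[OF additive_subgroup_0[OF M(1)] additive_subgroup_0[OF M(1)]] by simp
    ultimately show False
      using m(2)[of "(0, 1)"] by (simp add: G_def)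
  qed
  \<comment> \<open>The part \<open>z\<close> of \<open>(0, 1)\<close> orthogonal to the graph has
    the positive last component \<open>c = z \<bullet> z\<close>; division by it shows that
    \<open>h\<close> is minus the pairing with \<open>w' / c\<close>.\<close>
  obtain y z where y: "y \<in> span \<Gamma>" and z: "\<And>x. x \<in> span \<Gamma> \<Longrightarrow> orthogonal z x" and yz: "(0, 1) = y + z"
    using orthogonal_subspace_decomp_exists[of \<Gamma> "(0, 1)"] by metis
  obtain w' c where wc: "z = (w', c)"
    by (cases z) auto
  have "z \<noteq> 0"
    using y yz \<open>(0, 1) \<notin> span \<Gamma>\<close> by auto
  moreover have "z \<bullet> z = c"
  proof -
    have "z \<bullet> z = z \<bullet> ((0, 1) - y)"
      by (simp add: yz)
    also have "\<dots> = z \<bullet> (0, 1)"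
      using z[OF y] by (simp add: inner_diff_right orthogonal_def)
    finally show ?thesis
      by (simp add: wc)
  qed
  ultimately have "c > 0"
    by (metis inner_gt_zero_iff)
  obtain w where w: "w \<in> span N" "\<And>u. u \<in> span N \<Longrightarrow> w \<bullet> u = (w' /\<^sub>R c) \<bullet> u"
    using span_orthogonal_projection[of N "w' /\<^sub>R c"] by blast
  have "h m = - (m \<bullet> w)" if m: "m \<in> M" for m
  proof -
    have "(m, h m) \<in> span \<Gamma>"
      unfolding \<Gamma>_def using m by (intro span_base) blast
    then have "w' \<bullet> m + c * h m = 0"
      using z by (fastforce simp: orthogonal_def wc)
    moreover have "w \<bullet> m = (w' \<bullet> m) / c"
      using w(2)[of m] m M(2) by (auto simp: dual_lattice_def divide_inverse_commute)
    ultimately have "c * (h m + w \<bullet> m) = 0"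
      using \<open>c > 0\<close> by (simp add: distrib_left)
    then show ?thesis
      using \<open>c > 0\<close> by (simp add: inner_commute add_eq_0_iff2)
  qed
  then show thesis
    using that w(1) by blast
qed

text \<open>On the orbit of \<open>\<delta>\<close> the absolute values are
  \<open>exp (- m \<bullet> w)\<close> for the characters orthogonal to \<open>\<delta>\<close>.
  Those characters do not notice if an element of \<open>\<delta>\<close> is added to
  \<open>w\<close>, so a cone \<open>\<tau>\<close> above \<open>\<delta>\<close> that contains such
  a translate of \<open>w\<close> is what is needed.\<close>

lemma unit_polydisc_cover:
  assumes \<tau>0: "\<tau>0 \<in> \<Sigma>" and \<zeta>: "monoid_hom N \<tau>0 \<zeta>"
  obtains \<tau> \<xi> where "\<tau> \<in> \<Sigma>" "monoid_hom N (\<tau>0 \<inter> \<tau>) \<xi>" "\<And>m. m \<in> Q \<tau>0 \<Longrightarrow> \<xi> m = \<zeta> m"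
    "\<And>m. m \<in> Q \<tau> \<Longrightarrow> norm (\<xi> m) \<le> 1"
proof -
  define \<delta> where "\<delta> = orbit_cone N \<tau>0 \<zeta>"
  have \<delta>: "\<delta> \<in> \<Sigma>" "\<delta> \<subseteq> \<tau>0"
    unfolding \<delta>_def using orbit_cone_in_fan[OF \<tau>0 \<zeta>] orbit_cone_subset by blast+
  obtain \<xi> where \<xi>: "monoid_hom N \<delta> \<xi>" "\<And>m. m \<in> Q \<tau>0 \<Longrightarrow> \<xi> m = \<zeta> m"
    using extension_iff[OF \<tau>0 \<delta> \<zeta>] \<delta>_def by blast
  have orbit: "orbit_cone N \<delta> \<xi> = \<delta>"
    using orbit_cone_extension[OF \<tau>0 \<delta> \<xi>] by (simp add: \<delta>_def)
  define M where "M = {m \<in> dual_lattice N. \<forall>u\<in>\<delta>. m \<bullet> u = 0}"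
  have M: "additive_subgroup M"
    using additive_subgroup_dual_lattice[of N] by (auto simp: additive_subgroup_def M_def inner_diff_left)
  have MQ: "m \<in> Q \<delta>" if "m \<in> M" for m
    using that by (simp add: M_def character_monoid_def)
  have nz: "\<xi> m \<noteq> 0" if m: "m \<in> M" for m
  proof -
    have "\<xi> (m + - m) = \<xi> m * \<xi> (- m)"
      using m additive_subgroup_uminus[OF M m] by (intro monoid_hom_add[OF \<xi>(1)] MQ)
    then show ?thesis
      using \<xi>(1) by (auto simp: monoid_hom_def)
  qed
  define h where "h = (\<lambda>m. ln (norm (\<xi> m)))"
  have hdiff: "h (m - m') = h m - h m'" if m: "m \<in> M" "m' \<in> M" for m m'
  proof -
    have "\<xi> ((m - m') + m') = \<xi> (m - m') * \<xi> m'"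
      using m additive_subgroup_diff[OF M m] by (intro monoid_hom_add[OF \<xi>(1)] MQ)
    then have "norm (\<xi> m) = norm (\<xi> (m - m')) * norm (\<xi> m')"
      by (simp add: norm_mult)
    then show ?thesis
      using nz m additive_subgroup_diff[OF M m] by (simp add: h_def ln_mult)
  qed
  have "M \<subseteq> dual_lattice N"
    by (auto simp: M_def)
  then obtain w where w: "w \<in> span N" "\<And>m. m \<in> M \<Longrightarrow> h m = - (m \<bullet> w)"
    using additive_functional_inner[OF M _ hdiff] by blast
  obtain G where G: "finite G" "G \<subseteq> N" "\<delta> = convex_cone hull G"
    using cone_generators[OF \<delta>(1)] by blast
  \<comment> \<open>The sum of the generators lies in no proper face of
    \<open>\<delta>\<close>.\<close>
  define c where "c = \<Sum>G"
  have c: "c \<in> span N" "c \<in> \<delta>"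
  proof -
    show "c \<in> span N"
      unfolding c_def using G(2) by (intro span_sum) (auto intro: span_base)
    have "\<Sum>H \<in> \<delta>" if "H \<subseteq> G" for H
      using finite_subset[OF that G(1)] that
    proof (induction H rule: finite_induct)
      case empty
      then show ?case
        using cone_0[OF \<delta>(1)] by simp
    next
      case (insert g H)
      then have "g \<in> \<delta>"
        using G(3) by (simp add: hull_inc)
      then show ?case
        using insert convex_cone_add[OF cone_convex_cone[OF \<delta>(1)]] by simp
    qed
    then show "c \<in> \<delta>"
      unfolding c_def by blast
  qed
  have "w + of_nat L *\<^sub>R c \<in> span N" for L
    using w(1) c(1) by (intro span_add span_scale)
  then have "\<forall>L::nat. \<exists>\<tau>\<in>\<Sigma>. w + of_nat L *\<^sub>R c \<in> \<tau>"
    using span_covered by blast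
  then obtain T where T: "\<And>L::nat. T L \<in> \<Sigma>" "\<And>L::nat. w + of_nat L *\<^sub>R c \<in> T L"
    by metis
  have "finite (range T)"
    using T(1) fan by (auto simp: is_fan_def intro: finite_subset)
  \<comment> \<open>By the pigeonhole principle one cone contains \<open>w + L c\<close> for
    infinitely many \<open>L\<close>; being closed and convex, it then contains the direction
    \<open>c\<close>.\<close>
  then obtain L0 where inf: "infinite {L \<in> UNIV. T L = T L0}"
    using pigeonhole_infinite[of "UNIV :: nat set" T] by blast
  define \<tau> where "\<tau> = T L0"
  have \<tau>: "\<tau> \<in> \<Sigma>"
    using T(1) by (simp add: \<tau>_def)
  have "c \<in> \<tau>"
  proof (rule ccontr)
    assume "c \<notin> \<tau>"
    then obtain a where a: "a \<bullet> c < 0" "\<forall>x\<in>\<tau>. 0 \<le> a \<bullet> x"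
      using closed_cone_separation closed_cone[OF \<tau>] cone_convex_cone[OF \<tau>] by blast
    obtain n :: nat where n: "(a \<bullet> w) / - (a \<bullet> c) < of_nat n"
      using reals_Archimedean2 by blast
    obtain L where L: "T L = T L0" "n < L"
      using inf by (auto simp: infinite_nat_iff_unbounded)
    have "0 \<le> a \<bullet> w + of_nat L * (a \<bullet> c)"
      using a(2) T(2)[of L] L(1) by (auto simp: \<tau>_def inner_add_right)
    moreover have "a \<bullet> w < of_nat n * - (a \<bullet> c)"
      using n a(1) by (simp add: field_simps)
    moreover have "of_nat n * - (a \<bullet> c) \<le> of_nat L * - (a \<bullet> c)"
      using L(2) a(1) by (intro mult_right_mono) auto
    ultimately show False
      by simp
  qed
  \<comment> \<open>The common face with \<open>\<tau>\<close> is cut out of \<open>\<delta>\<close>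
    by a character that is nonnegative on the generators. It vanishes at their sum \<open>c\<close>,
    hence at each of them.\<close>
  have "\<delta> \<subseteq> \<tau>"
  proof -
    obtain m where m: "m \<in> Q \<delta>" "\<delta> \<inter> \<tau> = {x \<in> \<delta>. m \<bullet> x = 0}"
      using face_cut[OF \<delta>(1) Int_face_of[OF \<delta>(1) \<tau>]] cone_0[OF \<delta>(1)] cone_0[OF \<tau>] by blast
    have nonneg: "0 \<le> m \<bullet> g" if "g \<in> G" for g
      using m(1) that G(3) by (simp add: character_monoid_def hull_inc)
    have "(\<Sum>g\<in>G. m \<bullet> g) = m \<bullet> c"
      by (simp add: c_def inner_sum_right)
    also have "\<dots> = 0"
      using m(2) c(2) \<open>c \<in> \<tau>\<close> by blast
    finally have "\<forall>g\<in>G. m \<bullet> g = 0"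
      using sum_nonneg_eq_0_iff[OF G(1) nonneg] by simp
    then have "G \<subseteq> \<tau>"
      using m(2) G(3) hull_subset[of G convex_cone] by blast
    then show ?thesis
      unfolding G(3) by (rule hull_minimal) (rule cone_convex_cone[OF \<tau>])
  qed
  have "norm (\<xi> m) \<le> 1" if m: "m \<in> Q \<tau>" for m
  proof (cases "\<xi> m = 0")
    case False
    have "m \<in> Q \<delta>"
      using character_monoid_mono[OF \<open>\<delta> \<subseteq> \<tau>\<close>] m by blast
    then have perp: "m \<bullet> u = 0" if "u \<in> \<delta>" for u
      using False that orbit unfolding orbit_cone_def by blast
    then have "m \<in> M"
      using m by (simp add: M_def character_monoid_def)
    have "0 \<le> m \<bullet> (w + of_nat L0 *\<^sub>R c)"
      using m T(2)[of L0] by (simp add: character_monoid_def \<tau>_def)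
    then have "h m \<le> 0"
      using perp[OF c(2)] w(2)[OF \<open>m \<in> M\<close>] by (simp add: inner_add_right)
    then show ?thesis
      using False by (simp add: h_def ln_le_zero_iff)
  qed simp
  moreover have "monoid_hom N (\<tau>0 \<inter> \<tau>) \<xi>"
    using \<delta>(2) \<open>\<delta> \<subseteq> \<tau>\<close> by (intro monoid_hom_mono[OF _ \<xi>(1)]) blast
  ultimately show thesis
    using that[OF \<tau> _ \<xi>(2)] by blast
qed

end

section \<open>Bounded functions\<close>

text \<open>Reality and the bound are demanded at all vectors, including those outside the
  semigroup, so that the set is a closed subset of a product of discs and compact by Tychonoff's
  theorem.\<close>

definition unit_polydisc :: "'a::euclidean_space set \<Rightarrow> 'a set \<Rightarrow> ('a \<Rightarrow> complex) set" where
  "unit_polydisc N \<tau> = {\<zeta>. monoid_hom N \<tau> \<zeta> \<and> (\<forall>m. \<zeta> m \<in> \<real>) \<and> (\<forall>m. norm (\<zeta> m) \<le> 1)}"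

lemma closed_unit_polydisc: "closed (unit_polydisc N \<tau>)"
  unfolding unit_polydisc_def monoid_hom_def Ball_def complex_is_Real_iff
  by (intro closed_Collect_conj closed_Collect_all closed_Collect_imp closed_Collect_eq closed_Collect_le
      open_Collect_const continuous_intros continuous_on_product_coordinates)

lemma compact_unit_polydisc: "compact (unit_polydisc N \<tau>)"
proof -
  have "compactin (product_topology (\<lambda>i. euclidean) UNIV) (PiE UNIV (\<lambda>_::'a. cball (0::complex) 1))"
    by (simp add: compactin_PiE)
  then have "compact (PiE UNIV (\<lambda>_::'a. cball (0::complex) 1))"
    by (simp only: euclidean_product_topology compactin_euclidean_iff)
  then have "compact (PiE UNIV (\<lambda>_::'a. cball (0::complex) 1) \<inter> unit_polydisc N \<tau>)"
    by (rule compact_Int_closed) (rule closed_unit_polydisc)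
  moreover have "unit_polydisc N \<tau> \<subseteq> PiE UNIV (\<lambda>_::'a. cball (0::complex) 1)"
    by (auto simp: unit_polydisc_def)
  ultimately show ?thesis
    by (simp add: inf.absorb2)
qed

lemma topspace_affine_euclidean: "topspace (affine_euclidean A) = real_points A"
  by (auto simp: affine_euclidean_def real_points_def points_def extensional_def PiE_def)

lemma continuous_map_affine_euclidean_value:
  assumes "f \<in> A"
  shows "continuous_map (affine_euclidean A) euclidean (\<lambda>x. x f)"
  unfolding affine_euclidean_def
  by (intro continuous_map_from_subtopology continuous_map_product_projection[OF assms])

lemma openin_affine_euclidean_compare:
  assumes "f \<in> A" "g \<in> A"
  shows "openin (affine_euclidean A) {x \<in> real_points A. C * norm (x g) < norm (x f)}"
proof -
  have "continuous_map (affine_euclidean A) euclideanreal (\<lambda>x. C * norm (x g) - norm (x f))"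
    by (intro continuous_map_diff continuous_map_real_mult_left continuous_map_norm
        continuous_map_affine_euclidean_value assms)
  then have "openin (affine_euclidean A)
      {x \<in> topspace (affine_euclidean A). C * norm (x g) - norm (x f) \<in> {..<0}}"
    by (rule openin_continuous_map_preimage) simp
  then show ?thesis
    by (simp add: topspace_affine_euclidean)
qed

lemma continuous_map_hom_point:
  "continuous_map (top_of_set (unit_polydisc N \<tau>)) (affine_euclidean (coordinate_ring N \<tau>)) (hom_point N \<tau>)"
  unfolding affine_euclidean_def continuous_map_in_subtopology
proof
  show "continuous_map (top_of_set (unit_polydisc N \<tau>)) (product_topology (\<lambda>f. euclidean) (coordinate_ring N \<tau>))
      (hom_point N \<tau>)"
    unfolding continuous_map_componentwise
  proof (intro conjI ballI)
    show "hom_point N \<tau> ` topspace (top_of_set (unit_polydisc N \<tau>)) \<subseteq> extensional (coordinate_ring N \<tau>)"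
      by (auto simp: hom_point_def)
    fix f assume f: "f \<in> coordinate_ring N \<tau>"
    have "continuous_on (unit_polydisc N \<tau>) (\<lambda>\<zeta>. eval_hom \<zeta> f)"
      unfolding eval_hom_def by (intro continuous_intros continuous_on_product_then_coordinatewise continuous_on_id)
    then show "continuous_map (top_of_set (unit_polydisc N \<tau>)) euclidean (\<lambda>\<zeta>. hom_point N \<tau> \<zeta> f)"
      by (simp add: hom_point_apply[OF f])
  qed
  show "hom_point N \<tau> \<in> topspace (top_of_set (unit_polydisc N \<tau>)) \<rightarrow> real_points (coordinate_ring N \<tau>)"
    by (auto simp: unit_polydisc_def hom_point_real_iff)
qed

lemma closure_of_meets_openin:
  assumes "x \<in> T closure_of S" "openin T W" "x \<in> W"
  obtains y where "y \<in> S" "y \<in> W"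
proof -
  have "\<forall>W. x \<in> W \<and> openin T W \<longrightarrow> (\<exists>y. y \<in> S \<and> y \<in> W)"
    using assms(1) unfolding in_closure_of by (rule conjunct2)
  then show thesis
    using assms(2,3) that by blast
qed

section \<open>Overlaps of charts and open sets of the glued topologies\<close>

context toric_fan
begin

lemma chart_eq_iff:
  assumes "\<tau> \<in> \<Sigma>" "\<tau>' \<in> \<Sigma>" "x \<in> points (A \<tau>)" "y \<in> points (A \<tau>')"
  shows "chart N \<Sigma> \<tau> x = chart N \<Sigma> \<tau>' y \<longleftrightarrow>
    (\<exists>\<xi>. monoid_hom N (\<tau> \<inter> \<tau>') \<xi> \<and> x = hom_point N \<tau> \<xi> \<and> y = hom_point N \<tau>' \<xi>)"
proof -
  obtain \<zeta> where \<zeta>: "monoid_hom N \<tau> \<zeta>" "x = hom_point N \<tau> \<zeta>"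
    using assms(3) by (rule pointsE)
  obtain \<zeta>' where \<zeta>': "monoid_hom N \<tau>' \<zeta>'" "y = hom_point N \<tau>' \<zeta>'"
    using assms(4) by (rule pointsE)
  show ?thesis
    unfolding \<zeta>(2) \<zeta>'(2) tpoint_eq_iff[OF assms(1,2) \<zeta>(1) \<zeta>'(1)] by (simp add: hom_point_eq_iff)
qed

lemma chart_eqE:
  assumes "\<tau> \<in> \<Sigma>" "\<tau>' \<in> \<Sigma>" "x \<in> points (A \<tau>)" "y \<in> points (A \<tau>')"
    and "chart N \<Sigma> \<tau> x = chart N \<Sigma> \<tau>' y"
  obtains \<xi> where "monoid_hom N (\<tau> \<inter> \<tau>') \<xi>" "x = hom_point N \<tau> \<xi>" "y = hom_point N \<tau>' \<xi>"
  using iffD1[OF chart_eq_iff[OF assms(1-4)] assms(5)] by blast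

text \<open>On the overlap each coordinate of one chart is a fraction of coordinates of the other,
  so reality carries over by \<open>extension_real\<close>.\<close>

lemma chart_eq_real:
  assumes "\<tau> \<in> \<Sigma>" "\<tau>' \<in> \<Sigma>" "x \<in> real_points (A \<tau>)" "y \<in> points (A \<tau>')"
    and "chart N \<Sigma> \<tau> x = chart N \<Sigma> \<tau>' y"
  shows "y \<in> real_points (A \<tau>')"
proof -
  have x: "x \<in> points (A \<tau>)"
    using assms(3) by (simp add: real_points_def)
  obtain \<xi> where \<xi>: "monoid_hom N (\<tau> \<inter> \<tau>') \<xi>" "x = hom_point N \<tau> \<xi>" "y = hom_point N \<tau>' \<xi>"
    using chart_eqE[OF assms(1,2) x assms(4,5)] by blast
  have hom: "monoid_hom N \<tau> \<xi>" "monoid_hom N \<tau>' \<xi>"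
    by (rule monoid_hom_mono[OF _ \<xi>(1)], simp)+
  have "\<xi> m \<in> \<real>" if "m \<in> Q \<tau>" for m
    using assms(3) that unfolding \<xi>(2) hom_point_real_iff[OF hom(1)] by blast
  then have "\<xi> m \<in> \<real>" if "m \<in> Q (\<tau> \<inter> \<tau>')" for m
    using extension_real[OF assms(1) Int_in_fan[OF assms(1,2)] _ \<xi>(1) _ that] by blast
  then show ?thesis
    unfolding \<xi>(3) hom_point_real_iff[OF hom(2)] using character_monoid_mono[of "\<tau> \<inter> \<tau>'" \<tau>' N] by blast
qed

text \<open>
  The overlap of two charts is the principal open subset of \<open>U\<^sub>\<tau>\<^sub>'\<close> defined by a monomial \<open>s\<close>, a
  power of which clears the denominators of finitely many functions on \<open>U\<^sub>\<tau>\<close>.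
\<close>

lemma chart_overlap:
  assumes \<tau>: "\<tau> \<in> \<Sigma>" and \<tau>': "\<tau>' \<in> \<Sigma>" and F: "finite F" "F \<subseteq> A \<tau>"
  obtains s where "s \<in> A \<tau>'" "\<And>a. a \<in> F \<Longrightarrow> s * a \<in> A \<tau>'"
    "\<And>x a. x \<in> points (A \<tau>') \<Longrightarrow> x s = 0 \<Longrightarrow> a \<in> F \<Longrightarrow> x (s * a) = 0"
    "\<And>x y. x \<in> points (A \<tau>') \<Longrightarrow> y \<in> points (A \<tau>) \<Longrightarrow> chart N \<Sigma> \<tau> y = chart N \<Sigma> \<tau>' x \<Longrightarrow>
       x s \<noteq> 0 \<and> (\<forall>a\<in>F. x (s * a) = x s * y a)"
    "\<And>x. x \<in> points (A \<tau>') \<Longrightarrow> x s \<noteq> 0 \<Longrightarrow> \<exists>y\<in>points (A \<tau>). chart N \<Sigma> \<tau> y = chart N \<Sigma> \<tau>' x"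
proof -
  let ?\<gamma> = "\<tau>' \<inter> \<tau>"
  obtain m0 where m0: "m0 \<in> Q \<tau>'" "?\<gamma> = {x \<in> \<tau>'. m0 \<bullet> x = 0}"
    using subcone_cut[OF \<tau>' Int_in_fan[OF \<tau>' \<tau>]] by blast
  have Q: "Q \<tau>' \<subseteq> Q ?\<gamma>" "Q \<tau> \<subseteq> Q ?\<gamma>" and A: "A \<tau>' \<subseteq> A ?\<gamma>" "A \<tau> \<subseteq> A ?\<gamma>"
    by (auto intro!: character_monoid_mono coordinate_ring_mono)
  have "finite (\<Union>a\<in>F. Poly_Mapping.keys a)" "(\<Union>a\<in>F. Poly_Mapping.keys a) \<subseteq> Q ?\<gamma>"
    using F Q(2) by (auto simp: coordinate_ring_eq)
  then obtain L where L: "\<forall>m\<in>(\<Union>a\<in>F. Poly_Mapping.keys a). m + of_nat L *\<^sub>R m0 \<in> Q \<tau>'"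
    using localization_finite[OF \<tau>' m0] by blast
  define d where "d = (char_fun (of_nat L *\<^sub>R m0) :: 'a \<Rightarrow>\<^sub>0 real)"
  \<comment> \<open>The additional factor makes \<open>s * a\<close> vanish wherever
    \<open>s\<close> does, and it keeps the zero set of \<open>s\<close> equal to that of
    \<open>char_fun m0\<close> even if \<open>L = 0\<close>.\<close>
  define s where "s = char_fun m0 * d"
  have m0A: "char_fun m0 \<in> A \<tau>'" and dA: "d \<in> A \<tau>'"
    unfolding d_def by (intro coordinate_ring_single character_monoid_scale m0(1))+
  have sA: "s \<in> A \<tau>'"
    unfolding s_def by (intro coordinate_ring_mult m0A dA)
  have da: "d * a \<in> A \<tau>'" if "a \<in> F" for a
    unfolding coordinate_ring_eq
  proof (intro CollectI subsetI)
    fix k assume "k \<in> Poly_Mapping.keys (d * a)"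
    then obtain m where "m \<in> Poly_Mapping.keys a" "k = of_nat L *\<^sub>R m0 + m"
      unfolding d_def using keys_char_fun_mult by blast
    then show "k \<in> Q \<tau>'"
      using L \<open>a \<in> F\<close> by (auto simp: add.commute)
  qed
  have sa: "s * a = char_fun m0 * (d * a)" for a
    by (simp add: s_def mult.assoc)
  have saA: "s * a \<in> A \<tau>'" if "a \<in> F" for a
    unfolding sa by (intro coordinate_ring_mult m0A da that)
  have val: "x s = x (char_fun m0) ^ Suc L" "a \<in> F \<Longrightarrow> x (s * a) = x (char_fun m0) * x (d * a)"
    if x: "x \<in> points (A \<tau>')" for x a
  proof -
    obtain \<zeta> where \<zeta>: "monoid_hom N \<tau>' \<zeta>" "x = hom_point N \<tau>' \<zeta>"
      using x by (rule pointsE)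
    have "x s = x (char_fun m0) * x d"
      using x m0A dA unfolding points_def s_def by blast
    moreover have "x d = x (char_fun m0) ^ L"
      unfolding \<zeta>(2) d_def hom_point_char[OF m0(1)] hom_point_char[OF character_monoid_scale[OF m0(1)]]
      by (rule monoid_hom_scale[OF \<zeta>(1) m0(1)])
    ultimately show "x s = x (char_fun m0) ^ Suc L"
      by simp
    assume "a \<in> F"
    then show "x (s * a) = x (char_fun m0) * x (d * a)"
      using x m0A da unfolding points_def sa by blast
  qed
  show thesis
  proof (rule that[of s])
    show "s \<in> A \<tau>'" "\<And>a. a \<in> F \<Longrightarrow> s * a \<in> A \<tau>'"
      by (fact sA, fact saA)
    show "x (s * a) = 0" if "x \<in> points (A \<tau>')" "x s = 0" "a \<in> F" for x a
      using val(1)[OF that(1)] val(2)[OF that(1,3)] that(2) by auto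
    show "x s \<noteq> 0 \<and> (\<forall>a\<in>F. x (s * a) = x s * y a)"
      if xy: "x \<in> points (A \<tau>')" "y \<in> points (A \<tau>)" "chart N \<Sigma> \<tau> y = chart N \<Sigma> \<tau>' x" for x y
    proof -
      obtain \<xi> where \<xi>: "monoid_hom N ?\<gamma> \<xi>" "x = hom_point N \<tau>' \<xi>" "y = hom_point N \<tau> \<xi>"
        using chart_eqE[OF \<tau>' \<tau> xy(1,2) xy(3)[symmetric]] by blast
      have "\<xi> m0 \<noteq> 0"
        by (rule cut_unit[OF m0 \<xi>(1)])
      then have "x s \<noteq> 0"
        unfolding val(1)[OF xy(1)] by (simp add: \<xi>(2) hom_point_char[OF m0(1)])
      moreover have "x (s * a) = x s * y a" if "a \<in> F" for a
      proof -
        have "a \<in> A \<tau>"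
          using that F(2) by blast
        moreover have "eval_hom \<xi> (s * a) = eval_hom \<xi> s * eval_hom \<xi> a"
          using sA A \<open>a \<in> A \<tau>\<close> by (intro eval_hom_mult[OF \<xi>(1)]) auto
        ultimately show ?thesis
          by (simp add: \<xi>(2,3) hom_point_apply saA[OF that] sA)
      qed
      ultimately show ?thesis
        by blast
    qed
    show "\<exists>y\<in>points (A \<tau>). chart N \<Sigma> \<tau> y = chart N \<Sigma> \<tau>' x" if x: "x \<in> points (A \<tau>')" "x s \<noteq> 0" for x
    proof -
      obtain \<zeta> where \<zeta>: "monoid_hom N \<tau>' \<zeta>" "x = hom_point N \<tau>' \<zeta>"
        using x(1) by (rule pointsE)
      have "\<zeta> m0 \<noteq> 0"
        using x(2) unfolding val(1)[OF x(1)] by (simp add: \<zeta>(2) hom_point_char[OF m0(1)])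
      then obtain \<xi> where \<xi>: "monoid_hom N ?\<gamma> \<xi>" "\<forall>m\<in>Q \<tau>'. \<xi> m = \<zeta> m"
        using extension_exists[OF \<tau>' m0 \<zeta>(1)] by blast
      have "x = hom_point N \<tau>' \<xi>"
        using \<xi>(2) by (simp add: \<zeta>(2) hom_point_eq_iff)
      moreover have "tpoint \<tau>' \<xi> = tpoint \<tau> \<xi>"
        by (rule tpoint_eqI[OF \<tau>' \<tau> \<xi>(1)])
      moreover have "hom_point N \<tau> \<xi> \<in> points (A \<tau>)"
        by (rule hom_point_in_points[OF monoid_hom_mono[OF _ \<xi>(1)]]) simp
      ultimately show ?thesis
        by metis
    qed
  qed
qed

text \<open>In another chart the set is the principal open set of \<open>s * a\<close>: if this
  function is nonzero at a point, so is \<open>s\<close>, and the point belongs to the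
  overlap.\<close>

lemma openin_toric_zariski_chart:
  assumes \<tau>: "\<tau> \<in> \<Sigma>" and a: "a \<in> A \<tau>"
  shows "openin (toric_zariski N \<Sigma>) (chart N \<Sigma> \<tau> ` {y \<in> points (A \<tau>). y a \<noteq> 0})" (is "openin _ ?W")
  unfolding openin_toric_zariski_iff
proof (intro conjI ballI)
  show "?W \<subseteq> toric_variety N \<Sigma>"
    using chart_in_toric_variety[OF \<tau>] by blast
  fix \<tau>' assume \<tau>': "\<tau>' \<in> \<Sigma>"
  obtain s where s: "s * a \<in> A \<tau>'"
    "\<And>x. x \<in> points (A \<tau>') \<Longrightarrow> x s = 0 \<Longrightarrow> x (s * a) = 0"
    "\<And>x y. x \<in> points (A \<tau>') \<Longrightarrow> y \<in> points (A \<tau>) \<Longrightarrow> chart N \<Sigma> \<tau> y = chart N \<Sigma> \<tau>' x \<Longrightarrow>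
       x s \<noteq> 0 \<and> x (s * a) = x s * y a"
    "\<And>x. x \<in> points (A \<tau>') \<Longrightarrow> x s \<noteq> 0 \<Longrightarrow> \<exists>y\<in>points (A \<tau>). chart N \<Sigma> \<tau> y = chart N \<Sigma> \<tau>' x"
    by (rule chart_overlap[OF \<tau> \<tau>', of "{a}"]) (use a in auto)
  have "chart N \<Sigma> \<tau>' x \<in> ?W \<longleftrightarrow> x (s * a) \<noteq> 0" if x: "x \<in> points (A \<tau>')" for x
  proof
    assume "chart N \<Sigma> \<tau>' x \<in> ?W"
    then obtain y where "y \<in> points (A \<tau>)" "y a \<noteq> 0" "chart N \<Sigma> \<tau> y = chart N \<Sigma> \<tau>' x"
      by force
    then show "x (s * a) \<noteq> 0"
      using s(3)[OF x] by simp
  next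
    assume nz: "x (s * a) \<noteq> 0"
    then have "x s \<noteq> 0"
      using s(2)[OF x] by blast
    then obtain y where y: "y \<in> points (A \<tau>)" "chart N \<Sigma> \<tau> y = chart N \<Sigma> \<tau>' x"
      using s(4)[OF x] by blast
    then have "y a \<noteq> 0"
      using s(3)[OF x y] nz by simp
    then show "chart N \<Sigma> \<tau>' x \<in> ?W"
      using y by (intro image_eqI[of _ _ y]) auto
  qed
  then have "{x \<in> points (A \<tau>'). chart N \<Sigma> \<tau>' x \<in> ?W} = {x \<in> points (A \<tau>'). x (s * a) \<noteq> 0}"
    by (intro Collect_cong conj_cong refl)
  then show "openin (affine_zariski (A \<tau>')) {x \<in> points (A \<tau>'). chart N \<Sigma> \<tau>' x \<in> ?W}"
    using openin_affine_zariski_basis[OF s(1)] by simp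
qed

lemma real_points_subset: "real_points B \<subseteq> points B"
  by (auto simp: real_points_def)

lemma openin_toric_euclidean_iff:
  "openin (toric_euclidean N \<Sigma>) W \<longleftrightarrow> W \<subseteq> toric_real_points N \<Sigma> \<and>
    (\<forall>\<tau>\<in>\<Sigma>. openin (affine_euclidean (A \<tau>)) {x \<in> real_points (A \<tau>). chart N \<Sigma> \<tau> x \<in> W})"
  unfolding toric_euclidean_def openin_final_topology by (simp add: topspace_affine_euclidean)

lemma topspace_toric_euclidean: "topspace (toric_euclidean N \<Sigma>) = toric_real_points N \<Sigma>"
proof -
  have "openin (affine_euclidean (A \<tau>)) {x \<in> real_points (A \<tau>). chart N \<Sigma> \<tau> x \<in> toric_real_points N \<Sigma>}"
    if "\<tau> \<in> \<Sigma>" for \<tau>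
  proof -
    have "{x \<in> real_points (A \<tau>). chart N \<Sigma> \<tau> x \<in> toric_real_points N \<Sigma>} = topspace (affine_euclidean (A \<tau>))"
      using that unfolding topspace_affine_euclidean toric_real_points_def by blast
    then show ?thesis
      by simp
  qed
  then have "openin (toric_euclidean N \<Sigma>) (toric_real_points N \<Sigma>)"
    unfolding openin_toric_euclidean_iff by blast
  moreover have "topspace (toric_euclidean N \<Sigma>) \<subseteq> toric_real_points N \<Sigma>"
    unfolding topspace_def openin_toric_euclidean_iff by blast
  ultimately show ?thesis
    using openin_subset by blast
qed

text \<open>A homogeneous comparison survives multiplication of both sides by \<open>s\<close>.
  Since \<open>C\<close> is nonnegative, the strict inequality makes \<open>s * a\<close> nonzero,
  which confines it to the overlap.\<close>

lemma openin_toric_euclidean_chart: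
  assumes \<tau>: "\<tau> \<in> \<Sigma>" and a: "a \<in> A \<tau>" and b: "b \<in> A \<tau>" and C: "0 \<le> C"
  shows "openin (toric_euclidean N \<Sigma>) (chart N \<Sigma> \<tau> ` {y \<in> real_points (A \<tau>). C * norm (y b) < norm (y a)})"
    (is "openin _ ?W")
  unfolding openin_toric_euclidean_iff
proof (intro conjI ballI)
  show "?W \<subseteq> toric_real_points N \<Sigma>"
    using \<tau> unfolding toric_real_points_def by blast
  fix \<tau>' assume \<tau>': "\<tau>' \<in> \<Sigma>"
  obtain s where s: "s * a \<in> A \<tau>'" "s * b \<in> A \<tau>'"
    "\<And>x. x \<in> points (A \<tau>') \<Longrightarrow> x s = 0 \<Longrightarrow> x (s * a) = 0"
    "\<And>x y. x \<in> points (A \<tau>') \<Longrightarrow> y \<in> points (A \<tau>) \<Longrightarrow> chart N \<Sigma> \<tau> y = chart N \<Sigma> \<tau>' x \<Longrightarrow>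
       x s \<noteq> 0 \<and> x (s * a) = x s * y a \<and> x (s * b) = x s * y b"
    "\<And>x. x \<in> points (A \<tau>') \<Longrightarrow> x s \<noteq> 0 \<Longrightarrow> \<exists>y\<in>points (A \<tau>). chart N \<Sigma> \<tau> y = chart N \<Sigma> \<tau>' x"
    by (rule chart_overlap[OF \<tau> \<tau>', of "{a, b}"]) (use a b in auto)
  have cmp: "C * norm (x (s * b)) < norm (x (s * a)) \<longleftrightarrow> C * norm (y b) < norm (y a)"
    if "x \<in> points (A \<tau>')" "y \<in> points (A \<tau>)" "chart N \<Sigma> \<tau> y = chart N \<Sigma> \<tau>' x" for x y
  proof -
    have "0 < norm (x s)" "x (s * a) = x s * y a" "x (s * b) = x s * y b"
      using s(4)[OF that] by auto
    then show ?thesis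
      by (simp add: norm_mult mult.left_commute)
  qed
  have "chart N \<Sigma> \<tau>' x \<in> ?W \<longleftrightarrow> C * norm (x (s * b)) < norm (x (s * a))" if x: "x \<in> real_points (A \<tau>')" for x
  proof
    have xp: "x \<in> points (A \<tau>')"
      using x real_points_subset by blast
    show "C * norm (x (s * b)) < norm (x (s * a))" if W: "chart N \<Sigma> \<tau>' x \<in> ?W"
    proof -
      obtain y where "y \<in> real_points (A \<tau>)" "C * norm (y b) < norm (y a)" "chart N \<Sigma> \<tau> y = chart N \<Sigma> \<tau>' x"
        using W by force
      then show ?thesis
        using cmp[OF xp] real_points_subset by blast
    qed
    assume less: "C * norm (x (s * b)) < norm (x (s * a))"
    have "0 \<le> C * norm (x (s * b))"
      using C by simp
    then have "x (s * a) \<noteq> 0"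
      using less by auto
    then obtain y where y: "y \<in> points (A \<tau>)" "chart N \<Sigma> \<tau> y = chart N \<Sigma> \<tau>' x"
      using s(3,5)[OF xp] by blast
    have "y \<in> real_points (A \<tau>)"
      by (rule chart_eq_real[OF \<tau>' \<tau> x y(1) y(2)[symmetric]])
    moreover have "C * norm (y b) < norm (y a)"
      using cmp[OF xp y] less by simp
    ultimately show "chart N \<Sigma> \<tau>' x \<in> ?W"
      using y by (intro image_eqI[of _ _ y]) auto
  qed
  then have "{x \<in> real_points (A \<tau>'). chart N \<Sigma> \<tau>' x \<in> ?W} =
      {x \<in> real_points (A \<tau>'). C * norm (x (s * b)) < norm (x (s * a))}"
    by (intro Collect_cong conj_cong refl)
  then show "openin (affine_euclidean (A \<tau>')) {x \<in> real_points (A \<tau>'). chart N \<Sigma> \<tau>' x \<in> ?W}"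
    using openin_affine_euclidean_compare[OF s(1,2), of C] by simp
qed

text \<open>With a pole of order \<open>k\<close>, write \<open>f = a / b\<close>, where
  \<open>b\<close> is the \<open>k\<close>-th power of a uniformizer and \<open>a\<close> does not
  vanish identically on the divisor. Density gives a point of the divisor in the closure of
  \<open>S\<close> with \<open>a\<close> nonzero and \<open>b\<close> zero; at nearby points of
  \<open>S\<close> the quotient exceeds every bound.\<close>

lemma bounded_imp_order_nonneg:
  assumes \<sigma>: "\<sigma> \<in> \<Sigma>" and S: "S \<subseteq> points (A \<sigma>)" and ray: "primitive_ray \<rho> u"
    and f: "f \<in> A \<sigma>" "\<And>x. x \<in> S \<Longrightarrow> norm (x f) \<le> C"
    and dense: "orbit_closure \<rho> \<subseteq> toric_zariski N \<Sigma> closure_of (orbit_closure \<rho> \<inter> real_closure N \<sigma> \<Sigma> S)"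
    and m: "m \<in> Poly_Mapping.keys f"
  shows "0 \<le> m \<bullet> u"
proof (rule ccontr)
  assume "\<not> 0 \<le> m \<bullet> u"
  have \<rho>: "\<rho> \<in> \<Sigma>"
    using ray by (rule primitive_ray_in_fan)
  have fnz: "f \<noteq> 0" and neg: "order_min u f < 0"
    using m \<open>\<not> 0 \<le> m \<bullet> u\<close> order_min_le[OF m, of u] by auto
  have fN: "Poly_Mapping.keys f \<subseteq> dual_lattice N"
    using f(1) by (auto simp: coordinate_ring_eq character_monoid_def)
  obtain j where "order_min u f = of_int j"
    using order_along_orbit_closure[OF ray fnz fN] by metis
  then obtain k :: nat where k: "order_min u f = - of_nat k" "0 < k"
    using neg by (metis nat_0_less_mult_iff neg_less_0_iff_less of_int_less_0_iff of_int_minus of_int_of_nat_eq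
        zero_less_imp_eq_int add.inverse_inverse)
  obtain e where e: "e \<in> dual_lattice N" "e \<bullet> u = 1"
    using ray unfolding primitive_ray_def by blast
  define b where "b = (char_fun (of_nat k *\<^sub>R e) :: 'a \<Rightarrow>\<^sub>0 real)"
  define a where "a = b * f"
  have ke: "of_nat k *\<^sub>R e \<in> Q \<rho>"
    using e by (auto simp: primitive_ray_character_monoid[OF ray]
        intro!: additive_subgroup_scale_nat additive_subgroup_dual_lattice)
  have b: "b \<in> A \<rho>" "b \<noteq> 0" "order_min u b = of_nat k"
    using ke e(2) by (auto simp: b_def coordinate_ring_single order_min_def simp flip: keys_eq_empty)
  have a: "a \<noteq> 0" "order_min u a = 0"
    using order_min_mult(1)[OF b(2) fnz] order_min_mult(2)[OF b(2) fnz, of u] b(3) k(1) by (simp_all add: a_def)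
  have aA: "a \<in> A \<rho>"
    unfolding coordinate_ring_eq
  proof (intro CollectI subsetI)
    fix i assume i: "i \<in> Poly_Mapping.keys a"
    then obtain m' where m': "m' \<in> Poly_Mapping.keys f" "i = of_nat k *\<^sub>R e + m'"
      unfolding a_def b_def using keys_char_fun_mult by blast
    have "i \<in> dual_lattice N"
      using m' fN e(1) by (auto intro!: additive_subgroup_add additive_subgroup_scale_nat additive_subgroup_dual_lattice)
    then show "i \<in> Q \<rho>"
      using order_min_le[OF i, of u] a(2) by (simp add: primitive_ray_character_monoid[OF ray])
  qed
  obtain ma where ma: "ma \<in> Poly_Mapping.keys a" "ma \<bullet> u = 0"
    using order_min_attained[OF a(1), of u] a(2) by metis
  \<comment> \<open>As \<open>a\<close> has order 0, it is nonzero at a generic point of the orbit.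
    So the open set where \<open>a\<close> is nonzero meets the divisor and, by density, the closure
    of \<open>S\<close> within it.\<close>
  have "\<exists>w. \<forall>h\<in>{a}. eval_hom (face_hom \<rho> w) h \<noteq> 0"
    using ma primitive_ray_perp[OF ray, of ma] by (intro generic_face_hom) auto
  then obtain w where w: "eval_hom (face_hom \<rho> w) a \<noteq> 0"
    by blast
  let ?W = "chart N \<Sigma> \<rho> ` {y \<in> points (A \<rho>). y a \<noteq> 0}"
  have in_W: "tpoint \<rho> (face_hom \<rho> w) \<in> ?W"
    using w hom_point_in_points[OF monoid_hom_face_hom[OF subset_refl]]
    by (intro imageI) (simp add: hom_point_apply[OF aA])
  have in_closure: "tpoint \<rho> (face_hom \<rho> w) \<in> toric_zariski N \<Sigma> closure_of (orbit_closure \<rho> \<inter> real_closure N \<sigma> \<Sigma> S)"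
    using dense face_point_in_orbit_closure[OF \<rho>] by blast
  obtain p where p: "p \<in> orbit_closure \<rho>" "p \<in> real_closure N \<sigma> \<Sigma> S" "p \<in> ?W"
    by (rule closure_of_meets_openin[OF in_closure openin_toric_zariski_chart[OF \<rho> aA] in_W]) (erule IntE)
  obtain y where y: "y \<in> points (A \<rho>)" "y a \<noteq> 0" "p = chart N \<Sigma> \<rho> y"
    using p(3) by blast
  have "p \<in> toric_real_points N \<Sigma>"
    using p(2) closure_of_subset_topspace[of "toric_euclidean N \<Sigma>"]
    unfolding real_closure_def topspace_toric_euclidean by blast
  then obtain \<tau>' x' where "\<tau>' \<in> \<Sigma>" "x' \<in> real_points (A \<tau>')" "p = chart N \<Sigma> \<tau>' x'"
    unfolding toric_real_points_def by blast
  then have yr: "y \<in> real_points (A \<rho>)"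
    using chart_eq_real[OF _ \<rho> _ y(1)] y(3) by blast
  have "y b = 0"
  proof (rule ccontr)
    assume "y b \<noteq> 0"
    then have "\<exists>i\<in>Poly_Mapping.keys b. \<forall>x\<in>\<rho>. i \<bullet> x = 0"
      using orbit_closure_nonvanishing_key[OF \<rho> y(1) _ b(1)] p(1) y(3) by simp
    then show False
      using primitive_ray_perp[OF ray] e(2) k(2) by (auto simp: b_def)
  qed
  \<comment> \<open>Near \<open>p\<close> the inequality is strict, whereas at points of
    \<open>S\<close> the equation \<open>a = b * f\<close> gives the opposite one. The absolute
    value of \<open>C\<close> provides the nonnegative constant that openness asks for.\<close>
  let ?W' = "chart N \<Sigma> \<rho> ` {y \<in> real_points (A \<rho>). \<bar>C\<bar> * norm (y b) < norm (y a)}"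
  have "p \<in> ?W'"
    using yr y(2,3) \<open>y b = 0\<close> by auto
  then obtain q where q: "q \<in> chart N \<Sigma> \<sigma> ` S" "q \<in> ?W'"
    using closure_of_meets_openin[OF p(2)[unfolded real_closure_def]
        openin_toric_euclidean_chart[OF \<rho> aA b(1) abs_ge_zero[of C]]] by blast
  obtain x where x: "x \<in> S" "q = chart N \<Sigma> \<sigma> x"
    using q(1) by blast
  obtain y' where y': "y' \<in> real_points (A \<rho>)" "\<bar>C\<bar> * norm (y' b) < norm (y' a)" "q = chart N \<Sigma> \<rho> y'"
    using q(2) by blast
  have pts: "x \<in> points (A \<sigma>)" "y' \<in> points (A \<rho>)"
    using x(1) S y'(1) real_points_subset by blast+
  obtain \<xi> where \<xi>: "monoid_hom N (\<sigma> \<inter> \<rho>) \<xi>" "x = hom_point N \<sigma> \<xi>" "y' = hom_point N \<rho> \<xi>"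
    using chart_eqE[OF \<sigma> \<rho> pts] x(2) y'(3) by metis
  have "eval_hom \<xi> (b * f) = eval_hom \<xi> b * eval_hom \<xi> f"
    using b(1) f(1) coordinate_ring_mono[of "\<sigma> \<inter> \<rho>" \<sigma> N] coordinate_ring_mono[of "\<sigma> \<inter> \<rho>" \<rho> N]
    by (intro eval_hom_mult[OF \<xi>(1)]) auto
  then have "norm (y' a) = norm (y' b) * norm (x f)"
    using aA b(1) f(1) by (simp add: \<xi>(2,3) hom_point_apply norm_mult flip: a_def)
  also have "\<dots> \<le> norm (y' b) * \<bar>C\<bar>"
    using f(2)[OF x(1)] by (intro mult_left_mono) auto
  finally show False
    using y'(2) by (simp add: mult.commute)
qed

end

section \<open>Characters that are bounded on the set\<close>

context complete_toric_fan
begin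

text \<open>At a limit \<open>\<zeta>\<close> of points of \<open>S\<close> every ray of the orbit
  cone lies in \<open>\<sigma>\<close> or belongs to a component met by the closure, so
  \<open>m\<close> is a character on the orbit cone. Near \<open>\<zeta>\<close> it is the quotient
  of \<open>m + L m1\<close>, at most 1 in absolute value on the polydisc, by a power of
  \<open>m1\<close>, which does not vanish at \<open>\<zeta>\<close>. Compactness turns these local
  bounds into one.\<close>

lemma character_bounded:
  assumes \<sigma>: "\<sigma> \<in> \<Sigma>" and S: "S \<subseteq> real_points (A \<sigma>)" and m: "m \<in> Q \<sigma>"
    and rays: "\<And>\<rho> u. primitive_ray \<rho> u \<Longrightarrow> \<not> \<rho> \<subseteq> \<sigma> \<Longrightarrow>
      orbit_closure \<rho> \<inter> real_closure N \<sigma> \<Sigma> S \<noteq> {} \<Longrightarrow> 0 \<le> m \<bullet> u"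
  shows "\<exists>c. \<forall>x\<in>S. norm (x (char_fun m)) \<le> c"
proof -
  define S' where "S' = (\<lambda>\<tau>. {\<zeta> \<in> unit_polydisc N \<tau>. tpoint \<tau> \<zeta> \<in> chart N \<Sigma> \<sigma> ` S})"
  \<comment> \<open>The character \<open>m\<close> need not be a function on the chart of
    \<open>\<tau>\<close>, so a bound on a part of the polydisc is stated for those \<open>x\<close>
    in \<open>S\<close> that are identified with its points.\<close>
  define B where "B = (\<lambda>\<tau> (O' :: ('a \<Rightarrow> complex) set) c. \<forall>\<xi>\<in>S' \<tau> \<inter> O'. \<forall>x\<in>S.
    chart N \<Sigma> \<sigma> x = tpoint \<tau> \<xi> \<longrightarrow> norm (x (char_fun m)) \<le> c)"
  have local: "\<exists>O' c. open O' \<and> \<zeta> \<in> O' \<and> B \<tau> O' c" if \<tau>: "\<tau> \<in> \<Sigma>" and \<zeta>: "\<zeta> \<in> closure (S' \<tau>)" for \<tau> \<zeta>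
  proof -
    have "closure (S' \<tau>) \<subseteq> unit_polydisc N \<tau>"
      by (intro closure_minimal closed_unit_polydisc) (auto simp: S'_def)
    then have \<zeta>D: "\<zeta> \<in> unit_polydisc N \<tau>"
      using \<zeta> by blast
    then have hom: "monoid_hom N \<tau> \<zeta>"
      by (simp add: unit_polydisc_def)
    \<comment> \<open>Limits in the space of functions give limits in the variety, because
      \<open>hom_point\<close> is continuous on the polydisc.\<close>
    have in_rc: "tpoint \<tau> \<zeta> \<in> real_closure N \<sigma> \<Sigma> S"
      unfolding real_closure_def in_closure_of topspace_toric_euclidean
    proof (intro conjI allI impI)
      have "hom_point N \<tau> \<zeta> \<in> real_points (A \<tau>)"
        using \<zeta>D by (simp add: unit_polydisc_def hom_point_real_iff)
      then show "tpoint \<tau> \<zeta> \<in> toric_real_points N \<Sigma>"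
        unfolding toric_real_points_def using \<tau> by blast
      fix W assume W: "tpoint \<tau> \<zeta> \<in> W \<and> openin (toric_euclidean N \<Sigma>) W"
      let ?P = "{x \<in> real_points (A \<tau>). chart N \<Sigma> \<tau> x \<in> W}"
      have "openin (affine_euclidean (A \<tau>)) ?P"
        using W \<tau> unfolding openin_toric_euclidean_iff by blast
      then have "openin (top_of_set (unit_polydisc N \<tau>))
          {\<xi> \<in> topspace (top_of_set (unit_polydisc N \<tau>)). hom_point N \<tau> \<xi> \<in> ?P}"
        by (rule openin_continuous_map_preimage[OF continuous_map_hom_point])
      then obtain O' where O': "open O'"
        "{\<xi> \<in> unit_polydisc N \<tau>. hom_point N \<tau> \<xi> \<in> ?P} = unit_polydisc N \<tau> \<inter> O'"
        unfolding openin_open by auto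
      have "\<zeta> \<in> O'"
        using O'(2) \<zeta>D W \<open>hom_point N \<tau> \<zeta> \<in> real_points (A \<tau>)\<close> by blast
      then obtain \<xi> where \<xi>: "\<xi> \<in> S' \<tau>" "\<xi> \<in> O'"
        using \<zeta> O'(1) unfolding closure_iff_nhds_not_empty by blast
      then have "\<xi> \<in> unit_polydisc N \<tau> \<inter> O'"
        by (simp add: S'_def)
      then have "tpoint \<tau> \<xi> \<in> W"
        unfolding O'(2)[symmetric] by blast
      then show "\<exists>y. y \<in> chart N \<Sigma> \<sigma> ` S \<and> y \<in> W"
        using \<xi>(1) unfolding S'_def by blast
    qed
    let ?\<delta> = "orbit_cone N \<tau> \<zeta>"
    have \<delta>: "?\<delta> \<in> \<Sigma>"
      by (rule orbit_cone_in_fan[OF \<tau> hom])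
    have "0 \<le> m \<bullet> u" if \<rho>: "primitive_ray \<rho> u" "\<rho> \<subseteq> ?\<delta>" for \<rho> u
    proof (cases "\<rho> \<subseteq> \<sigma>")
      case True
      then show ?thesis
        using m primitive_ray_in[OF \<rho>(1)] by (auto simp: character_monoid_def)
    next
      case False
      have "tpoint \<tau> \<zeta> \<in> orbit_closure \<rho>"
        using \<rho>(2) tpoint_in_orbit_closure_iff[OF \<tau> hom] by blast
      then show ?thesis
        using rays[OF \<rho>(1) False] in_rc by blast
    qed
    then have "0 \<le> m \<bullet> x" if "x \<in> ?\<delta>" for x
      using nonneg_on_rays_imp_nonneg[OF \<delta> _ that] by blast
    then have m\<delta>: "m \<in> Q ?\<delta>"
      using m by (simp add: character_monoid_def)
    obtain m1 where m1: "m1 \<in> Q \<tau>" "\<zeta> m1 \<noteq> 0" "?\<delta> = {x \<in> \<tau>. m1 \<bullet> x = 0}"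
      using orbit_cone_cut[OF \<tau> hom] by blast
    obtain L where L: "m + of_nat L *\<^sub>R m1 \<in> Q \<tau>"
      using localization[OF \<tau> m1(1,3) m\<delta>] by blast
    \<comment> \<open>Here the denominator stays above half its absolute value at
      \<open>\<zeta>\<close>, whence the constant
      \<open>(2 / norm (\<zeta> m1)) ^ L\<close>.\<close>
    define O' where "O' = {\<xi> :: 'a \<Rightarrow> complex. norm (\<zeta> m1) / 2 < norm (\<xi> m1)}"
    have "open O'"
      unfolding O'_def
      by (intro open_Collect_less continuous_on_const continuous_on_norm continuous_on_product_coordinates)
    moreover have "\<zeta> \<in> O'"
      using m1(2) by (simp add: O'_def)
    moreover have "B \<tau> O' ((2 / norm (\<zeta> m1)) ^ L)"
      unfolding B_def
    proof (intro ballI impI)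
      fix \<xi> x assume \<xi>: "\<xi> \<in> S' \<tau> \<inter> O'" and x: "x \<in> S" and eq: "chart N \<Sigma> \<sigma> x = tpoint \<tau> \<xi>"
      have \<xi>D: "\<xi> \<in> unit_polydisc N \<tau>"
        using \<xi> by (simp add: S'_def)
      have xp: "x \<in> points (A \<sigma>)"
        using x S real_points_subset by blast
      have \<xi>p: "hom_point N \<tau> \<xi> \<in> points (A \<tau>)"
        using \<xi>D by (intro hom_point_in_points) (simp add: unit_polydisc_def)
      obtain \<theta> where \<theta>: "monoid_hom N (\<sigma> \<inter> \<tau>) \<theta>" "x = hom_point N \<sigma> \<theta>" "hom_point N \<tau> \<xi> = hom_point N \<tau> \<theta>"
        using chart_eqE[OF \<sigma> \<tau> xp \<xi>p eq] by blast
      have agree: "\<xi> m' = \<theta> m'" if "m' \<in> Q \<tau>" for m'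
        using \<theta>(3) that by (simp add: hom_point_eq_iff)
      have "\<theta> (m + of_nat L *\<^sub>R m1) = \<theta> m * \<theta> m1 ^ L"
        using m m1(1) character_monoid_mono[of "\<sigma> \<inter> \<tau>" \<sigma> N] character_monoid_mono[of "\<sigma> \<inter> \<tau>" \<tau> N]
        by (intro hom_shift[OF \<theta>(1)]) auto
      then have "norm (\<xi> (m + of_nat L *\<^sub>R m1)) = norm (\<theta> m) * norm (\<xi> m1) ^ L"
        using agree[OF L] agree[OF m1(1)] by (simp add: norm_mult norm_power)
      moreover have "norm (\<xi> (m + of_nat L *\<^sub>R m1)) \<le> 1"
        using \<xi>D by (simp add: unit_polydisc_def)
      ultimately have le1: "norm (\<theta> m) * norm (\<xi> m1) ^ L \<le> 1"
        by simp
      have "norm (\<theta> m) * (norm (\<zeta> m1) / 2) ^ L \<le> norm (\<theta> m) * norm (\<xi> m1) ^ L"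
        using \<xi> by (intro mult_left_mono power_mono) (auto simp: O'_def)
      then have "norm (\<theta> m) * (norm (\<zeta> m1) / 2) ^ L \<le> 1"
        using le1 by simp
      then have "norm (\<theta> m) \<le> 1 / (norm (\<zeta> m1) / 2) ^ L"
        using m1(2) by (simp add: pos_le_divide_eq)
      also have "\<dots> = (2 / norm (\<zeta> m1)) ^ L"
        by (simp add: power_divide)
      finally show "norm (x (char_fun m)) \<le> (2 / norm (\<zeta> m1)) ^ L"
        by (simp add: \<theta>(2) hom_point_char[OF m])
    qed
    ultimately show ?thesis
      by blast
  qed
  have chartwise: "\<exists>c. B \<tau> UNIV c" if \<tau>: "\<tau> \<in> \<Sigma>" for \<tau>
  proof -
    let ?T = "closure (S' \<tau>)"
    have "?T \<subseteq> unit_polydisc N \<tau>"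
      by (intro closure_minimal closed_unit_polydisc) (auto simp: S'_def)
    then have "compact ?T"
      using compact_Int_closed[OF compact_unit_polydisc[of N \<tau>] closed_closure[of "S' \<tau>"]]
      by (simp add: inf.absorb2)
    have "\<forall>\<zeta>\<in>?T. \<exists>O' c. open O' \<and> \<zeta> \<in> O' \<and> B \<tau> O' c"
      using local[OF \<tau>] by blast
    then obtain O' c where O': "\<And>\<zeta>. \<zeta> \<in> ?T \<Longrightarrow> open (O' \<zeta>) \<and> \<zeta> \<in> O' \<zeta> \<and> B \<tau> (O' \<zeta>) (c \<zeta>)"
      by metis
    then have "\<And>\<zeta>. \<zeta> \<in> ?T \<Longrightarrow> open (O' \<zeta>)" "?T \<subseteq> (\<Union>\<zeta>\<in>?T. O' \<zeta>)"
      by blast+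
    then obtain D where D: "D \<subseteq> ?T" "finite D" "?T \<subseteq> (\<Union>\<zeta>\<in>D. O' \<zeta>)"
      using compactE_image[OF \<open>compact ?T\<close>] by blast
    have "B \<tau> UNIV (\<Sum>\<zeta>\<in>D. \<bar>c \<zeta>\<bar>)"
      unfolding B_def
    proof (intro ballI impI)
      fix \<xi> x assume \<xi>: "\<xi> \<in> S' \<tau> \<inter> UNIV" and x: "x \<in> S" and eq: "chart N \<Sigma> \<sigma> x = tpoint \<tau> \<xi>"
      obtain \<zeta> where \<zeta>: "\<zeta> \<in> D" "\<xi> \<in> O' \<zeta>"
        using \<xi> D(3) closure_subset by blast
      have "B \<tau> (O' \<zeta>) (c \<zeta>)"
        using O' D(1) \<zeta>(1) by blast
      then have "norm (x (char_fun m)) \<le> c \<zeta>"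
        using \<xi> \<zeta>(2) x eq unfolding B_def by blast
      also have "\<dots> \<le> \<bar>c \<zeta>\<bar>"
        by simp
      also have "\<dots> \<le> (\<Sum>\<zeta>\<in>D. \<bar>c \<zeta>\<bar>)"
        using D(2) \<zeta>(1) by (intro member_le_sum) auto
      finally show "norm (x (char_fun m)) \<le> (\<Sum>\<zeta>\<in>D. \<bar>c \<zeta>\<bar>)" .
    qed
    then show ?thesis
      by blast
  qed
  then obtain c where c: "\<And>\<tau>. \<tau> \<in> \<Sigma> \<Longrightarrow> B \<tau> UNIV (c \<tau>)"
    by metis
  have finite: "finite \<Sigma>"
    using fan by (simp add: is_fan_def)
  have "norm (x (char_fun m)) \<le> (\<Sum>\<tau>\<in>\<Sigma>. \<bar>c \<tau>\<bar>)" if x: "x \<in> S" for x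
  proof -
    have xr: "x \<in> real_points (A \<sigma>)"
      using x S by blast
    then have "x \<in> points (A \<sigma>)"
      by (simp add: real_points_def)
    then obtain \<zeta> where \<zeta>: "monoid_hom N \<sigma> \<zeta>" "x = hom_point N \<sigma> \<zeta>"
      by (rule pointsE)
    obtain \<tau> \<xi> where \<tau>: "\<tau> \<in> \<Sigma>" and \<xi>: "monoid_hom N (\<sigma> \<inter> \<tau>) \<xi>" "\<And>m. m \<in> Q \<sigma> \<Longrightarrow> \<xi> m = \<zeta> m"
      "\<And>m. m \<in> Q \<tau> \<Longrightarrow> norm (\<xi> m) \<le> 1"
      using unit_polydisc_cover[OF \<sigma> \<zeta>(1)] by blast
    have x\<xi>: "x = hom_point N \<sigma> \<xi>"
      using \<xi>(2) by (simp add: \<zeta>(2) hom_point_eq_iff)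
    have hom: "monoid_hom N \<sigma> \<xi>" "monoid_hom N \<tau> \<xi>"
      by (rule monoid_hom_mono[OF _ \<xi>(1)], simp)+
    have eq: "chart N \<Sigma> \<sigma> x = tpoint \<tau> \<xi>"
      unfolding x\<xi> by (rule tpoint_eqI[OF \<sigma> \<tau> \<xi>(1)])
    have "hom_point N \<tau> \<xi> \<in> real_points (A \<tau>)"
      by (rule chart_eq_real[OF \<sigma> \<tau> xr hom_point_in_points[OF hom(2)] eq])
    then have real: "\<xi> m \<in> \<real>" if "m \<in> Q \<tau>" for m
      using that hom_point_real_iff[OF hom(2)] by blast
    \<comment> \<open>The bound and reality of \<open>\<xi>\<close> are known only on
      \<open>Q \<tau>\<close>; the value 0 elsewhere gives the same point and an element of the
      polydisc.\<close>
    define \<xi>' where "\<xi>' = (\<lambda>m. if m \<in> Q \<tau> then \<xi> m else 0)"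
    have "monoid_hom N \<tau> \<xi>'"
      using monoid_hom_cong[of N \<tau> \<xi>' \<xi>] hom(2) by (simp add: \<xi>'_def)
    then have "\<xi>' \<in> unit_polydisc N \<tau>"
      using real \<xi>(3) by (simp add: unit_polydisc_def \<xi>'_def)
    moreover have eq': "chart N \<Sigma> \<sigma> x = tpoint \<tau> \<xi>'"
      unfolding eq by (intro arg_cong[where f = "chart N \<Sigma> \<tau>"]) (simp add: hom_point_eq_iff \<xi>'_def)
    ultimately have "\<xi>' \<in> S' \<tau> \<inter> UNIV"
      using x by (auto simp: S'_def)
    then have "norm (x (char_fun m)) \<le> c \<tau>"
      using c[OF \<tau>] x eq' unfolding B_def by blast
    also have "\<dots> \<le> \<bar>c \<tau>\<bar>"
      by simp
    also have "\<dots> \<le> (\<Sum>\<tau>\<in>\<Sigma>. \<bar>c \<tau>\<bar>)"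
      using finite \<tau> by (intro member_le_sum) auto
    finally show ?thesis .
  qed
  then show ?thesis
    by blast
qed

end

section \<open>Finite generation\<close>

text \<open>Let \<open>G0\<close> serve for the coordinates in \<open>I\<close>, and let
  \<open>K\<close> bound its values at the new coordinate \<open>j\<close>. Where the value at
  \<open>j\<close> is at least \<open>K\<close>, \<open>G0\<close> still serves; each of the
  finitely many smaller values is a slice to which the induction hypothesis applies.\<close>

lemma dickson:
  fixes v :: "'b \<Rightarrow> 'i \<Rightarrow> nat"
  assumes "finite I"
  shows "\<exists>G. finite G \<and> G \<subseteq> P \<and> (\<forall>p\<in>P. \<exists>g\<in>G. \<forall>i\<in>I. v g i \<le> v p i)"
  using assms
proof (induction I arbitrary: P rule: finite_induct)
  case empty
  show ?case
  proof (cases "P = {}")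
    case False
    then obtain p where "p \<in> P"
      by blast
    then show ?thesis
      by (intro exI[of _ "{p}"]) simp
  qed simp
next
  case (insert j I)
  obtain G0 where G0: "finite G0" "G0 \<subseteq> P" "\<forall>p\<in>P. \<exists>g\<in>G0. \<forall>i\<in>I. v g i \<le> v p i"
    using insert.IH[of P] by blast
  obtain K where K: "\<forall>g\<in>G0. v g j \<le> K"
    using finite_nat_set_iff_bounded_le[of "(\<lambda>g. v g j) ` G0"] G0(1) by auto
  have "\<forall>c. \<exists>G. finite G \<and> G \<subseteq> {p \<in> P. v p j = c} \<and>
      (\<forall>p\<in>{p \<in> P. v p j = c}. \<exists>g\<in>G. \<forall>i\<in>I. v g i \<le> v p i)"
    using insert.IH by blast
  from choice[OF this] obtain G where G': "\<forall>c. finite (G c) \<and> G c \<subseteq> {p \<in> P. v p j = c} \<and>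
      (\<forall>p\<in>{p \<in> P. v p j = c}. \<exists>g\<in>G c. \<forall>i\<in>I. v g i \<le> v p i)"
    by (rule exE)
  then have G: "\<And>c. finite (G c)" "\<And>c. G c \<subseteq> {p \<in> P. v p j = c}"
    "\<And>c p. p \<in> P \<Longrightarrow> v p j = c \<Longrightarrow> \<exists>g\<in>G c. \<forall>i\<in>I. v g i \<le> v p i"
    by simp_all
  have "\<exists>g\<in>G0 \<union> (\<Union>c<K. G c). \<forall>i\<in>insert j I. v g i \<le> v p i" if p: "p \<in> P" for p
  proof (cases "v p j < K")
    case True
    obtain g where g: "g \<in> G (v p j)" "\<forall>i\<in>I. v g i \<le> v p i"
      using G(3)[OF p refl] by blast
    then have "v g j = v p j"
      using G(2)[of "v p j"] by blast
    then show ?thesis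
      using g True by (intro bexI[of _ g]) auto
  next
    case False
    obtain g where g: "g \<in> G0" "\<forall>i\<in>I. v g i \<le> v p i"
      using G0(3) p by blast
    moreover have "v g j \<le> v p j"
      using K g(1) False by fastforce
    ultimately show ?thesis
      by (intro bexI[of _ g]) auto
  qed
  moreover have "finite (G0 \<union> (\<Union>c<K. G c))" "G0 \<union> (\<Union>c<K. G c) \<subseteq> P"
    using G0(1,2) G(1,2) by blast+
  ultimately show ?case
    by blast
qed

text \<open>The monomials of \<open>G\<close> generate: every term of \<open>f\<close> is a multiple
  of one of them by a monomial of \<open>P0\<close>.\<close>

lemma monomial_module_finitely_generated:
  fixes P P0 G :: "'a::comm_monoid_add set"
  assumes G: "finite G" "G \<subseteq> P" and add: "\<And>m m'. m \<in> P0 \<Longrightarrow> m' \<in> P \<Longrightarrow> m + m' \<in> P"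
    and cover: "\<And>m. m \<in> P \<Longrightarrow> \<exists>g\<in>G. \<exists>m'\<in>P0. m = m' + g"
  shows "finitely_generated_module {f :: 'a \<Rightarrow>\<^sub>0 real. Poly_Mapping.keys f \<subseteq> P0} {f. Poly_Mapping.keys f \<subseteq> P}"
  unfolding finitely_generated_module_def
proof (intro exI conjI)
  let ?X = "(char_fun :: 'a \<Rightarrow> 'a \<Rightarrow>\<^sub>0 real) ` G"
  let ?B = "{f :: 'a \<Rightarrow>\<^sub>0 real. Poly_Mapping.keys f \<subseteq> P0}" and ?L = "{f :: 'a \<Rightarrow>\<^sub>0 real. Poly_Mapping.keys f \<subseteq> P}"
  show finX: "finite ?X"
    using G(1) by simp
  show "?X \<subseteq> ?L"
    using G(2) by auto
  show "?L = {\<Sum>g\<in>?X. b g * g | b. \<forall>g\<in>?X. b g \<in> ?B}"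
  proof (intro subset_antisym subsetI)
    fix f assume "f \<in> {\<Sum>g\<in>?X. b g * g | b. \<forall>g\<in>?X. b g \<in> ?B}"
    then obtain b where b: "f = (\<Sum>g\<in>?X. b g * g)" "\<forall>g\<in>?X. Poly_Mapping.keys (b g) \<subseteq> P0"
      by auto
    have "k \<in> P" if k: "k \<in> Poly_Mapping.keys f" for k
    proof -
      obtain h where h: "h \<in> ?X" "k \<in> Poly_Mapping.keys (b h * h)"
        using keys_sum_obtain[of k "\<lambda>g. b g * g" ?X] k b(1) by blast
      then obtain g where g: "g \<in> G" "h = char_fun g"
        by blast
      obtain m m' where m: "m \<in> Poly_Mapping.keys (b h)" "m' \<in> Poly_Mapping.keys h" "k = m + m'"
        using keys_mult_obtain[OF h(2)] by blast
      have "m \<in> P0"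
        using b(2) h(1) m(1) by blast
      moreover have "m' \<in> P"
        using m(2) g G(2) by auto
      ultimately show ?thesis
        unfolding m(3) by (rule add)
    qed
    then show "f \<in> ?L"
      by blast
  next
    fix f assume "f \<in> ?L"
    then have f: "Poly_Mapping.keys f \<subseteq> P"
      by simp
    have "\<forall>m\<in>Poly_Mapping.keys f. \<exists>g m'. g \<in> G \<and> m' \<in> P0 \<and> m = m' + g"
      using f cover by blast
    then obtain \<gamma> \<mu> where \<gamma>: "\<And>m. m \<in> Poly_Mapping.keys f \<Longrightarrow> \<gamma> m \<in> G \<and> \<mu> m \<in> P0 \<and> m = \<mu> m + \<gamma> m"
      by metis
    \<comment> \<open>Each exponent \<open>m\<close> is assigned to one generator
      \<open>\<gamma> m\<close>; the coefficient of a generator collects the quotients of the terms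
      assigned to it.\<close>
    define b where "b = (\<lambda>h :: 'a \<Rightarrow>\<^sub>0 real. \<Sum>m\<in>{m \<in> Poly_Mapping.keys f. char_fun (\<gamma> m) = h}.
      Poly_Mapping.single (\<mu> m) (Poly_Mapping.lookup f m))"
    have "b h \<in> ?B" for h
    proof -
      have "k \<in> P0" if k: "k \<in> Poly_Mapping.keys (b h)" for k
      proof -
        obtain m where "m \<in> {m \<in> Poly_Mapping.keys f. char_fun (\<gamma> m) = h}"
          "k \<in> Poly_Mapping.keys (Poly_Mapping.single (\<mu> m) (Poly_Mapping.lookup f m))"
          using k unfolding b_def by (rule keys_sum_obtain)
        then show ?thesis
          using \<gamma>[of m] by (auto split: if_splits)
      qed
      then show ?thesis
        by blast
    qed
    moreover have "(\<Sum>h\<in>?X. b h * h) = f"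
    proof -
      have "b h * h = (\<Sum>m\<in>{m \<in> Poly_Mapping.keys f. char_fun (\<gamma> m) = h}.
          Poly_Mapping.single m (Poly_Mapping.lookup f m))" for h
        unfolding b_def sum_distrib_right
      proof (rule sum.cong[OF refl])
        fix m assume m: "m \<in> {m \<in> Poly_Mapping.keys f. char_fun (\<gamma> m) = h}"
        have "Poly_Mapping.single (\<mu> m) (Poly_Mapping.lookup f m) * char_fun (\<gamma> m) =
            Poly_Mapping.single (\<mu> m + \<gamma> m) (Poly_Mapping.lookup f m)"
          by (simp add: mult_single)
        then show "Poly_Mapping.single (\<mu> m) (Poly_Mapping.lookup f m) * h =
            Poly_Mapping.single m (Poly_Mapping.lookup f m)"
          using m \<gamma>[of m] by simp
      qed
      then have "(\<Sum>h\<in>?X. b h * h) = (\<Sum>h\<in>?X. \<Sum>m\<in>{m \<in> Poly_Mapping.keys f. char_fun (\<gamma> m) = h}.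
          Poly_Mapping.single m (Poly_Mapping.lookup f m))"
        by (simp only:)
      also have "\<dots> = (\<Sum>m\<in>Poly_Mapping.keys f. Poly_Mapping.single m (Poly_Mapping.lookup f m))"
        using \<gamma> by (intro sum.group finX) auto
      also have "\<dots> = f"
        by (rule poly_mapping_expansion[symmetric])
      finally show ?thesis .
    qed
    ultimately show "f \<in> {\<Sum>g\<in>?X. b g * g | b. \<forall>g\<in>?X. b g \<in> ?B}"
      by blast
  qed
qed

lemma semialgebraic_subset: "S \<in> semialgebraic_sets A \<Longrightarrow> S \<subseteq> real_points A"
  by (induction rule: semialgebraic_sets.induct) auto

lemma (in toric_fan) primitive_ray_inner_nonneg:
  assumes "primitive_ray \<rho> u" "primitive_ray \<rho> u'" "0 \<le> m \<bullet> u"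
  shows "0 \<le> m \<bullet> u'"
proof -
  have "u' \<in> \<rho>"
    by (rule primitive_ray_in[OF assms(2)])
  then obtain t where "0 \<le> t" "u' = t *\<^sub>R u"
    using assms(1) by (auto simp: primitive_ray_def convex_cone_hull_singleton)
  then show ?thesis
    using assms(3) by simp
qed

section \<open>The ring and the modules of a compatible completion as spans of monomials\<close>

locale compatible_toric_completion = complete_toric_fan +
  fixes \<sigma> :: "'a set" and S :: "'a point set"
  assumes \<sigma>: "\<sigma> \<in> \<Sigma>" and S: "S \<subseteq> real_points (A \<sigma>)" and compatible: "compatible_completion N \<sigma> \<Sigma> S"
begin

text \<open>The rays of the components that make up \<open>Y'\<close>.\<close>

definition limit_rays :: "'a set set" where
  "limit_rays = {\<rho>. (\<exists>u. primitive_ray \<rho> u) \<and> \<not> \<rho> \<subseteq> \<sigma> \<and> orbit_closure \<rho> \<inter> real_closure N \<sigma> \<Sigma> S \<noteq> {}}"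

definition ray_vector :: "'a set \<Rightarrow> 'a" where
  "ray_vector \<rho> = (SOME u. primitive_ray \<rho> u)"

definition order_monomials :: "nat \<Rightarrow> 'a set" where
  "order_monomials n = {m \<in> Q \<sigma>. \<forall>\<rho>\<in>limit_rays. - of_nat n \<le> m \<bullet> ray_vector \<rho>}"

lemma primitive_ray_vector: "\<rho> \<in> limit_rays \<Longrightarrow> primitive_ray \<rho> (ray_vector \<rho>)"
  unfolding limit_rays_def ray_vector_def by (auto intro: someI)

lemma finite_limit_rays: "finite limit_rays"
proof -
  have "limit_rays \<subseteq> \<Sigma>"
    unfolding limit_rays_def using primitive_ray_in_fan by blast
  then show ?thesis
    using fan finite_subset unfolding is_fan_def by blast
qed

lemma L_module_eq: "L_module N \<sigma> \<Sigma> n S = {f. Poly_Mapping.keys f \<subseteq> order_monomials n}"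
proof -
  have "f \<in> L_module N \<sigma> \<Sigma> n S \<longleftrightarrow> Poly_Mapping.keys f \<subseteq> order_monomials n" for f
  proof (cases "f = 0")
    case True
    then show ?thesis
      by (simp add: L_module_def coordinate_ring_0)
  next
    case False
    show ?thesis
    proof (cases "f \<in> A \<sigma>")
      case f: True
      have "(\<forall>Z\<in>boundary_components N \<sigma> \<Sigma>. Z \<inter> real_closure N \<sigma> \<Sigma> S \<noteq> {} \<longrightarrow> - int n \<le> order_along N \<Sigma> Z f) \<longleftrightarrow>
          (\<forall>\<rho>\<in>limit_rays. - int n \<le> order_along N \<Sigma> (orbit_closure \<rho>) f)"
        unfolding boundary_components_eq[OF \<sigma>] limit_rays_def by blast
      also have "\<dots> \<longleftrightarrow> (\<forall>\<rho>\<in>limit_rays. \<forall>m\<in>Poly_Mapping.keys f. - of_nat n \<le> m \<bullet> ray_vector \<rho>)"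
        by (intro ball_cong refl order_along_ge_iff[OF primitive_ray_vector f False])
      also have "\<dots> \<longleftrightarrow> Poly_Mapping.keys f \<subseteq> order_monomials n"
        using f unfolding order_monomials_def coordinate_ring_eq by blast
      finally show ?thesis
        using f False by (simp add: L_module_def)
    next
      case f: False
      then have "\<not> Poly_Mapping.keys f \<subseteq> order_monomials n"
        unfolding order_monomials_def coordinate_ring_eq by blast
      then show ?thesis
        using f by (simp add: L_module_def)
    qed
  qed
  then show ?thesis
    by blast
qed

text \<open>Together with \<open>L_module_eq\<close> this is the identity of the ring of bounded
  functions with the module for \<open>n = 0\<close>. Compatibility enters the first inclusion
  through \<open>bounded_imp_order_nonneg\<close>; for the second, \<open>character_bounded\<close>
  is applied to each monomial.\<close>

lemma bounded_functions_eq: "bounded_functions (A \<sigma>) S = {f. Poly_Mapping.keys f \<subseteq> order_monomials 0}"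
proof (intro subset_antisym subsetI)
  fix f assume "f \<in> bounded_functions (A \<sigma>) S"
  then obtain c where f: "f \<in> A \<sigma>" "\<And>x. x \<in> S \<Longrightarrow> norm (x f) \<le> c"
    unfolding bounded_functions_def by blast
  have "m \<in> order_monomials 0" if m: "m \<in> Poly_Mapping.keys f" for m
  proof -
    have "0 \<le> m \<bullet> ray_vector \<rho>" if \<rho>: "\<rho> \<in> limit_rays" for \<rho>
    proof (rule bounded_imp_order_nonneg[where C = c, OF \<sigma> _ primitive_ray_vector[OF \<rho>] f(1) _ _ m])
      show "norm (x f) \<le> c" if "x \<in> S" for x
        using that by (rule f(2))
      show "S \<subseteq> points (A \<sigma>)"
        using S real_points_subset by blast
      have "orbit_closure \<rho> \<in> boundary_components N \<sigma> \<Sigma>" "orbit_closure \<rho> \<inter> real_closure N \<sigma> \<Sigma> S \<noteq> {}"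
        using \<rho> unfolding boundary_components_eq[OF \<sigma>] limit_rays_def by blast+
      then show "orbit_closure \<rho> \<subseteq> toric_zariski N \<Sigma> closure_of (orbit_closure \<rho> \<inter> real_closure N \<sigma> \<Sigma> S)"
        using compatible unfolding compatible_completion_def by blast
    qed
    then show ?thesis
      using f(1) m unfolding order_monomials_def coordinate_ring_eq by auto
  qed
  then show "f \<in> {f. Poly_Mapping.keys f \<subseteq> order_monomials 0}"
    by blast
next
  fix f :: "'a \<Rightarrow>\<^sub>0 real"
  assume "f \<in> {f. Poly_Mapping.keys f \<subseteq> order_monomials 0}"
  then have f: "Poly_Mapping.keys f \<subseteq> order_monomials 0"
    by simp
  then have fA: "f \<in> A \<sigma>"
    by (auto simp: coordinate_ring_eq order_monomials_def)
  have "\<exists>c. \<forall>x\<in>S. norm (x (char_fun m)) \<le> c" if m: "m \<in> Poly_Mapping.keys f" for m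
  proof (rule character_bounded[OF \<sigma> S])
    show "m \<in> Q \<sigma>"
      using m f by (auto simp: order_monomials_def)
    fix \<rho> u assume ray: "primitive_ray \<rho> u" "\<not> \<rho> \<subseteq> \<sigma>" "orbit_closure \<rho> \<inter> real_closure N \<sigma> \<Sigma> S \<noteq> {}"
    then have \<rho>: "\<rho> \<in> limit_rays"
      unfolding limit_rays_def by blast
    then have "0 \<le> m \<bullet> ray_vector \<rho>"
      using m f by (auto simp: order_monomials_def)
    then show "0 \<le> m \<bullet> u"
      by (rule primitive_ray_inner_nonneg[OF primitive_ray_vector[OF \<rho>] ray(1)])
  qed
  then obtain c where c: "\<And>m x. m \<in> Poly_Mapping.keys f \<Longrightarrow> x \<in> S \<Longrightarrow> norm (x (char_fun m)) \<le> c m"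
    by metis
  have "norm (x f) \<le> (\<Sum>m\<in>Poly_Mapping.keys f. \<bar>Poly_Mapping.lookup f m\<bar> * c m)" if x: "x \<in> S" for x
  proof -
    have "x \<in> points (A \<sigma>)"
      using x S real_points_subset by blast
    then obtain \<zeta> where \<zeta>: "monoid_hom N \<sigma> \<zeta>" "x = hom_point N \<sigma> \<zeta>"
      by (rule pointsE)
    have "norm (x f) \<le> (\<Sum>m\<in>Poly_Mapping.keys f. norm (of_real (Poly_Mapping.lookup f m) * \<zeta> m))"
      unfolding \<zeta>(2) hom_point_apply[OF fA] eval_hom_def by (rule norm_sum)
    also have "\<dots> \<le> (\<Sum>m\<in>Poly_Mapping.keys f. \<bar>Poly_Mapping.lookup f m\<bar> * c m)"
    proof (rule sum_mono)
      fix m assume m: "m \<in> Poly_Mapping.keys f"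
      then have "m \<in> Q \<sigma>"
        using f by (auto simp: order_monomials_def)
      then have "norm (\<zeta> m) \<le> c m"
        using c[OF m x] by (simp add: \<zeta>(2) hom_point_char)
      then show "norm (of_real (Poly_Mapping.lookup f m) * \<zeta> m) \<le> \<bar>Poly_Mapping.lookup f m\<bar> * c m"
        by (simp add: norm_mult mult_left_mono)
    qed
    finally show ?thesis .
  qed
  then show "f \<in> bounded_functions (A \<sigma>) S"
    unfolding bounded_functions_def using fA by blast
qed

text \<open>Membership is expressed by finitely many integral forms, the generators of
  \<open>\<sigma>\<close> and the vectors of the limit rays. If every form is at most as large at
  \<open>g\<close> as at \<open>m\<close>, then \<open>m - g\<close> satisfies the inequalities with
  \<open>n = 0\<close>.\<close>

lemma order_monomials_finitely_generated:
  "\<exists>G. finite G \<and> G \<subseteq> order_monomials n \<and>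
    (\<forall>m\<in>order_monomials n. \<exists>g\<in>G. \<exists>m'\<in>order_monomials 0. m = m' + g)"
proof -
  obtain H where H: "finite H" "H \<subseteq> N" "\<sigma> = convex_cone hull H"
    using cone_generators[OF \<sigma>] by blast
  let ?I = "H \<union> ray_vector ` limit_rays"
  \<comment> \<open>The shift by \<open>n\<close> turns all values into natural numbers: on
    \<open>order_monomials n\<close> the forms from \<open>H\<close> are nonnegative, those from the
    rays at least \<open>- n\<close>.\<close>
  define v where "v = (\<lambda>(m::'a) (i::'a). nat \<lfloor>m \<bullet> i + of_nat n\<rfloor>)"
  have "finite ?I"
    using H(1) finite_limit_rays by simp
  then obtain G where G: "finite G" "G \<subseteq> order_monomials n"
    "\<forall>m\<in>order_monomials n. \<exists>g\<in>G. \<forall>i\<in>?I. v g i \<le> v m i"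
    using dickson[of ?I "order_monomials n" v] by blast
  have dual: "m \<in> dual_lattice N" if "m \<in> order_monomials n" for m
    using that by (simp add: order_monomials_def character_monoid_def)
  have int: "m \<bullet> i \<in> \<int>" if "m \<in> order_monomials n" "i \<in> ?I" for m i
    using that(2) dual[OF that(1)] dual_lattice_inner_Ints H(2) primitive_ray_Ints primitive_ray_vector by blast
  have ge: "0 \<le> m \<bullet> i + of_nat n" if m: "m \<in> order_monomials n" and i: "i \<in> ?I" for m i
  proof (cases "i \<in> H")
    case True
    then have "i \<in> \<sigma>"
      using H(3) by (simp add: hull_inc)
    then have "0 \<le> m \<bullet> i"
      using m by (simp add: order_monomials_def character_monoid_def)
    then show ?thesis
      by simp
  next
    case False
    then obtain \<rho> where "\<rho> \<in> limit_rays" "i = ray_vector \<rho>"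
      using i by blast
    then have "- of_nat n \<le> m \<bullet> i"
      using m by (simp add: order_monomials_def)
    then show ?thesis
      by simp
  qed
  have "\<exists>g\<in>G. \<exists>m'\<in>order_monomials 0. m = m' + g" if m: "m \<in> order_monomials n" for m
  proof -
    obtain g where g: "g \<in> G" "\<forall>i\<in>?I. v g i \<le> v m i"
      using G(3) m by blast
    have gm: "g \<in> order_monomials n"
      using g(1) G(2) by blast
    have le: "0 \<le> (m - g) \<bullet> i" if i: "i \<in> ?I" for i
    proof -
      obtain a where a: "m \<bullet> i = of_int a"
        using int[OF m i] by (elim Ints_cases)
      obtain b where b: "g \<bullet> i = of_int b"
        using int[OF gm i] by (elim Ints_cases)
      have "real_of_int 0 \<le> real_of_int (a + int n)" "real_of_int 0 \<le> real_of_int (b + int n)"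
        using ge[OF m i] ge[OF gm i] by (simp_all add: a b)
      then have "0 \<le> a + int n" "0 \<le> b + int n"
        by (simp_all only: of_int_le_iff)
      moreover have "v m i = nat (a + int n)" "v g i = nat (b + int n)"
        by (simp_all add: v_def a b)
      moreover have "v g i \<le> v m i"
        using g(2) i by blast
      ultimately have "b \<le> a"
        by simp
      then show ?thesis
        by (simp add: inner_diff_left a b)
    qed
    have "m - g \<in> dual_lattice N"
      by (intro additive_subgroup_diff additive_subgroup_dual_lattice dual m gm)
    moreover have "0 \<le> (m - g) \<bullet> x" if x: "x \<in> \<sigma>" for x
    proof (rule convex_cone_hull_nonneg)
      show "0 \<le> (m - g) \<bullet> h" if "h \<in> H" for h
        using that by (intro le) simp
      show "x \<in> convex_cone hull H"
        using x by (simp only: H(3))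
    qed
    moreover have "0 \<le> (m - g) \<bullet> ray_vector \<rho>" if "\<rho> \<in> limit_rays" for \<rho>
      using that by (intro le) simp
    ultimately have "m - g \<in> order_monomials 0"
      by (simp add: order_monomials_def character_monoid_def)
    then show ?thesis
      using g(1) by (intro bexI[of _ g] bexI[of _ "m - g"]) auto
  qed
  then show ?thesis
    using G(1,2) by blast
qed

lemma L_module_finitely_generated:
  "finitely_generated_module (bounded_functions (A \<sigma>) S) (L_module N \<sigma> \<Sigma> n S)"
proof -
  obtain G where G: "finite G" "G \<subseteq> order_monomials n"
    "\<forall>m\<in>order_monomials n. \<exists>g\<in>G. \<exists>m'\<in>order_monomials 0. m = m' + g"
    using order_monomials_finitely_generated[of n] by (elim exE conjE)
  have add: "m + m' \<in> order_monomials n" if m: "m \<in> order_monomials 0" "m' \<in> order_monomials n" for m m'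
    unfolding order_monomials_def
  proof (intro CollectI conjI ballI)
    show "m + m' \<in> Q \<sigma>"
      using m by (intro character_monoid_add) (simp_all add: order_monomials_def)
    fix \<rho> assume \<rho>: "\<rho> \<in> limit_rays"
    have "0 \<le> m \<bullet> ray_vector \<rho>" "- of_nat n \<le> m' \<bullet> ray_vector \<rho>"
      using m \<rho> by (simp_all add: order_monomials_def)
    then show "- of_nat n \<le> (m + m') \<bullet> ray_vector \<rho>"
      by (simp add: inner_add_left)
  qed
  show ?thesis
    unfolding bounded_functions_eq L_module_eq
    by (rule monomial_module_finitely_generated[OF G(1,2) add]) (use G(3) in blast)+
qed

end

theorem corollary4p6:
  fixes N \<sigma> :: "'a::euclidean_space set"
    and \<Sigma> :: "'a set set"
    and S :: "'a point set"
  assumes "is_lattice N"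
    and "strongly_convex_rational_cone N \<sigma>"
    and "S \<in> semialgebraic_sets (coordinate_ring N \<sigma>)"
    and "toric_completion N \<sigma> \<Sigma>"
    and "compatible_completion N \<sigma> \<Sigma> S"
  shows "\<forall>n. finitely_generated_module (bounded_functions (coordinate_ring N \<sigma>) S)
               (L_module N \<sigma> \<Sigma> n S)"
proof -
  have "is_fan N \<Sigma>" "\<sigma> \<in> \<Sigma>"
    and closed: "\<forall>k. closed_map (toric_product_zariski k N \<Sigma>) (affine_space_zariski k) snd"
    using assms(4) unfolding toric_completion_def complete_toric_variety_def by blast+
  moreover have "\<Sigma> \<noteq> {}"
    using \<open>\<sigma> \<in> \<Sigma>\<close> by blast
  moreover have "S \<subseteq> real_points (coordinate_ring N \<sigma>)"
    using assms(3) by (rule semialgebraic_subset)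
  ultimately interpret compatible_toric_completion N \<Sigma> \<sigma> S
    using assms(1,5) by unfold_locales blast+
  show ?thesis
    using L_module_finitely_generated by blast
qed

end
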